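(* Let $(X,d,\sigma)$ be a compatible metric-topological space with $(X,d)$ complete, let $\phi:X\to(-\infty,\infty]$ be proper and satisfy the LSCC assumptions with coercivity constant $\mathsf B$, and let $\varepsilon>0$ with $\frac1{16\varepsilon}\ge\mathsf B$. If $x\in D(V_\varepsilon)$ and $u_\varepsilon\in\mathcal M_\varepsilon(x)$, then the map $t\mapsto V_\varepsilon(u_\varepsilon(t))$ is absolutely continuous, and for a.e. $t\in(0,\infty)$ $$-\frac{d}{dt}V_\varepsilon(u_\varepsilon(t))=\frac12|u_\varepsilon'|^2(t)+\frac1\varepsilon\phi(u_\varepsilon(t))-\frac1\varepsilon V_\varepsilon(u_\varepsilon(t))=\frac12|u_\varepsilon'|^2(t)+\frac12G_\varepsilon^2(u_\varepsilon(t)),$$ $$V_\varepsilon(u_\varepsilon(t))=\phi(u_\varepsilon(t))-\frac\varepsilon2|u_\varepsilon'|^2(t).$$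
   Context: **Setting.** $(X,d)$ is a complete metric space and $\sigma$ is a Hausdorff topology on $X$; $(X,d,\sigma)$ is called compatible if (MT1) $u_n\to u$ and $v_n\to v$ in $\sigma$ imply $\liminf_n d(u_n,v_n)\ge d(u,v)$; (MT2) for every $\sigma$-open set $U$ and $x\in U$ there exist a $\sigma$-open neighborhood $V$ of $x$ and $\delta>0$ such that $d(y,V)<\delta$ implies $y\in U$, where $d(y,V)=\inf_{v\in V}d(y,v)$. For an interval $I\subset\mathbb R$ and $p\in[1,\infty]$, $AC^p(I;X)$ is the set of curves $u:I\to X$ for which there is $m\in L^p(I)$ with $d(u(s),u(t))\le\int_s^t m(r)\,dr$ for all $s\le t$ in $I$; $AC^p_{\rm loc}(I;X)$ is the set of curves belonging to $AC^p(J;X)$ for every compact interval $J\subset I$. The metric derivative $|u'|(t)=\lim_{s\to t}\frac{d(u(s),u(t))}{|t-s|}$ exists for a.e. $t\in I$. **LSCC assumptions.** $\phi:X\to(-\infty,\infty]$ is proper, and: (Lower semicontinuity) if $\sup_{n,m}d(u_n,u_m)<\infty$ and $u_n\to u$ in $\sigma$, then $\liminf_n\phi(u_n)\ge\phi(u)$; (Compactness) every sequence with $\sup_n\phi(u_n)<\infty$ and $\sup_{n,m}d(u_n,u_m)<\infty$ has a $\sigma$-convergent subsequence; (Coercivity) there are $u_*\in X$ and constants $\mathsf A,\mathsf B\ge0$ such that $\phi(u)\ge-\mathsf B\,d^2(u,v)-\mathsf Q(v)$ for all $u,v\in X$, where $\mathsf Q(v)=\mathsf B\,d^2(v,u_*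 )+\mathsf A$. **WED functional and value function.** $\mu_\varepsilon$ is the probability measure on $(0,\infty)$ with density $\frac1\varepsilon e^{-t/\varepsilon}$; $\mathcal I_\varepsilon[u]=\int_0^\infty\big(\frac\varepsilon2|u'|^2+\phi(u)\big)\,d\mu_\varepsilon$ for $u\in\mathscr C_\varepsilon(x)=\{u\in AC^2_{\rm loc}([0,\infty);X): u(0)=x,\ \int_0^\infty|u'|^2\,d\mu_\varepsilon<\infty\}$; $\mathcal M_\varepsilon(x)$ is the set of minimizers of $\mathcal I_\varepsilon$ in $\mathscr C_\varepsilon(x)$. The value function is $V_\varepsilon(x)=\inf_{u\in\mathscr C_\varepsilon(x)}\mathcal I_\varepsilon[u]$, $D(V_\varepsilon)=\{V_\varepsilon<\infty\}$. Set $G_\varepsilon(x)=\sqrt{2(\phi(x)-V_\varepsilon(x))/\varepsilon}$ if $x\in D(V_\varepsilon)$ and $G_\varepsilon(x)=\infty$ otherwise.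
   Formalization: "Absolutely continuous" is proved as local absolute continuity on [0,∞), i.e. on every compact subinterval including 0; the global version with integrable derivative on (0,∞) fails, e.g. for X=ℝ, φ(u)=−u, where V(u(t))=−t+const. *)

theory Defs
  imports "HOL-Analysis.Analysis"
begin

section \<open>Compatible metric-topological spaces\<close>

definition compatible :: "'a::metric_space topology \<Rightarrow> bool" where
  "compatible \<sigma> \<longleftrightarrow>
     topspace \<sigma> = UNIV \<and> Hausdorff_space \<sigma> \<and>
     (\<forall>(u::nat \<Rightarrow> 'a) v x y.
        limitin \<sigma> u x sequentially \<and> limitin \<sigma> v y sequentially \<longrightarrow>
        ereal (dist x y) \<le> liminf (\<lambda>n. ereal (dist (u n) (v n)))) \<and>
     (\<forall>U x. openin \<sigma> U \<and> x \<in> U \<longrightarrow>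
        (\<exists>V \<delta>. openin \<sigma> V \<and> x \<in> V \<and> \<delta> > 0 \<and> (\<forall>y. infdist y V < \<delta> \<longrightarrow> y \<in> U)))"

section \<open>Absolutely continuous curves\<close>

text \<open>Curves on an interval \<open>I\<close> are total functions on the reals of which only the
  restriction to \<open>I\<close> matters. Only finite exponents \<open>p \<ge> 1\<close> are covered; none of the
  notions below needs \<open>p = \<infinity>\<close>.\<close>

definition in_Lp :: "real \<Rightarrow> real set \<Rightarrow> (real \<Rightarrow> real) \<Rightarrow> bool" where
  "in_Lp p I m \<longleftrightarrow>
     set_borel_measurable lborel I m \<and> set_integrable lborel I (\<lambda>r. \<bar>m r\<bar> powr p)"

definition AC :: "real \<Rightarrow> real set \<Rightarrow> (real \<Rightarrow> 'a::metric_space) set" where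
  "AC p I = {u. \<exists>m. in_Lp p I m \<and>
     (\<forall>s\<in>I. \<forall>t\<in>I. s \<le> t \<longrightarrow> dist (u s) (u t) \<le> set_lebesgue_integral lborel {s..t} m)}"

definition AC_loc :: "real \<Rightarrow> real set \<Rightarrow> (real \<Rightarrow> 'a::metric_space) set" where
  "AC_loc p I = {u. \<forall>a b. {a..b} \<subseteq> I \<longrightarrow> u \<in> AC p {a..b}}"

text \<open>The metric derivative. Where the limit does not exist (a null set for absolutely
  continuous curves) the value is an unspecified real number, the same at all such points.
  It is used at interior points of the interval only.\<close>

definition metric_deriv :: "(real \<Rightarrow> 'a::metric_space) \<Rightarrow> real \<Rightarrow> real" where
  "metric_deriv u t = Lim (at t) (\<lambda>s. dist (u s) (u t) / \<bar>t - s\<bar>)"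

section \<open>Assumptions on the functional\<close>

text \<open>Functions with values in \<open>(-\<infinity>,\<infinity>]\<close> that are not identically \<open>\<infinity>\<close>.\<close>

definition proper_fun :: "('a \<Rightarrow> ereal) \<Rightarrow> bool" where
  "proper_fun \<phi> \<longleftrightarrow> (\<forall>x. \<phi> x \<noteq> -\<infinity>) \<and> (\<exists>x. \<phi> x \<noteq> \<infinity>)"

definition dist_bounded :: "(nat \<Rightarrow> 'a::metric_space) \<Rightarrow> bool" where
  "dist_bounded u \<longleftrightarrow> bdd_above (range (\<lambda>(n, m). dist (u n) (u m)))"

definition seq_lsc :: "'a::metric_space topology \<Rightarrow> ('a \<Rightarrow> ereal) \<Rightarrow> bool" where
  "seq_lsc \<sigma> \<phi> \<longleftrightarrow>
     (\<forall>u x. dist_bounded u \<and> limitin \<sigma> u x sequentially \<longrightarrow> \<phi> x \<le> liminf (\<lambda>n. \<phi> (u n)))"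

definition compact_sublevels :: "'a::metric_space topology \<Rightarrow> ('a \<Rightarrow> ereal) \<Rightarrow> bool" where
  "compact_sublevels \<sigma> \<phi> \<longleftrightarrow>
     (\<forall>u. (SUP n. \<phi> (u n)) < \<infinity> \<and> dist_bounded u \<longrightarrow>
        (\<exists>r x. strict_mono (r :: nat \<Rightarrow> nat) \<and> limitin \<sigma> (u \<circ> r) x sequentially))"

definition coercive :: "('a::metric_space \<Rightarrow> ereal) \<Rightarrow> real \<Rightarrow> real \<Rightarrow> 'a \<Rightarrow> bool" where
  "coercive \<phi> A B ustar \<longleftrightarrow> A \<ge> 0 \<and> B \<ge> 0 \<and>
     (\<forall>u v. \<phi> u \<ge> ereal (- B * (dist u v)\<^sup>2 - (B * (dist v ustar)\<^sup>2 + A)))"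

definition LSCC ::
  "'a::metric_space topology \<Rightarrow> ('a \<Rightarrow> ereal) \<Rightarrow> real \<Rightarrow> real \<Rightarrow> 'a \<Rightarrow> bool" where
  "LSCC \<sigma> \<phi> A B ustar \<longleftrightarrow> seq_lsc \<sigma> \<phi> \<and> compact_sublevels \<sigma> \<phi> \<and> coercive \<phi> A B ustar"

section \<open>The WED functional and the value function\<close>

definition mu :: "real \<Rightarrow> real measure" where
  "mu \<epsilon> = density lborel (\<lambda>t. ennreal (indicator {0<..} t * (1 / \<epsilon>) * exp (- t / \<epsilon>)))"

text \<open>Integral of an extended-real function, as positive part minus negative part. In
  \<^typ>\<open>ereal\<close> one has \<open>\<infinity> - \<infinity> = \<infinity>\<close>; that case does not arise for the WED functional on
  \<open>admissible_curves\<close>, because coercivity of \<open>\<phi>\<close> makes the negative part integrable.\<close>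

definition ereal_integral :: "'b measure \<Rightarrow> ('b \<Rightarrow> ereal) \<Rightarrow> ereal" where
  "ereal_integral M f =
     enn2ereal (\<integral>\<^sup>+ t. e2ennreal (f t) \<partial>M) - enn2ereal (\<integral>\<^sup>+ t. e2ennreal (- f t) \<partial>M)"

definition admissible_curves :: "real \<Rightarrow> 'a::metric_space \<Rightarrow> (real \<Rightarrow> 'a) set" where
  "admissible_curves \<epsilon> x =
     {u \<in> AC_loc 2 {0..}. u 0 = x \<and> (\<integral>\<^sup>+ t. ennreal ((metric_deriv u t)\<^sup>2) \<partial>mu \<epsilon>) < \<infinity>}"

definition WED :: "('a::metric_space \<Rightarrow> ereal) \<Rightarrow> real \<Rightarrow> (real \<Rightarrow> 'a) \<Rightarrow> ereal" where
  "WED \<phi> \<epsilon> u =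
     ereal_integral (mu \<epsilon>) (\<lambda>t. ereal (\<epsilon> / 2 * (metric_deriv u t)\<^sup>2) + \<phi> (u t))"

definition WED_minimizers ::
  "('a::metric_space \<Rightarrow> ereal) \<Rightarrow> real \<Rightarrow> 'a \<Rightarrow> (real \<Rightarrow> 'a) set" where
  "WED_minimizers \<phi> \<epsilon> x =
     {u \<in> admissible_curves \<epsilon> x. \<forall>v \<in> admissible_curves \<epsilon> x. WED \<phi> \<epsilon> u \<le> WED \<phi> \<epsilon> v}"

definition value_fun :: "('a::metric_space \<Rightarrow> ereal) \<Rightarrow> real \<Rightarrow> 'a \<Rightarrow> ereal" where
  "value_fun \<phi> \<epsilon> x = (INF u \<in> admissible_curves \<epsilon> x. WED \<phi> \<epsilon> u)"

definition value_dom :: "('a::metric_space \<Rightarrow> ereal) \<Rightarrow> real \<Rightarrow> 'a set" where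
  "value_dom \<phi> \<epsilon> = {x. value_fun \<phi> \<epsilon> x < \<infinity>}"

text \<open>Square root on \<open>[0,\<infinity>]\<close>.\<close>

definition ereal_sqrt :: "ereal \<Rightarrow> ereal" where
  "ereal_sqrt y = (if y = \<infinity> then \<infinity> else ereal (sqrt (real_of_ereal y)))"

definition G_fun :: "('a::metric_space \<Rightarrow> ereal) \<Rightarrow> real \<Rightarrow> 'a \<Rightarrow> ereal" where
  "G_fun \<phi> \<epsilon> x =
     (if x \<in> value_dom \<phi> \<epsilon>
      then ereal_sqrt (2 * (\<phi> x - value_fun \<phi> \<epsilon> x) / ereal \<epsilon>) else \<infinity>)"

end

theory Submission
  imports Defs
begin

text \<open>
  Put \<open>F t = value_fun \<phi> \<epsilon> (u t)\<close> for a minimizer \<open>u\<close>, let \<open>g\<close> be its metric speed and \<open>f\<close> a real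
  version of \<open>\<phi> \<circ> u\<close>. The proof is dynamic programming, followed by a comparison of \<open>u\<close> with curves
  that run along \<open>u\<close> a little faster or a little slower.

  A tail of a minimizer is again a minimizer, since a cheaper continuation from \<open>u t\<close> could be glued
  to the initial piece of \<open>u\<close> (\<open>value_along_minimizer\<close>). Hence \<open>F t\<close> is the cost of the tail of \<open>u\<close> after
  time \<open>t\<close>. Additivity of the integral (\<open>wed_cost_split\<close>) turns this into
  \<open>F t = exp (t / \<epsilon>) * (F 0 - (LINT r:{0..t}|lborel. l r))\<close>, where
  \<open>l r = (\<epsilon> / 2 * (g r)\<^sup>2 + f r) * exp (- r / \<epsilon>) / \<epsilon>\<close>. So \<open>F\<close> is locally absolutely continuous, and
  Lebesgue's differentiation theorem gives the first identity
  \<open>- F' = g\<^sup>2 / 2 + f / \<epsilon> - F / \<epsilon>\<close> almost everywhere.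

  For the remaining identities, run through \<open>u\<close> from \<open>u s\<close> with speed factor \<open>c\<close> during a time \<open>\<delta>\<close> and
  then follow \<open>u\<close> at its own speed. The cost of this competitor is at least \<open>F s\<close>
  (\<open>reparametrization_inequality\<close>), with equality for \<open>\<delta> = 0\<close>. The right derivative at \<open>\<delta> = 0\<close> is therefore
  nonnegative, that is, \<open>0 \<le> c\<^sup>2 / 2 * g\<^sup>2 + f / \<epsilon> - F / \<epsilon> + c * F'\<close> at almost every \<open>s\<close>
  (\<open>first_variation_inequality\<close>); a sequence of factors \<open>c\<close> tending to 1 from both sides is enough.
  The first identity is equality for \<open>c = 1\<close>. So \<open>c = 1\<close> minimizes the right side, its derivative in \<open>c\<close> vanishes there, and \<open>F' = - g\<^sup>2\<close> (\<open>stationary_speed\<close>). Inserted in the first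
  identity this says \<open>F = f - \<epsilon> / 2 * g\<^sup>2\<close>, and the identity for the slope \<open>G\<close> follows.

  For curves in a metric space the argument rests on the following facts. Integrable functions on the line are
  almost everywhere the derivative of their integral (\<open>lebesgue_differentiation\<close>), and absolutely
  continuous curves have a metric derivative whose integral bounds the distance
  (\<open>metric_derivative_exists\<close>); both are deduced from Vitali's covering theorem. The functional \<open>\<phi>\<close> is
  lower semicontinuous for the metric, hence Borel along curves, because compatibility makes
  metric convergence stronger than convergence in \<open>\<sigma>\<close>. Finally, a weighted Poincare
  inequality (\<open>weighted_poincare\<close>) and coercivity make the negative part of the running cost
  integrable, so that an admissible curve with cost below \<open>\<infinity>\<close> has an integrable real running cost
  (\<open>finite_cost_exists\<close>).
\<close>

section \<open>Vitali coverings and Lebesgue differentiation on the line\<close>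

text \<open>Vitali's covering theorem for closed balls, read for intervals given by their end points. The point \<open>x\<close>
  may lie anywhere in the covering interval; below it is an end point.\<close>

lemma vitali_intervals:
  fixes K :: "(real \<times> real) set"
  assumes lt: "\<And>c d. (c, d) \<in> K \<Longrightarrow> c < d"
    and fine: "\<And>x \<delta>. x \<in> S \<Longrightarrow> \<delta> > 0 \<Longrightarrow> \<exists>c d. (c, d) \<in> K \<and> x \<in> {c..d} \<and> d - c < \<delta>"
  obtains C N where "countable C" "C \<subseteq> K" "disjoint_family_on (\<lambda>p. {fst p..snd p}) C"
    "N \<in> null_sets lborel" "S \<subseteq> (\<Union>p\<in>C. {fst p..snd p}) \<union> N"
proof -
  define mid where "mid = (\<lambda>p::real\<times>real. (fst p + snd p) / 2)"
  define rad where "rad = (\<lambda>p::real\<times>real. (snd p - fst p) / 2)"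
  have cb: "cball (mid p) (rad p) = {fst p..snd p}" for p
    by (auto simp: mid_def rad_def cball_eq_atLeastAtMost field_simps)
  obtain C where C: "countable C" "C \<subseteq> K"
     "pairwise (\<lambda>i j. disjnt (cball (mid i) (rad i)) (cball (mid j) (rad j))) C"
     "negligible (S - (\<Union>i \<in> C. cball (mid i) (rad i)))"
  proof (rule Vitali_covering_theorem_cballs[of K rad S mid])
    show "0 < rad i" if "i \<in> K" for i using lt[of "fst i" "snd i"] that by (simp add: rad_def)
    show "\<exists>i. i \<in> K \<and> x \<in> cball (mid i) (rad i) \<and> rad i < d" if xd: "x \<in> S" "0 < d" for x d
    proof -
      from fine[OF xd] obtain c e where "(c, e) \<in> K" "x \<in> {c..e}" "e - c < d" by blast
      then have "(c,e) \<in> K \<and> x \<in> cball (mid (c,e)) (rad (c,e)) \<and> rad (c,e) < d"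
        unfolding cb using lt by (auto simp: rad_def)
      then show ?thesis by blast
    qed
  qed blast
  have "S - (\<Union>p\<in>C. {fst p..snd p}) \<in> null_sets (completion lborel)"
    using C(4) by (simp add: cb negligible_iff_null_sets)
  then obtain N where N: "N \<in> null_sets lborel" "S - (\<Union>p\<in>C. {fst p..snd p}) \<subseteq> N"
    by (auto simp: null_sets_completion_iff2)
  show thesis
  proof (rule that[OF C(1,2) _ N(1)])
    show "disjoint_family_on (\<lambda>p. {fst p..snd p}) C"
      using C(3) unfolding cb pairwise_def disjoint_family_on_def disjnt_def by blast
  qed (use N(2) in blast)
qed

text \<open>Cover \<open>E\<close>, inside an open set \<open>U\<close>, by disjoint intervals on which \<open>M1\<close> is at most \<open>M2\<close>. They exhaust \<open>E\<close> up to a null set,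
  so the \<open>M1\<close>-mass of \<open>E\<close> is at most the \<open>M2\<close>-mass of \<open>U\<close>, and outer regularity of \<open>M2\<close> lets \<open>U\<close> shrink to \<open>E\<close>.
  This one comparison gives both inequalities in Lebesgue's differentiation theorem.\<close>

lemma vitali_compare:
  fixes M1 M2 :: "real measure"
  assumes s1: "sets M1 = sets borel" and s2: "sets M2 = sets borel"
    and fin: "emeasure M2 UNIV \<noteq> \<infinity>"
    and ac: "null_sets lborel \<subseteq> null_sets M1"
    and E: "E \<in> sets borel"
    and fine: "\<And>x \<delta>. x \<in> E \<Longrightarrow> \<delta> > 0 \<Longrightarrow>
      \<exists>c d. c < d \<and> x \<in> {c..d} \<and> d - c < \<delta> \<and> emeasure M1 {c..d} \<le> emeasure M2 {c..d}"
  shows "emeasure M1 E \<le> emeasure M2 E"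
proof -
  have sp: "space M2 = UNIV" using sets_eq_imp_space_eq[OF s2] by simp
  have "emeasure M1 E \<le> emeasure M2 U" if U: "E \<subseteq> U" "open U" for U
  proof -
    define K where "K = {(c, d). c < d \<and> {c..d} \<subseteq> U \<and> emeasure M1 {c..d} \<le> emeasure M2 {c..d}}"
    obtain C N where C: "countable C" "C \<subseteq> K" "disjoint_family_on (\<lambda>p. {fst p..snd p}) C"
      "N \<in> null_sets lborel" "E \<subseteq> (\<Union>p\<in>C. {fst p..snd p}) \<union> N"
    proof (rule vitali_intervals[of K E])
      show "\<exists>c d. (c, d) \<in> K \<and> x \<in> {c..d} \<and> d - c < \<delta>" if "x \<in> E" "\<delta> > 0" for x \<delta>
      proof -
        from that U obtain r where r: "r > 0" "ball x r \<subseteq> U" by (meson openE subsetD)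
        from fine[OF \<open>x \<in> E\<close>, of "min r \<delta>"] r that obtain c d where
          cd: "c < d" "x \<in> {c..d}" "d - c < min r \<delta>" "emeasure M1 {c..d} \<le> emeasure M2 {c..d}" by auto
        have "{c..d} \<subseteq> ball x r" using cd by (auto simp: dist_real_def)
        with cd r show ?thesis by (auto simp: K_def)
      qed
    qed (auto simp: K_def)
    have N: "N \<in> null_sets M1" using ac C(4) by auto
    have "emeasure M1 E \<le> emeasure M1 ((\<Union>p\<in>C. {fst p..snd p}) \<union> N)"
      using C N by (intro emeasure_mono sets.Un sets.countable_UN') (auto simp: s1)
    also have "\<dots> = emeasure M1 (\<Union>p\<in>C. {fst p..snd p})"
      using C N by (intro emeasure_Un_null_set sets.countable_UN') (auto simp: s1)
    also have "\<dots> = (\<integral>\<^sup>+p. emeasure M1 {fst p..snd p} \<partial>count_space C)"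
      using C by (intro emeasure_UN_countable) (auto simp: s1)
    also have "\<dots> \<le> (\<integral>\<^sup>+p. emeasure M2 {fst p..snd p} \<partial>count_space C)"
      using C(2) by (intro nn_integral_mono) (auto simp: K_def)
    also have "\<dots> = emeasure M2 (\<Union>p\<in>C. {fst p..snd p})"
      using C by (intro emeasure_UN_countable[symmetric]) (auto simp: s2)
    also have "\<dots> \<le> emeasure M2 U"
      using C(2) U by (intro emeasure_mono) (fastforce simp: s2 K_def)+
    finally show ?thesis .
  qed
  then show ?thesis
    by (subst outer_regular[OF s2]) (use fin E sp in \<open>auto intro!: INF_greatest\<close>)
qed

text \<open>The condition involves uncountably many increments \<open>h\<close>. It is still Borel, because a union of open sets
  is open: the set is a countable intersection of open sets.\<close>

lemma borel_frequently_less: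
  fixes q :: "real \<Rightarrow> real \<Rightarrow> real"
  assumes "\<And>h. h \<noteq> 0 \<Longrightarrow> continuous_on UNIV (\<lambda>t. q t h)"
  shows "{t. \<exists>\<^sub>F h in at 0. q t h < p} \<in> sets borel"
proof -
  have "(\<exists>\<^sub>F h in at 0. q t h < p) \<longleftrightarrow> (\<forall>k::nat. \<exists>h. h \<noteq> 0 \<and> \<bar>h\<bar> < 1 / Suc k \<and> q t h < p)" (is "?l = ?r") for t
  proof
    assume ?l
    then show ?r
      unfolding frequently_at by (auto simp: dist_real_def)
  next
    assume ?r
    then show ?l
      unfolding frequently_at
      by (auto simp: dist_real_def) (metis nat_approx_posE of_nat_Suc order_less_trans)
  qed
  then have "{t. \<exists>\<^sub>F h in at 0. q t h < p} =
      (\<Inter>k::nat. \<Union>h\<in>{h. h \<noteq> 0 \<and> \<bar>h\<bar> < 1 / Suc k}. {t. q t h < p})" by auto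
  also have "\<dots> \<in> sets borel"
    by (intro sets.countable_INT'' borel_open open_UN ballI open_Collect_less assms) auto
  finally show ?thesis .
qed

lemma integral_atMost_diff:
  fixes f :: "real \<Rightarrow> real"
  assumes "integrable lborel f" "c \<le> d"
  shows "(LINT r:{..d}|lborel. f r) - (LINT r:{..c}|lborel. f r) = (LINT r:{c..d}|lborel. f r)"
proof -
  have si: "set_integrable lborel A f" if "A \<in> sets borel" for A
    using integrable_mult_indicator[OF _ assms(1)] that by (simp add: set_integrable_def)
  have "(LINT r:{..d}|lborel. f r) = (LINT r:{..c} \<union> {c<..d}|lborel. f r)"
    using assms(2) by (intro arg_cong[where f="\<lambda>A. set_lebesgue_integral lborel A f"]) auto
  also have "\<dots> = (LINT r:{..c}|lborel. f r) + (LINT r:{c<..d}|lborel. f r)"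
    by (intro set_integral_Un si) auto
  also have "(LINT r:{c<..d}|lborel. f r) = (LINT r:{c..d}|lborel. f r)"
  proof (rule set_integral_cong_set)
    show "AE x in lborel. x \<in> {c..d} \<longleftrightarrow> x \<in> {c<..d}"
      using AE_lborel_singleton[of c] by eventually_elim auto
  qed (use si in \<open>auto simp: set_borel_measurable_def set_integrable_def intro!: borel_measurable_integrable\<close>)
  finally show ?thesis by simp
qed

lemma integral_atMost_continuous:
  fixes f :: "real \<Rightarrow> real"
  assumes f: "integrable lborel f"
  shows "continuous_on UNIV (\<lambda>t. LINT r:{..t}|lborel. f r)"
proof (rule continuous_at_imp_continuous_on, rule ballI)
  fix t :: real
  have [measurable]: "f \<in> borel_measurable borel" using f borel_measurable_integrable by force
  show "isCont (\<lambda>t. LINT r:{..t}|lborel. f r) t"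
    unfolding continuous_at_sequentially comp_def set_lebesgue_integral_def
  proof (intro allI impI)
    fix x :: "nat \<Rightarrow> real" assume x: "x \<longlonglongrightarrow> t"
    show "(\<lambda>n. LINT r|lborel. indicator {..x n} r *\<^sub>R f r) \<longlonglongrightarrow> (LINT r|lborel. indicator {..t} r *\<^sub>R f r)"
    proof (rule integral_dominated_convergence[where w="\<lambda>r. norm (f r)"])
      show "AE r in lborel. (\<lambda>n. indicator {..x n} r *\<^sub>R f r) \<longlonglongrightarrow> indicator {..t} r *\<^sub>R f r"
        using AE_lborel_singleton[of t]
      proof eventually_elim
        fix r assume "r \<noteq> t"
        then consider "r < t" | "r > t" by linarith
        then have "\<forall>\<^sub>F n in sequentially. (indicator {..x n} r :: real) = indicator {..t} r"
        proof cases
          case 1 then show ?thesis using order_tendstoD(1)[OF x 1] by (auto elim: eventually_mono)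
        next
          case 2 then show ?thesis using order_tendstoD(2)[OF x 2] by (auto elim: eventually_mono)
        qed
        then show "(\<lambda>n. indicator {..x n} r *\<^sub>R f r) \<longlonglongrightarrow> indicator {..t} r *\<^sub>R f r"
          by (intro tendsto_eventually) (auto elim: eventually_mono)
      qed
    qed (use f in \<open>auto simp: indicator_def\<close>)
  qed
qed

lemma emeasure_density_Icc:
  fixes f :: "real \<Rightarrow> real"
  assumes f: "integrable lborel f" "\<And>x. f x \<ge> 0"
  shows "emeasure (density lborel (\<lambda>x. ennreal (f x))) {c..d} = ennreal (LINT r:{c..d}|lborel. f r)"
proof -
  have [measurable]: "f \<in> borel_measurable borel" using f borel_measurable_integrable by force
  have "emeasure (density lborel (\<lambda>x. ennreal (f x))) {c..d} = (\<integral>\<^sup>+ x. ennreal (indicator {c..d} x * f x) \<partial>lborel)"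
    by (subst emeasure_density) (auto intro!: nn_integral_cong simp: indicator_def)
  also have "\<dots> = ennreal (LINT r:{c..d}|lborel. f r)"
    unfolding set_lebesgue_integral_def using f integrable_mult_indicator[OF _ f(1), of "{c..d}"]
    by (subst nn_integral_eq_integral) auto
  finally show ?thesis .
qed

lemma null_set_if_scaled_measure_le:
  fixes E :: "real set" and p q :: real
  assumes E: "E \<in> sets borel" "E \<subseteq> {a..b}" and pq: "0 \<le> p" "p < q"
    and le: "ennreal q * emeasure lborel E \<le> ennreal p * emeasure lborel E"
  shows "E \<in> null_sets lborel"
proof -
  have "emeasure lborel E \<le> emeasure lborel {a..b}" using E by (intro emeasure_mono) auto
  also have "\<dots> < \<infinity>" by (cases "a \<le> b") auto
  finally obtain r where r: "emeasure lborel E = ennreal r" "r \<ge> 0" by (cases "emeasure lborel E") auto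
  from le pq r have "q * r \<le> p * r" by (simp add: ennreal_mult[symmetric] ennreal_le_iff)
  then have "r = 0" using pq r by (simp add: mult_le_cancel_right)
  then show ?thesis using r E by auto
qed

text \<open>Where the derivative fails to be \<open>f t\<close>, there are rationals \<open>p < q\<close> such that either \<open>f t > q\<close> and some arbitrarily
  short intervals at \<open>t\<close> carry an average below \<open>p\<close>, or the reverse. In the first case
  \<open>vitali_compare\<close> bounds the integral of \<open>f\<close> over the set of such \<open>t\<close> by \<open>p\<close> times its length, while \<open>f > q\<close>
  makes it at least \<open>q\<close> times the length; so the length is zero. The second case is symmetric.\<close>

lemma lebesgue_differentiation_nonneg:
  fixes f :: "real \<Rightarrow> real"
  assumes f: "integrable lborel f" and f0: "\<And>x. f x \<ge> 0"
  shows "AE t in lborel. ((\<lambda>s. LINT r:{..s}|lborel. f r) has_real_derivative f t) (at t)"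
proof -
  define P where "P = (\<lambda>s. LINT r:{..s}|lborel. f r)"
  define Q where "Q = (\<lambda>t h. (P (t + h) - P t) / h)"
  define \<nu> where "\<nu> = density lborel (\<lambda>x. ennreal (f x))"
  \<comment> \<open>a multiple of Lebesgue measure, cut off to be finite; the margin 1 leaves room for intervals around points of \<open>{-N<..<N}\<close>\<close>
  define \<kappa> where "\<kappa> = (\<lambda>(p::real) (N::nat). density lborel (\<lambda>x. ennreal (p * indicator {-real N-1..real N+1} x)))"
  have [measurable]: "f \<in> borel_measurable borel" using f borel_measurable_integrable by force
  have Pc: "continuous_on UNIV P" unfolding P_def by (rule integral_atMost_continuous[OF f])
  have Qc: "continuous_on UNIV (\<lambda>t. Q t h)" if "h \<noteq> 0" for h
    unfolding Q_def using that by (intro continuous_intros continuous_on_compose2[OF Pc]) auto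
  have Q0: "Q t h \<ge> 0" for t h
  proof -
    have "P c \<le> P d" if "c \<le> d" for c d
    proof -
      have "0 \<le> (LINT r:{c..d}|lborel. f r)"
        unfolding set_lebesgue_integral_def using f0 by (intro integral_nonneg_AE) auto
      then show ?thesis using integral_atMost_diff[OF f that] by (simp add: P_def)
    qed
    from this[of t "t+h"] this[of "t+h" t] show ?thesis
      by (cases "h \<ge> 0") (auto simp: Q_def divide_nonpos_neg)
  qed
  have \<nu>I: "emeasure \<nu> {c..d} = ennreal (P d - P c)" if "c \<le> d" for c d
    unfolding \<nu>_def P_def using that by (simp add: emeasure_density_Icc f f0 integral_atMost_diff)
  have \<kappa>I: "emeasure (\<kappa> p N) A = ennreal p * emeasure lborel A" if "A \<in> sets borel" "A \<subseteq> {-real N-1..real N+1}" "p \<ge> 0" for p N A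
  proof -
    have "emeasure (\<kappa> p N) A = (\<integral>\<^sup>+x. ennreal p * indicator A x \<partial>lborel)"
      unfolding \<kappa>_def using that by (subst emeasure_density) (auto intro!: nn_integral_cong simp: indicator_def)
    then show ?thesis using that by (simp add: nn_integral_cmult)
  qed
  have \<kappa>fin: "emeasure (\<kappa> p N) UNIV \<noteq> \<infinity>" if "p \<ge> 0" for p N
  proof -
    have "emeasure (\<kappa> p N) UNIV = (\<integral>\<^sup>+x. ennreal p * indicator {-real N-1..real N+1} x \<partial>lborel)"
      unfolding \<kappa>_def by (subst emeasure_density) (auto intro!: nn_integral_cong simp: indicator_def)
    also have "\<dots> = ennreal p * ennreal (2 * real N + 2)" by (simp add: nn_integral_cmult)
    finally show ?thesis by (simp add: ennreal_mult_eq_top_iff)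
  qed
  have \<nu>fin: "emeasure \<nu> UNIV \<noteq> \<infinity>"
  proof -
    have "emeasure \<nu> UNIV = (\<integral>\<^sup>+x. ennreal (f x) \<partial>lborel)"
      unfolding \<nu>_def by (subst emeasure_density) auto
    also have "\<dots> < \<infinity>" using f f0 by (simp add: nn_integral_eq_integral)
    finally show ?thesis by simp
  qed
  have interval: "\<exists>c d. c < d \<and> x \<in> {c..d} \<and> d - c < \<delta> \<and> {c..d} \<subseteq> {-real N-1..real N+1} \<and> R ((P d - P c) / (d - c))"
    if "\<exists>\<^sub>F h in at 0. R (Q x h)" "\<delta> > 0" "x \<in> {-real N<..<real N}" for x \<delta> N R
  proof -
    have "\<forall>\<^sub>F h in at (0::real). \<bar>h\<bar> < min \<delta> 1"
      unfolding eventually_at using that by (intro exI[of _ "min \<delta> 1"]) (auto simp: dist_real_def)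
    moreover have "\<forall>\<^sub>F h in at (0::real). h \<noteq> 0" by (simp add: eventually_neq_at_within)
    ultimately have "\<exists>h. R (Q x h) \<and> \<bar>h\<bar> < min \<delta> 1 \<and> h \<noteq> 0"
      using frequently_ex[OF frequently_eventually_frequently[OF that(1) eventually_conj]] by blast
    then obtain h where h: "R (Q x h)" "\<bar>h\<bar> < \<delta>" "\<bar>h\<bar> < 1" "h \<noteq> 0" by auto
    have "Q x h = (P (max x (x+h)) - P (min x (x+h))) / (max x (x+h) - min x (x+h))"
      using h(4) by (auto simp: Q_def max_def min_def field_simps)
    then show ?thesis using h that
      by (intro exI[of _ "min x (x+h)"] exI[of _ "max x (x+h)"]) auto
  qed
  have E1: "AE t in lborel. \<not> (f t > q \<and> (\<exists>\<^sub>F h in at 0. Q t h < p) \<and> t \<in> {-real N<..<real N})"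
    if pq: "0 \<le> p" "p < q" for p q N
  proof -
    define E where "E = {t. f t > q} \<inter> {t. \<exists>\<^sub>F h in at 0. Q t h < p} \<inter> {-real N<..<real N}"
    have E[measurable]: "E \<in> sets borel" unfolding E_def
    proof (intro sets.Int)
      show "{t. f t > q} \<in> sets borel" by measurable
      show "{t. \<exists>\<^sub>F h in at 0. Q t h < p} \<in> sets borel" by (rule borel_frequently_less[OF Qc])
    qed auto
    have "emeasure \<nu> E \<le> emeasure (\<kappa> p N) E"
    proof (rule vitali_compare)
      show "null_sets lborel \<subseteq> null_sets \<nu>"
        using absolutely_continuousI_density[of "\<lambda>x. ennreal (f x)" lborel] by (simp add: \<nu>_def absolutely_continuous_def)
      fix x \<delta> :: real assume x: "x \<in> E" "\<delta> > 0"
      then obtain c d where cd: "c < d" "x \<in> {c..d}" "d - c < \<delta>" "{c..d} \<subseteq> {-real N-1..real N+1}" "(P d - P c) / (d - c) < p"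
        using interval[of "\<lambda>y. y < p" x \<delta> N] by (auto simp: E_def)
      then have "ennreal (P d - P c) \<le> ennreal p * ennreal (d - c)"
        using pq by (subst ennreal_mult[symmetric]) (auto simp: field_simps intro!: ennreal_leI)
      then show "\<exists>c d. c < d \<and> x \<in> {c..d} \<and> d - c < \<delta> \<and> emeasure \<nu> {c..d} \<le> emeasure (\<kappa> p N) {c..d}"
        using cd pq by (intro exI[of _ c] exI[of _ d]) (auto simp: \<nu>I \<kappa>I)
    qed (use \<kappa>fin pq in \<open>auto simp: \<nu>_def \<kappa>_def\<close>)
    also have "\<dots> = ennreal p * emeasure lborel E" using pq by (intro \<kappa>I E) (auto simp: E_def)
    finally have 1: "emeasure \<nu> E \<le> ennreal p * emeasure lborel E" .
    have "ennreal q * emeasure lborel E = (\<integral>\<^sup>+x. ennreal q * indicator E x \<partial>lborel)"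
      by (simp add: nn_integral_cmult)
    also have "\<dots> \<le> (\<integral>\<^sup>+x. ennreal (f x) * indicator E x \<partial>lborel)"
      by (intro nn_integral_mono) (auto simp: E_def indicator_def intro!: ennreal_leI)
    also have "\<dots> = emeasure \<nu> E" unfolding \<nu>_def by (subst emeasure_density) auto
    finally have 2: "ennreal q * emeasure lborel E \<le> ennreal p * emeasure lborel E" using 1 by simp
    have "E \<subseteq> {-real N..real N}" by (auto simp: E_def)
    then have "E \<in> null_sets lborel" by (rule null_set_if_scaled_measure_le[OF E _ pq 2])
    from AE_not_in[OF this] show ?thesis by eventually_elim (auto simp: E_def)
  qed
  have E2: "AE t in lborel. \<not> (f t < p \<and> (\<exists>\<^sub>F h in at 0. Q t h > q) \<and> t \<in> {-real N<..<real N})"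
    if pq: "0 \<le> p" "p < q" for p q N
  proof -
    define E where "E = {t. f t < p} \<inter> {t. \<exists>\<^sub>F h in at 0. - Q t h < - q} \<inter> {-real N<..<real N}"
    have E[measurable]: "E \<in> sets borel" unfolding E_def
    proof (intro sets.Int)
      show "{t. f t < p} \<in> sets borel" by measurable
      show "{t. \<exists>\<^sub>F h in at 0. - Q t h < - q} \<in> sets borel"
        by (rule borel_frequently_less[OF continuous_on_minus[OF Qc]])
    qed auto
    have "emeasure (\<kappa> q N) E \<le> emeasure \<nu> E"
    proof (rule vitali_compare)
      show "null_sets lborel \<subseteq> null_sets (\<kappa> q N)"
        using absolutely_continuousI_density[of "\<lambda>x. ennreal (q * indicator {-real N-1..real N+1} x)" lborel]
        by (simp add: \<kappa>_def absolutely_continuous_def)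
      fix x \<delta> :: real assume x: "x \<in> E" "\<delta> > 0"
      then obtain c d where cd: "c < d" "x \<in> {c..d}" "d - c < \<delta>" "{c..d} \<subseteq> {-real N-1..real N+1}" "(P d - P c) / (d - c) > q"
        using interval[of "\<lambda>y. y > q" x \<delta> N] by (auto simp: E_def)
      then have "ennreal q * ennreal (d - c) \<le> ennreal (P d - P c)"
        using pq by (subst ennreal_mult[symmetric]) (auto simp: field_simps intro!: ennreal_leI)
      then show "\<exists>c d. c < d \<and> x \<in> {c..d} \<and> d - c < \<delta> \<and> emeasure (\<kappa> q N) {c..d} \<le> emeasure \<nu> {c..d}"
        using cd pq by (intro exI[of _ c] exI[of _ d]) (auto simp: \<nu>I \<kappa>I)
    qed (use \<nu>fin in \<open>auto simp: \<nu>_def \<kappa>_def\<close>)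
    moreover have "emeasure (\<kappa> q N) E = ennreal q * emeasure lborel E" using pq by (intro \<kappa>I E) (auto simp: E_def)
    ultimately have 1: "ennreal q * emeasure lborel E \<le> emeasure \<nu> E" by simp
    have "emeasure \<nu> E = (\<integral>\<^sup>+x. ennreal (f x) * indicator E x \<partial>lborel)"
      unfolding \<nu>_def by (subst emeasure_density) auto
    also have "\<dots> \<le> (\<integral>\<^sup>+x. ennreal p * indicator E x \<partial>lborel)"
      by (intro nn_integral_mono) (auto simp: E_def indicator_def intro!: ennreal_leI)
    also have "\<dots> = ennreal p * emeasure lborel E"
      by (simp add: nn_integral_cmult)
    finally have 2: "ennreal q * emeasure lborel E \<le> ennreal p * emeasure lborel E" using 1 by simp
    have "E \<subseteq> {-real N..real N}" by (auto simp: E_def)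
    then have "E \<in> null_sets lborel" by (rule null_set_if_scaled_measure_le[OF E _ pq 2])
    from AE_not_in[OF this] show ?thesis by eventually_elim (auto simp: E_def)
  qed
  have "AE t in lborel. \<forall>(p::rat) (q::rat) (N::nat). 0 \<le> p \<and> p < q \<longrightarrow>
      \<not> (f t > of_rat q \<and> (\<exists>\<^sub>F h in at 0. Q t h < of_rat p) \<and> t \<in> {-real N<..<real N}) \<and>
      \<not> (f t < of_rat p \<and> (\<exists>\<^sub>F h in at 0. Q t h > of_rat q) \<and> t \<in> {-real N<..<real N})"
    unfolding AE_all_countable
  proof (intro allI)
    fix p q :: rat and N :: nat
    show "AE t in lborel. 0 \<le> p \<and> p < q \<longrightarrow>
      \<not> (f t > of_rat q \<and> (\<exists>\<^sub>F h in at 0. Q t h < of_rat p) \<and> t \<in> {-real N<..<real N}) \<and>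
      \<not> (f t < of_rat p \<and> (\<exists>\<^sub>F h in at 0. Q t h > of_rat q) \<and> t \<in> {-real N<..<real N})"
    proof (cases "0 \<le> p \<and> p < q")
      case True
      then have "0 \<le> (of_rat p::real)" "(of_rat p::real) < of_rat q" by (auto simp: of_rat_less)
      from E1[OF this, of N] E2[OF this, of N] show ?thesis by eventually_elim auto
    qed auto
  qed
  then show ?thesis
  proof eventually_elim
    fix t assume H: "\<forall>(p::rat) (q::rat) (N::nat). 0 \<le> p \<and> p < q \<longrightarrow>
      \<not> (f t > of_rat q \<and> (\<exists>\<^sub>F h in at 0. Q t h < of_rat p) \<and> t \<in> {-real N<..<real N}) \<and>
      \<not> (f t < of_rat p \<and> (\<exists>\<^sub>F h in at 0. Q t h > of_rat q) \<and> t \<in> {-real N<..<real N})"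
    obtain N :: nat where "\<bar>t\<bar> < real N" using reals_Archimedean2 by blast
    then have N: "t \<in> {-real N<..<real N}" by auto
    have "((\<lambda>h. Q t h) \<longlongrightarrow> f t) (at 0)"
    proof (rule order_tendstoI)
      fix a assume a: "a < f t"
      show "\<forall>\<^sub>F h in at 0. a < Q t h"
      proof (cases "a < 0")
        case True
        show ?thesis
        proof (rule always_eventually, rule allI)
          show "a < Q t h" for h using Q0[of t h] True by linarith
        qed
      next
        case False
        obtain p where p: "a < of_rat p" "of_rat p < f t" using of_rat_dense[OF a] by blast
        obtain q where q: "of_rat p < (of_rat q::real)" "of_rat q < f t" using of_rat_dense[OF p(2)] by blast
        have "0 \<le> (of_rat p :: real)" using False p by linarith
        then have "0 \<le> p" "p < q" using q by (auto simp: of_rat_less)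
        with H N q have "\<not> (\<exists>\<^sub>F h in at 0. Q t h < of_rat p)" by blast
        then show ?thesis unfolding not_frequently using p by (auto elim!: eventually_mono)
      qed
    next
      fix b assume b: "f t < b"
      obtain q where q: "f t < of_rat q" "of_rat q < b" using of_rat_dense[OF b] by blast
      obtain p where p: "f t < of_rat p" "of_rat p < (of_rat q::real)" using of_rat_dense[OF q(1)] by blast
      have "0 \<le> (of_rat p :: real)" using f0[of t] p by linarith
      then have "0 \<le> p" "p < q" using p by (auto simp: of_rat_less)
      with H N p have "\<not> (\<exists>\<^sub>F h in at 0. Q t h > of_rat q)" by blast
      then show "\<forall>\<^sub>F h in at 0. Q t h < b" unfolding not_frequently using q by (auto elim!: eventually_mono)
    qed
    then show "((\<lambda>s. LINT r:{..s}|lborel. f r) has_real_derivative f t) (at t)"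
      unfolding DERIV_def Q_def P_def .
  qed
qed

lemma lebesgue_differentiation:
  fixes f :: "real \<Rightarrow> real"
  assumes f: "integrable lborel f"
  shows "AE t in lborel. ((\<lambda>s. LINT r:{..s}|lborel. f r) has_real_derivative f t) (at t)"
proof -
  have p: "integrable lborel (\<lambda>r. max 0 (f r))" and n: "integrable lborel (\<lambda>r. max 0 (- f r))"
    using f by auto
  have eq: "(LINT r:{..s}|lborel. f r) = (LINT r:{..s}|lborel. max 0 (f r)) - (LINT r:{..s}|lborel. max 0 (- f r))" for s
    using integrable_mult_indicator[OF _ p, of "{..s}"] integrable_mult_indicator[OF _ n, of "{..s}"]
    by (subst set_integral_diff(2)[symmetric])
      (auto simp: set_integrable_def set_lebesgue_integral_def max_def intro!: Bochner_Integration.integral_cong)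
  show ?thesis
    using lebesgue_differentiation_nonneg[OF p, simplified] lebesgue_differentiation_nonneg[OF n, simplified]
  proof (eventually_elim)
    fix t
    assume "((\<lambda>s. LINT r:{..s}|lborel. max 0 (f r)) has_real_derivative max 0 (f t)) (at t)"
      "((\<lambda>s. LINT r:{..s}|lborel. max 0 (- f r)) has_real_derivative max 0 (- f t)) (at t)"
    from DERIV_diff[OF this] show "((\<lambda>s. LINT r:{..s}|lborel. f r) has_real_derivative f t) (at t)"
      unfolding eq by (rule DERIV_cong) auto
  qed
qed

section \<open>The metric derivative\<close>

text \<open>The triangle inequality along the end points of the intervals, where the gaps are estimated by \<open>\<nu>\<close>.
  Induction removes the rightmost interval; the other intervals then lie strictly to the left of it.\<close>

lemma dist_le_finite_intervals:
  fixes u :: "real \<Rightarrow> 'a::metric_space" and \<nu> :: "real measure"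
  assumes \<nu>: "finite_measure \<nu>" "sets \<nu> = sets borel" and null: "\<And>x. measure \<nu> {x} = 0"
    and le: "\<And>s t. s \<le> t \<Longrightarrow> dist (u s) (u t) \<le> measure \<nu> {s..t}"
  assumes "finite C" and "disjoint_family_on (\<lambda>p. {fst p..snd p}) C"
    and "\<And>p. p \<in> C \<Longrightarrow> fst p \<le> snd p \<and> {fst p..snd p} \<subseteq> {a..b}" and "a \<le> b"
  shows "dist (u a) (u b) \<le> (\<Sum>p\<in>C. dist (u (fst p)) (u (snd p)))
    + measure \<nu> ({a..b} - (\<Union>p\<in>C. {fst p..snd p}))"
  using assms(5-)
proof (induction C arbitrary: b rule: finite_ranking_induct[where f = "fst :: real \<times> real \<Rightarrow> real"])
  case empty
  then show ?case using le[of a b] by simp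
next
  case (insert p C)
  interpret finite_measure \<nu> by fact
  show ?case
  proof (cases "p \<in> C")
    case True
    then show ?thesis using insert by (simp add: insert_absorb)
  next
    case False
    obtain c d where p: "p = (c, d)" by force
    have cd: "a \<le> c" "c \<le> d" "d \<le> b" using insert.prems(2)[of p] by (auto simp: p)
    have left: "snd q < c" if "q \<in> C" for q
    proof (rule ccontr)
      assume "\<not> snd q < c"
      then have "c \<in> {fst q..snd q} \<inter> {fst p..snd p}" using insert.hyps(2)[OF that] cd by (auto simp: p)
      moreover have "q \<noteq> p" using that False by auto
      ultimately show False using insert.prems(1) that unfolding disjoint_family_on_def by blast
    qed
    let ?U = "\<Union>q\<in>C. {fst q..snd q}"
    have U[measurable]: "?U \<in> sets borel" using insert.hyps(1) by (intro sets.finite_UN) auto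
    have IH: "dist (u a) (u c) \<le> (\<Sum>q\<in>C. dist (u (fst q)) (u (snd q))) + measure \<nu> ({a..c} - ?U)"
    proof (rule insert.IH)
      show "disjoint_family_on (\<lambda>p. {fst p..snd p}) C"
        using insert.prems(1) by (auto simp: disjoint_family_on_def)
      show "fst q \<le> snd q \<and> {fst q..snd q} \<subseteq> {a..c}" if "q \<in> C" for q
        using left[OF that] insert.prems(2)[of q] that by auto
    qed (use cd in simp)
    have nullset: "{x} \<in> null_sets \<nu>" for x
      using null[of x] by (intro null_setsI) (auto simp: \<nu> emeasure_eq_measure)
    have "measure \<nu> ({a..c} - ?U) + measure \<nu> {d..b} = measure \<nu> (({a..c} - ?U) - {c}) + measure \<nu> ({d..b} - {d})"
      by (simp add: measure_Diff_null_set \<nu> nullset)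
    also have "\<dots> = measure \<nu> ((({a..c} - ?U) - {c}) \<union> ({d..b} - {d}))"
      using cd by (intro finite_measure_Union[symmetric]) (auto simp: \<nu>)
    also have "\<dots> \<le> measure \<nu> ({a..b} - (\<Union>p\<in>insert p C. {fst p..snd p}))"
    proof (rule finite_measure_mono)
      show "({a..c} - ?U - {c}) \<union> ({d..b} - {d}) \<subseteq> {a..b} - (\<Union>p\<in>insert p C. {fst p..snd p})"
        using cd left by (force simp: p)
    qed (use insert.hyps(1) in \<open>auto simp: \<nu> intro!: sets.Diff sets.finite_UN\<close>)
    finally have 1: "measure \<nu> ({a..c} - ?U) + measure \<nu> {d..b} \<le> measure \<nu> ({a..b} - (\<Union>p\<in>insert p C. {fst p..snd p}))" .
    have "dist (u a) (u b) \<le> dist (u a) (u c) + dist (u c) (u d) + dist (u d) (u b)"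
      by (metis add.commute add_left_mono dist_triangle dist_triangle_le order_trans add_right_mono)
    also have "dist (u d) (u b) \<le> measure \<nu> {d..b}" using le cd by auto
    finally show ?thesis using IH 1 False insert.hyps(1) by (simp add: p)
  qed
qed

lemma curve_continuous:
  fixes u :: "real \<Rightarrow> 'a::metric_space"
  assumes m: "integrable lborel m"
    and le: "\<And>s t. s \<le> t \<Longrightarrow> dist (u s) (u t) \<le> (LINT r:{s..t}|lborel. m r)"
  shows "continuous_on UNIV u"
proof -
  define P where "P = (\<lambda>t. LINT r:{..t}|lborel. m r)"
  have P: "dist (u s) (u t) \<le> \<bar>P s - P t\<bar>" for s t
    using le[of s t] le[of t s] integral_atMost_diff[OF m, of s t] integral_atMost_diff[OF m, of t s]
    by (cases "s \<le> t") (auto simp: P_def dist_commute)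
  have Pc: "isCont P t" for t
    using integral_atMost_continuous[OF m] by (simp add: P_def continuous_on_eq_continuous_at)
  have "isCont u t" for t
    unfolding continuous_within
  proof (rule tendsto_dist_iff[THEN iffD2], rule Lim_null_comparison)
    show "\<forall>\<^sub>F s in at t. norm (dist (u s) (u t)) \<le> \<bar>P s - P t\<bar>" using P by simp
    show "((\<lambda>s. \<bar>P s - P t\<bar>) \<longlongrightarrow> 0) (at t)"
      using Pc[of t] by (intro tendsto_rabs_zero) (simp add: isCont_def LIM_zero)
  qed
  then show ?thesis by (simp add: continuous_at_imp_continuous_on)
qed

text \<open>The function \<open>g\<close> is the lower metric derivative. The point is that the distance is bounded by the integral of
  the lower derivative: at almost every \<open>t\<close> there are arbitrarily short intervals \<open>{c..d}\<close> at \<open>t\<close> with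
  \<open>dist (u c) (u d)\<close> at most the integral of \<open>g + \<eta>\<close>. A Vitali selection of such intervals fills \<open>{a..b}\<close> up to a null
  set, and the gaps contribute little because \<open>m\<close> is integrable. Once the bound is known, Lebesgue's
  differentiation theorem shows that the upper metric derivative is at most \<open>g\<close>, so the limit exists.\<close>

lemma metric_derivative_exists:
  fixes u :: "real \<Rightarrow> 'a::metric_space"
  assumes m: "integrable lborel m" and m0: "\<And>r. m r \<ge> 0"
    and le: "\<And>s t. s \<le> t \<Longrightarrow> dist (u s) (u t) \<le> (LINT r:{s..t}|lborel. m r)"
  obtains g where "integrable lborel g" "\<And>r. g r \<ge> 0" "AE r in lborel. g r \<le> m r"
    "\<And>s t. s \<le> t \<Longrightarrow> dist (u s) (u t) \<le> (LINT r:{s..t}|lborel. g r)"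
    "AE t in lborel. ((\<lambda>s. dist (u s) (u t) / \<bar>t - s\<bar>) \<longlongrightarrow> g t) (at t)"
proof -
  define P where "P = (\<lambda>t. LINT r:{..t}|lborel. m r)"
  define q where "q = (\<lambda>t h. dist (u (t + h)) (u t) / \<bar>h\<bar>)"
  define D where "D = (\<lambda>t. Liminf (at 0) (\<lambda>h. ereal (q t h)))"
  define g where "g = (\<lambda>t. real_of_ereal (D t))"
  define G where "G = (\<lambda>t. LINT r:{..t}|lborel. g r)"
  have [measurable]: "m \<in> borel_measurable borel" using m borel_measurable_integrable by force
  have uc: "continuous_on UNIV u" using curve_continuous[OF m le] .
  have qc: "continuous_on UNIV (\<lambda>t. q t h)" if "h \<noteq> 0" for h
    unfolding q_def using that
    by (intro continuous_intros continuous_on_compose2[OF uc]) auto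
  have [measurable]: "D \<in> borel_measurable borel"
  proof (rule borel_measurableI_less)
    fix y :: ereal
    have "D t < y \<longleftrightarrow> (\<exists>r::rat. ereal (of_rat r) < y \<and> (\<exists>\<^sub>F h in at 0. q t h < of_rat r))" for t
    proof
      assume "D t < y"
      then obtain z where z: "D t < z" "z < y" using dense by blast
      obtain r' where r': "D t < ereal r'" "ereal r' < z" using ereal_dense2[OF z(1)] by blast
      have "ereal r' < y" using r' z by auto
      then obtain r'' where r'': "ereal r' < ereal r''" "ereal r'' < y" using ereal_dense2 by blast
      obtain r where r: "r' < of_rat r" "of_rat r < r''" using of_rat_dense[of r' r''] r''(1) by auto
      have "\<not> (\<forall>\<^sub>F h in at 0. ereal r' \<le> ereal (q t h))"
        using r'(1) Liminf_bounded[of "ereal r'" "\<lambda>h. ereal (q t h)" "at 0"]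
        unfolding D_def by (metis not_less)
      then have "\<exists>\<^sub>F h in at 0. q t h < r'" by (simp add: not_eventually not_le)
      then have "\<exists>\<^sub>F h in at 0. q t h < of_rat r" by (rule frequently_elim1) (use r in linarith)
      moreover have "ereal (of_rat r) < y" using r r'' by (metis ereal_less_eq(3) less_imp_le order_le_less_trans)
      ultimately show "\<exists>r::rat. ereal (of_rat r) < y \<and> (\<exists>\<^sub>F h in at 0. q t h < of_rat r)" by blast
    next
      assume "\<exists>r::rat. ereal (of_rat r) < y \<and> (\<exists>\<^sub>F h in at 0. q t h < of_rat r)"
      then obtain r :: rat where r: "ereal (of_rat r) < y" "\<exists>\<^sub>F h in at 0. q t h < of_rat r" by blast
      have "D t \<le> ereal (of_rat r)"
      proof (rule ccontr)
        assume "\<not> D t \<le> ereal (of_rat r)"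
        then have "\<forall>\<^sub>F h in at 0. ereal (of_rat r) < ereal (q t h)"
          unfolding D_def by (intro less_LiminfD) auto
        then have "\<forall>\<^sub>F h in at 0. \<not> q t h < of_rat r" by eventually_elim simp
        with r(2) show False by (simp add: frequently_def)
      qed
      with r(1) show "D t < y" by simp
    qed
    then have "{t \<in> space borel. D t < y} = (\<Union>r\<in>{r::rat. ereal (of_rat r) < y}. {t. \<exists>\<^sub>F h in at 0. q t h < of_rat r})"
      by auto
    also have "\<dots> \<in> sets borel"
    proof (rule sets.countable_UN'')
      show "{t. \<exists>\<^sub>F h in at 0. q t h < of_rat r} \<in> sets borel" for r by (rule borel_frequently_less[OF qc])
    qed auto
    finally show "{t \<in> space borel. D t < y} \<in> sets borel" .
  qed
  have D0: "0 \<le> D t" for t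
    unfolding D_def by (intro Liminf_bounded always_eventually) (auto simp: q_def)
  have g0: "0 \<le> g t" for t using D0[of t] by (simp add: g_def real_of_ereal_pos)
  have [measurable]: "g \<in> borel_measurable borel" unfolding g_def by measurable
  have qP: "q t h \<le> (P (t + h) - P t) / h" if "h \<noteq> 0" for t h
    using that le[of t "t+h"] le[of "t+h" t] integral_atMost_diff[OF m, of t "t+h"] integral_atMost_diff[OF m, of "t+h" t]
    by (cases "h > 0") (auto simp: q_def P_def dist_commute field_simps)
  \<comment> \<open>the lower derivative is at most the density \<open>m\<close>, so it is finite almost everywhere and integrable\<close>
  have Dm: "AE t in lborel. D t \<le> ereal (m t)"
    using lebesgue_differentiation[OF m]
  proof eventually_elim
    fix t assume "((\<lambda>s. LINT r:{..s}|lborel. m r) has_real_derivative m t) (at t)"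
    then have "((\<lambda>h. (P (t + h) - P t) / h) \<longlongrightarrow> m t) (at 0)" by (simp add: DERIV_def P_def)
    then have lim: "((\<lambda>h. ereal ((P (t + h) - P t) / h)) \<longlongrightarrow> ereal (m t)) (at 0)" by simp
    have "D t \<le> Liminf (at 0) (\<lambda>h. ereal ((P (t + h) - P t) / h))"
      unfolding D_def using qP
      by (intro Liminf_mono) (auto simp: eventually_at_filter intro!: always_eventually)
    also have "\<dots> = ereal (m t)" using lim by (intro lim_imp_Liminf) auto
    finally show "D t \<le> ereal (m t)" .
  qed
  have Dg: "AE t in lborel. D t = ereal (g t)"
    using Dm
  proof eventually_elim
    fix t assume "D t \<le> ereal (m t)" then show "D t = ereal (g t)"
      using D0[of t] by (cases "D t") (auto simp: g_def)
  qed
  have gm: "AE t in lborel. g t \<le> m t" using Dm Dg by eventually_elim simp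
  have g: "integrable lborel g"
    by (rule Bochner_Integration.integrable_bound[OF m]) (use gm g0 m0 in auto)
  have gdiff: "AE t in lborel. ((\<lambda>h. (G (t + h) - G t) / h) \<longlongrightarrow> g t) (at 0)"
    using lebesgue_differentiation[OF g] by (simp add: G_def DERIV_def)
  have main: "dist (u a) (u b) \<le> (LINT r:{a..b}|lborel. g r)" if ab: "a \<le> b" for a b
  proof (rule field_le_epsilon)
    fix e :: real assume e: "e > 0"
    define \<eta> where "\<eta> = e / (b - a + 1)"
    have \<eta>: "\<eta> > 0" "\<eta> * (b - a) \<le> e" using e ab by (auto simp: \<eta>_def field_simps)
    \<comment> \<open>the slack \<open>\<eta>\<close> absorbs the two approximations, of the lower limit and of the derivative of \<open>G\<close>\<close>
    define k where "k = (\<lambda>r. g r + \<eta> * indicator {a..b} r)"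
    have k: "integrable lborel k" and k0: "\<And>r. k r \<ge> 0"
      unfolding k_def using g g0 \<eta>(1) ab by (auto intro!: Bochner_Integration.integrable_add integrable_mult_right integrable_real_indicator)
    define \<nu> where "\<nu> = density lborel (\<lambda>x. ennreal (m x))"
    define \<rho> where "\<rho> = density lborel (\<lambda>x. ennreal (k x))"
    have fin\<nu>: "finite_measure \<nu>"
      by (rule finite_measureI) (use m m0 in \<open>simp add: \<nu>_def emeasure_density nn_integral_eq_integral\<close>)
    have [measurable]: "k \<in> borel_measurable borel" using k borel_measurable_integrable by force
    have fin\<rho>: "finite_measure \<rho>"
      by (rule finite_measureI) (use k k0 in \<open>simp add: \<rho>_def emeasure_density nn_integral_eq_integral\<close>)
    have I0: "0 \<le> (LINT r:A|lborel. f r)" if "\<And>r. f r \<ge> (0::real)" for f and A :: "real set"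
      unfolding set_lebesgue_integral_def using that by (intro integral_nonneg_AE) auto
    have m\<nu>: "measure \<nu> {c..d} = (LINT r:{c..d}|lborel. m r)" for c d
      unfolding measure_def \<nu>_def emeasure_density_Icc[OF m m0] by (simp add: I0 m0)
    have m\<rho>: "measure \<rho> {c..d} = (LINT r:{c..d}|lborel. k r)" for c d
      unfolding measure_def \<rho>_def emeasure_density_Icc[OF k k0] by (simp add: I0 k0)
    have si: "set_integrable lborel A f" if "integrable lborel f" "A \<in> sets borel" for A and f :: "real \<Rightarrow> real"
      using integrable_mult_indicator[OF _ that(1), of A] that by (simp add: set_integrable_def)
    have kI: "(LINT r:{c..d}|lborel. k r) = (LINT r:{c..d}|lborel. g r) + \<eta> * (d - c)" if "c \<le> d" "{c..d} \<subseteq> {a..b}" for c d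
    proof -
      have "(LINT r:{c..d}|lborel. k r) = (LINT r:{c..d}|lborel. g r) + (LINT r:{c..d}|lborel. \<eta> * indicator {a..b} r)"
        unfolding k_def using ab
        by (intro set_integral_add si g) (auto intro!: integrable_mult_right integrable_real_indicator)
      also have "(LINT r:{c..d}|lborel. \<eta> * indicator {a..b} r) = (LINT r:{c..d}|lborel. \<eta>)"
        using that by (intro set_lebesgue_integral_cong) (auto simp: indicator_def)
      also have "\<dots> = \<eta> * (d - c)" using that by (simp add: set_lebesgue_integral_def)
      finally show ?thesis .
    qed
    define K where "K = {(c, d). c < d \<and> {c..d} \<subseteq> {a..b} \<and> dist (u c) (u d) \<le> measure \<rho> {c..d}}"
    define S where "S = {t\<in>{a<..<b}. D t = ereal (g t) \<and> ((\<lambda>h. (G (t + h) - G t) / h) \<longlongrightarrow> g t) (at 0)}"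
    obtain C N where C: "countable C" "C \<subseteq> K" "disjoint_family_on (\<lambda>p. {fst p..snd p}) C"
      "N \<in> null_sets lborel" "S \<subseteq> (\<Union>p\<in>C. {fst p..snd p}) \<union> N"
    proof (rule vitali_intervals[of K S])
      fix x \<delta> :: real assume x: "x \<in> S" "\<delta> > 0"
      have "\<not> (\<forall>\<^sub>F h in at 0. ereal (g x + \<eta> / 2) \<le> ereal (q x h))"
      proof
        assume "\<forall>\<^sub>F h in at 0. ereal (g x + \<eta> / 2) \<le> ereal (q x h)"
        then have "ereal (g x + \<eta> / 2) \<le> D x" unfolding D_def by (rule Liminf_bounded)
        then show False using x \<eta> by (simp add: S_def)
      qed
      then have fr: "\<exists>\<^sub>F h in at 0. q x h < g x + \<eta> / 2" by (simp add: not_eventually not_le)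
      have "\<forall>\<^sub>F h in at 0. (G (x + h) - G x) / h > g x - \<eta> / 2"
        using x \<eta> by (intro order_tendstoD(1)[of _ "g x"]) (auto simp: S_def)
      moreover have "\<forall>\<^sub>F h in at (0::real). \<bar>h\<bar> < min \<delta> (min (x - a) (b - x))"
        unfolding eventually_at using x
        by (intro exI[of _ "min \<delta> (min (x - a) (b - x))"]) (auto simp: dist_real_def S_def)
      moreover have "\<forall>\<^sub>F h in at (0::real). h \<noteq> 0" by (simp add: eventually_neq_at_within)
      ultimately have "\<forall>\<^sub>F h in at 0. (G (x + h) - G x) / h > g x - \<eta> / 2 \<and>
          \<bar>h\<bar> < min \<delta> (min (x - a) (b - x)) \<and> h \<noteq> 0"
        by eventually_elim auto
      from frequently_ex[OF frequently_eventually_frequently[OF fr this]]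
      obtain h where h: "q x h < g x + \<eta> / 2" "(G (x + h) - G x) / h > g x - \<eta> / 2"
          "\<bar>h\<bar> < \<delta>" "\<bar>h\<bar> < x - a" "\<bar>h\<bar> < b - x" "h \<noteq> 0" by auto
      define c d where "c = min x (x + h)" and "d = max x (x + h)"
      have cd: "c < d" "d - c = \<bar>h\<bar>" "x \<in> {c..d}" "{c..d} \<subseteq> {a..b}"
        using h by (auto simp: c_def d_def min_def max_def)
      have "dist (u c) (u d) / (d - c) = q x h"
        using cd(2) by (auto simp: c_def d_def q_def min_def max_def dist_commute)
      moreover have "(G d - G c) / (d - c) = (G (x + h) - G x) / h"
        using h(6) by (auto simp: c_def d_def min_def max_def field_simps)
      ultimately have "dist (u c) (u d) / (d - c) \<le> (G d - G c) / (d - c) + \<eta>" using h by linarith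
      then have "dist (u c) (u d) \<le> ((G d - G c) / (d - c) + \<eta>) * (d - c)" using cd(1) by (simp add: pos_divide_le_eq)
      also have "\<dots> = (G d - G c) + \<eta> * (d - c)" using cd(1) by (simp add: distrib_right)
      also have "\<dots> = measure \<rho> {c..d}"
        using cd integral_atMost_diff[OF g, of c d] by (simp add: m\<rho> kI G_def)
      finally show "\<exists>c d. (c, d) \<in> K \<and> x \<in> {c..d} \<and> d - c < \<delta>"
        using cd h(3) by (intro exI[of _ c] exI[of _ d]) (auto simp: K_def)
    qed (auto simp: K_def)
    interpret \<nu>: finite_measure \<nu> by fact
    interpret \<rho>: finite_measure \<rho> by fact
    define U where "U = (\<lambda>p::real\<times>real. {fst p..snd p})"
    have fin_bound: "dist (u a) (u b) \<le> measure \<rho> {a..b} + measure \<nu> ({a..b} - (\<Union>p\<in>F. U p))" if F: "finite F" "F \<subseteq> C" for F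
    proof -
      have dis: "disjoint_family_on U F" using C(3) F(2) unfolding U_def by (rule disjoint_family_on_mono[rotated])
      have "dist (u a) (u b) \<le> (\<Sum>p\<in>F. dist (u (fst p)) (u (snd p))) + measure \<nu> ({a..b} - (\<Union>p\<in>F. {fst p..snd p}))"
      proof (rule dist_le_finite_intervals[OF fin\<nu>])
        show "measure \<nu> {x} = 0" for x
        proof -
          have "AE r in lborel. indicator {x..x} r *\<^sub>R m r = 0"
            using AE_lborel_singleton[of x] by eventually_elim auto
          then have "(LINT r:{x..x}|lborel. m r) = 0"
            unfolding set_lebesgue_integral_def by (rule integral_eq_zero_AE)
          then show ?thesis using m\<nu>[of x x] by simp
        qed
        show "dist (u s) (u t) \<le> measure \<nu> {s..t}" if "s \<le> t" for s t using le[OF that] by (simp add: m\<nu>)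
        show "fst p \<le> snd p \<and> {fst p..snd p} \<subseteq> {a..b}" if "p \<in> F" for p using that F C(2) unfolding K_def by fastforce
      qed (use F dis ab in \<open>auto simp: \<nu>_def U_def\<close>)
      also have "(\<Sum>p\<in>F. dist (u (fst p)) (u (snd p))) \<le> (\<Sum>p\<in>F. measure \<rho> (U p))"
        using F C(2) by (intro sum_mono) (auto simp: K_def U_def)
      also have "(\<Sum>p\<in>F. measure \<rho> (U p)) = measure \<rho> (\<Union>p\<in>F. U p)"
        using F dis by (intro \<rho>.finite_measure_finite_Union[symmetric]) (auto simp: \<rho>_def U_def)
      also have "\<dots> \<le> measure \<rho> {a..b}"
        using F C(2) by (intro \<rho>.finite_measure_mono) (fastforce simp: K_def U_def \<rho>_def)+
      finally show ?thesis by (simp add: U_def)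
    qed
    \<comment> \<open>exhaust the countable selection by finite ones; the mass of the gaps tends to zero\<close>
    have "dist (u a) (u b) \<le> measure \<rho> {a..b}"
    proof -
      obtain F :: "nat \<Rightarrow> (real \<times> real) set" where F: "\<And>n. finite (F n)" "incseq F" "(\<Union>n. F n) = C"
      proof (cases "C = {}")
        case True then show ?thesis by (intro that[of "\<lambda>_. {}"]) auto
      next
        case False
        have "range (from_nat_into C) = C" using range_from_nat_into[OF False C(1)] .
        moreover have "(\<Union>n. from_nat_into C ` {..n}) = range (from_nat_into C)"
          by (auto intro: image_eqI[OF _ atMost_iff[THEN iffD2, OF order_refl]])
        ultimately have "(\<Union>n. from_nat_into C ` {..n}) = C" by simp
        then show ?thesis
          by (intro that[of "\<lambda>n. from_nat_into C ` {..n}"]) (auto simp: incseq_def)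
      qed
      have FC: "F n \<subseteq> C" for n using F(3) by auto
      define A where "A = (\<lambda>n. {a..b} - (\<Union>p\<in>F n. U p))"
      have "(\<lambda>n. measure \<nu> (A n)) \<longlonglongrightarrow> measure \<nu> (\<Inter>n. A n)"
      proof (rule \<nu>.finite_Lim_measure_decseq)
        show "range A \<subseteq> sets \<nu>" using F(1) by (auto simp: A_def \<nu>_def U_def intro!: sets.Diff sets.finite_UN)
        show "decseq A" using F(2) unfolding A_def decseq_def incseq_def by blast
      qed
      moreover have "measure \<nu> (\<Inter>n. A n) = 0"
      proof -
        have "AE t in lborel. t \<notin> (\<Inter>n. A n)"
          using AE_not_in[OF C(4)] Dg gdiff AE_lborel_singleton[of a] AE_lborel_singleton[of b]
        proof eventually_elim
          fix t assume t: "t \<notin> N" "D t = ereal (g t)" "((\<lambda>h. (G (t + h) - G t) / h) \<longlongrightarrow> g t) (at 0)" "t \<noteq> a" "t \<noteq> b"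
          show "t \<notin> (\<Inter>n. A n)"
          proof
            assume "t \<in> (\<Inter>n. A n)"
            then have "t \<in> {a..b}" "\<And>n. t \<notin> (\<Union>p\<in>F n. U p)" by (auto simp: A_def)
            then have "t \<in> S" "t \<notin> (\<Union>p\<in>C. U p)" using t F(3) by (auto simp: S_def)
            then show False using C(5) t(1) unfolding U_def by blast
          qed
        qed
        moreover have [measurable]: "(\<Inter>n. A n) \<in> sets borel"
          using F(1) by (intro sets.countable_INT'') (auto simp: A_def U_def intro!: sets.Diff sets.finite_UN)
        ultimately have "(\<Inter>n. A n) \<in> null_sets lborel" by (subst AE_iff_null_sets) auto
        moreover have "null_sets lborel \<subseteq> null_sets \<nu>"
          using absolutely_continuousI_density[of "\<lambda>x. ennreal (m x)" lborel] by (simp add: \<nu>_def absolutely_continuous_def)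
        ultimately have "(\<Inter>n. A n) \<in> null_sets \<nu>" by blast
        then show ?thesis by (simp add: measure_def null_setsD1)
      qed
      ultimately have "(\<lambda>n. measure \<rho> {a..b} + measure \<nu> (A n)) \<longlonglongrightarrow> measure \<rho> {a..b} + 0"
        by (intro tendsto_add) auto
      moreover have "dist (u a) (u b) \<le> measure \<rho> {a..b} + measure \<nu> (A n)" for n
        using fin_bound[OF F(1) FC, of n] by (simp add: A_def)
      ultimately show ?thesis by (intro LIMSEQ_le_const[of "\<lambda>n. measure \<rho> {a..b} + measure \<nu> (A n)"]) auto
    qed
    also have "\<dots> = (LINT r:{a..b}|lborel. g r) + \<eta> * (b - a)" using ab by (simp add: m\<rho> kI)
    finally show "dist (u a) (u b) \<le> (LINT r:{a..b}|lborel. g r) + e" using \<eta> by linarith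
  qed
  have "AE t in lborel. ((\<lambda>s. dist (u s) (u t) / \<bar>t - s\<bar>) \<longlongrightarrow> g t) (at t)"
    using gdiff Dg
  proof eventually_elim
    fix t assume t: "((\<lambda>h. (G (t + h) - G t) / h) \<longlongrightarrow> g t) (at 0)" "D t = ereal (g t)"
    have qG: "q t h \<le> (G (t + h) - G t) / h" if "h \<noteq> 0" for h
      using that main[of t "t+h"] main[of "t+h" t] integral_atMost_diff[OF g, of t "t+h"] integral_atMost_diff[OF g, of "t+h" t]
      by (cases "h > 0") (auto simp: q_def G_def dist_commute field_simps)
    have "(q t \<longlongrightarrow> g t) (at 0)"
    proof (rule order_tendstoI)
      fix a assume "a < g t"
      then have "ereal a < Liminf (at 0) (\<lambda>h. ereal (q t h))" using t(2) by (simp add: D_def)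
      from less_LiminfD[OF this] show "\<forall>\<^sub>F h in at 0. a < q t h" by simp
    next
      fix b assume "g t < b"
      from order_tendstoD(2)[OF t(1) this] have "\<forall>\<^sub>F h in at 0. (G (t + h) - G t) / h < b \<and> h \<noteq> 0"
        by (simp add: eventually_conj_iff eventually_neq_at_within)
      then show "\<forall>\<^sub>F h in at 0. q t h < b" by eventually_elim (use qG in force)
    qed
    then show "((\<lambda>s. dist (u s) (u t) / \<bar>t - s\<bar>) \<longlongrightarrow> g t) (at t)"
      by (intro LIM_offset_zero_cancel[of _ t]) (simp add: q_def[abs_def])
  qed
  with g g0 gm main show thesis using that by blast
qed

section \<open>Speeds of curves on the half-line\<close>

text \<open>A Borel version of the metric derivative on the half-line together with the estimates that characterize
  local absolute continuity with exponent 2. Unlike \<open>metric_deriv u\<close> itself, such a \<open>g\<close> can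
  be shifted, rescaled and glued pointwise, also on the null set where the limit does not exist.\<close>

definition is_speed :: "(real \<Rightarrow> 'a::metric_space) \<Rightarrow> (real \<Rightarrow> real) \<Rightarrow> bool" where
  "is_speed u g \<longleftrightarrow> g \<in> borel_measurable borel \<and> (\<forall>t. 0 \<le> g t) \<and>
     (\<forall>T. set_integrable lborel {0..T} (\<lambda>r. (g r)\<^sup>2)) \<and>
     (\<forall>s t. 0 \<le> s \<longrightarrow> s \<le> t \<longrightarrow> dist (u s) (u t) \<le> (LINT r:{s..t}|lborel. g r)) \<and>
     (AE t in lborel. t > 0 \<longrightarrow> ((\<lambda>s. dist (u s) (u t) / \<bar>t - s\<bar>) \<longlongrightarrow> g t) (at t))"

lemma
  assumes "is_speed u g"
  shows is_speed_measurable: "g \<in> borel_measurable borel"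
    and is_speed_nonneg: "0 \<le> g t"
    and is_speed_square_integrable: "set_integrable lborel {0..T} (\<lambda>r. (g r)\<^sup>2)"
    and is_speed_dist_le: "0 \<le> s \<Longrightarrow> s \<le> t \<Longrightarrow> dist (u s) (u t) \<le> (LINT r:{s..t}|lborel. g r)"
    and is_speed_AE: "AE t in lborel. t > 0 \<longrightarrow> ((\<lambda>s. dist (u s) (u t) / \<bar>t - s\<bar>) \<longlongrightarrow> g t) (at t)"
  using assms by (auto simp: is_speed_def)

lemma le_1_plus_square: "x \<le> 1 + x\<^sup>2" for x :: real
proof -
  have "0 \<le> x\<^sup>2 - 2 * x + 1" using zero_le_power2[of "x - 1"] by (simp add: power2_diff)
  then show ?thesis using zero_le_power2[of x] by linarith
qed

lemma is_speed_integrable: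
  assumes "is_speed u g" "0 \<le> a"
  shows "set_integrable lborel {a..b} g"
proof -
  have [measurable]: "g \<in> borel_measurable borel" using is_speed_measurable[OF assms(1)] .
  have "set_integrable lborel {a..b} (\<lambda>r. 1 + (g r)\<^sup>2)"
  proof (rule set_integrable_subset)
    have "set_integrable lborel {0..max 0 b} (\<lambda>r. 1::real)"
      by (simp add: set_integrable_def)
    then show "set_integrable lborel {0..max 0 b} (\<lambda>r. 1 + (g r)\<^sup>2)"
      by (intro set_integral_add is_speed_square_integrable[OF assms(1)])
  qed (use assms in auto)
  then show ?thesis
    by (rule set_integrable_bound)
      (use is_speed_nonneg[OF assms(1)] in \<open>auto simp: set_borel_measurable_def intro!: AE_I2 le_1_plus_square\<close>)
qed

lemma metric_deriv_eq_speed: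
  assumes "is_speed u g"
  shows "AE t in lborel. t > 0 \<longrightarrow> metric_deriv u t = g t"
  using is_speed_AE[OF assms]
  by eventually_elim (auto simp: metric_deriv_def intro!: tendsto_Lim)

lemma is_speed_imp_AC_loc:
  assumes "is_speed u g"
  shows "u \<in> AC_loc 2 {0..}"
  unfolding AC_loc_def AC_def
proof (intro CollectI allI impI exI conjI ballI)
  fix a b :: real assume ab: "{a..b} \<subseteq> {0..}"
  have [measurable]: "g \<in> borel_measurable borel" using is_speed_measurable[OF assms(1)] .
  have "set_integrable lborel {a..b} (\<lambda>r. (g r)\<^sup>2)"
    by (rule set_integrable_subset[OF is_speed_square_integrable[OF assms, of b]]) (use ab in auto)
  then show "in_Lp 2 {a..b} g"
    using is_speed_nonneg[OF assms] by (simp add: in_Lp_def set_borel_measurable_def)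
  fix s t assume "s \<in> {a..b}" "t \<in> {a..b}" "s \<le> t"
  then show "dist (u s) (u t) \<le> (LINT r:{s..t}|lborel. g r)"
    using is_speed_dist_le[OF assms, of s t] ab by auto
qed

text \<open>Freezing a curve outside \<open>{0..n}\<close> gives a curve on the whole line with a globally integrable bound, which is
  the situation of \<open>metric_derivative_exists\<close>. Each \<open>m\<close> controls one compact interval only.\<close>

lemma clamped_curve_dist_le:
  fixes u :: "real \<Rightarrow> 'a::metric_space"
  assumes m: "integrable lborel (\<lambda>r. indicator {0..n} r * \<bar>m r\<bar>)"
    and le: "\<And>s t. 0 \<le> s \<Longrightarrow> s \<le> t \<Longrightarrow> t \<le> n \<Longrightarrow> dist (u s) (u t) \<le> (LINT r:{s..t}|lborel. m r)"
    and n: "0 \<le> n" and st: "s \<le> t"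
  shows "dist (u (max 0 (min n s))) (u (max 0 (min n t))) \<le> (LINT r:{s..t}|lborel. indicator {0..n} r * \<bar>m r\<bar>)"
proof -
  define s' t' where "s' = max 0 (min n s)" and "t' = max 0 (min n t)"
  have st': "0 \<le> s'" "s' \<le> t'" "t' \<le> n" using n st by (auto simp: s'_def t'_def)
  show ?thesis
  proof (cases "s' = t'")
    case True
    have "0 \<le> (LINT r:{s..t}|lborel. indicator {0..n} r * \<bar>m r\<bar>)"
      unfolding set_lebesgue_integral_def by (intro integral_nonneg_AE) auto
    then show ?thesis using True by (simp add: s'_def t'_def)
  next
    case False
    then have sub: "s \<le> s'" "t' \<le> t" using st by (auto simp: s'_def t'_def max_def min_def split: if_splits)
    have "dist (u s') (u t') \<le> (LINT r:{s'..t'}|lborel. m r)" by (rule le[OF st'])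
    also have "\<dots> \<le> (LINT r:{s..t}|lborel. indicator {0..n} r * \<bar>m r\<bar>)"
      unfolding set_lebesgue_integral_def
    proof (rule integral_mono')
      show "integrable lborel (\<lambda>r. indicator {s..t} r *\<^sub>R (indicator {0..n} r * \<bar>m r\<bar>))"
        by (intro integrable_mult_indicator m) auto
    qed (use sub st' in \<open>auto simp: indicator_def\<close>)
    finally show ?thesis by (simp add: s'_def t'_def)
  qed
qed

lemma continuous_if_clamps_continuous:
  fixes u :: "real \<Rightarrow> 'a::metric_space"
  assumes "\<And>n::nat. continuous_on UNIV (\<lambda>t. u (max 0 (min (real n) t)))"
  shows "continuous_on UNIV (\<lambda>t. u (max 0 t))"
proof -
  have "continuous_on (\<Union>n\<in>UNIV. {..<real n}) (\<lambda>t. u (max 0 t))"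
  proof (rule continuous_on_open_UN)
    fix n :: nat
    have "continuous_on {..<real n} (\<lambda>t. u (max 0 (min (real n) t)))"
      using assms by (rule continuous_on_subset) auto
    then show "continuous_on {..<real n} (\<lambda>t. u (max 0 t))"
      by (rule continuous_on_eq) auto
  qed auto
  moreover have "(\<Union>n\<in>UNIV. {..<real n}) = UNIV" using reals_Archimedean2 by auto
  ultimately show ?thesis by simp
qed

text \<open>On each interval \<open>{0..n}\<close> the metric derivative exists almost everywhere. It does not depend on \<open>n\<close>, and the limit along
  the increments \<open>1 / (k + 1)\<close> is a Borel function that agrees with all these derivatives almost
  everywhere.\<close>

lemma AC_loc_imp_is_speed:
  fixes u :: "real \<Rightarrow> 'a::metric_space"
  assumes "u \<in> AC_loc 2 {0..}"
  obtains g where "is_speed u g"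
proof -
  have "\<forall>n::nat. \<exists>m. in_Lp 2 {0..real n} m \<and>
     (\<forall>s\<in>{0..real n}. \<forall>t\<in>{0..real n}. s \<le> t \<longrightarrow> dist (u s) (u t) \<le> set_lebesgue_integral lborel {s..t} m)"
    using assms by (auto simp: AC_loc_def AC_def)
  then obtain mm where mm: "\<And>n::nat. in_Lp 2 {0..real n} (mm n)"
     "\<And>n s t. s \<in> {0..real n} \<Longrightarrow> t \<in> {0..real n} \<Longrightarrow> s \<le> t \<Longrightarrow> dist (u s) (u t) \<le> set_lebesgue_integral lborel {s..t} (mm n)"
    by metis
  define m where "m = (\<lambda>n r. indicator {0..real n} r * \<bar>mm n r\<bar>)"
  define un where "un = (\<lambda>(n::nat) t. u (max 0 (min (real n) t)))"
  define u0 where "u0 = (\<lambda>t. u (max 0 t))"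
  have mmm[measurable]: "(\<lambda>r. indicator {0..real n} r * mm n r) \<in> borel_measurable borel" for n
    using mm(1)[of n] by (simp add: in_Lp_def set_borel_measurable_def)
  have mmeas[measurable]: "m n \<in> borel_measurable borel" for n
  proof -
    have "m n = (\<lambda>r. \<bar>indicator {0..real n} r * mm n r\<bar>)" by (simp add: m_def abs_mult fun_eq_iff)
    then show ?thesis by simp
  qed
  have m0: "0 \<le> m n r" for n r by (simp add: m_def)
  have m2: "integrable lborel (\<lambda>r. (m n r)\<^sup>2)" for n
  proof -
    have "integrable lborel (\<lambda>r. indicator {0..real n} r *\<^sub>R (\<bar>mm n r\<bar> powr 2))"
      using mm(1)[of n] by (simp only: in_Lp_def set_integrable_def)
    also have "(\<lambda>r. indicator {0..real n} r *\<^sub>R (\<bar>mm n r\<bar> powr 2)) = (\<lambda>r. (m n r)\<^sup>2)"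
      by (auto simp: m_def indicator_def fun_eq_iff)
    finally show ?thesis .
  qed
  have m1: "integrable lborel (m n)" for n
  proof (rule Bochner_Integration.integrable_bound)
    show "integrable lborel (\<lambda>r. indicator {0..real n} r + (m n r)\<^sup>2)"
      by (intro Bochner_Integration.integrable_add m2 integrable_real_indicator) auto
    have "m n r \<le> indicator {0..real n} r + (m n r)\<^sup>2" for r
      using le_1_plus_square[of "m n r"] by (auto simp: m_def indicator_def)
    then show "AE r in lborel. norm (m n r) \<le> norm (indicator {0..real n} r + (m n r)\<^sup>2)"
      using m0 by (intro AE_I2) (auto simp: abs_of_nonneg)
  qed simp
  have le: "dist (un n s) (un n t) \<le> (LINT r:{s..t}|lborel. m n r)" if "s \<le> t" for n s t
    using clamped_curve_dist_le[OF m1[of n, unfolded m_def], of u s t] mm(2) that by (simp add: un_def m_def)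
  define good where "good n g \<longleftrightarrow> integrable lborel g \<and> (\<forall>r. g r \<ge> 0) \<and> (AE r in lborel. g r \<le> m n r) \<and>
     (\<forall>s t. s \<le> t \<longrightarrow> dist (un n s) (un n t) \<le> (LINT r:{s..t}|lborel. g r)) \<and>
     (AE t in lborel. ((\<lambda>s. dist (un n s) (un n t) / \<bar>t - s\<bar>) \<longlongrightarrow> g t) (at t))" for n g
  have "\<forall>n. \<exists>g. good n g"
  proof
    fix n
    obtain g where g: "integrable lborel g" "\<And>r. g r \<ge> 0" "AE r in lborel. g r \<le> m n r"
      "\<And>s t. s \<le> t \<Longrightarrow> dist (un n s) (un n t) \<le> (LINT r:{s..t}|lborel. g r)"
      "AE t in lborel. ((\<lambda>s. dist (un n s) (un n t) / \<bar>t - s\<bar>) \<longlongrightarrow> g t) (at t)"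
      by (rule metric_derivative_exists[OF m1[of n] m0 le]) (assumption, rule that)
    show "\<exists>g. good n g"
      unfolding good_def by (rule exI[of _ g], intro conjI allI impI g)
  qed
  then obtain gn where good: "\<And>n. good n (gn n)" by (auto dest: choice)
  have gn: "\<And>n. integrable lborel (gn n)" "\<And>n r. gn n r \<ge> 0" "\<And>n. AE r in lborel. gn n r \<le> m n r"
     "\<And>n s t. s \<le> t \<Longrightarrow> dist (un n s) (un n t) \<le> (LINT r:{s..t}|lborel. gn n r)"
     "\<And>n. AE t in lborel. ((\<lambda>s. dist (un n s) (un n t) / \<bar>t - s\<bar>) \<longlongrightarrow> gn n t) (at t)"
    using good unfolding good_def by simp_all
  have gnm[measurable]: "gn n \<in> borel_measurable borel" for n using gn(1)[of n] borel_measurable_integrable by force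
  have u0c: "continuous_on UNIV u0"
    unfolding u0_def using curve_continuous[OF m1 le] by (intro continuous_if_clamps_continuous) (simp add: un_def)
  define Q where "Q = (\<lambda>(k::nat) t. dist (u0 (t + inverse (real (Suc k)))) (u0 t) / inverse (real (Suc k)))"
  define g where "g = (\<lambda>t. \<bar>lim (\<lambda>k. Q k t)\<bar>)"
  have [measurable]: "Q k \<in> borel_measurable borel" for k
    unfolding Q_def
    by (intro borel_measurable_continuous_onI continuous_intros continuous_on_compose2[OF u0c]) auto
  have gmeas[measurable]: "g \<in> borel_measurable borel" unfolding g_def by measurable
  have key: "AE t in lborel. \<forall>n. 0 < t \<and> t < real n \<longrightarrow>
     ((\<lambda>s. dist (u s) (u t) / \<bar>t - s\<bar>) \<longlongrightarrow> gn n t) (at t) \<and> g t = gn n t"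
    unfolding AE_all_countable
  proof
    fix n
    show "AE t in lborel. 0 < t \<and> t < real n \<longrightarrow>
     ((\<lambda>s. dist (u s) (u t) / \<bar>t - s\<bar>) \<longlongrightarrow> gn n t) (at t) \<and> g t = gn n t"
      using gn(5)[of n]
    proof (eventually_elim, intro impI)
      fix t assume lim: "((\<lambda>s. dist (un n s) (un n t) / \<bar>t - s\<bar>) \<longlongrightarrow> gn n t) (at t)" and t: "0 < t \<and> t < real n"
      have "\<forall>\<^sub>F s in at t. s \<in> {0<..<real n}"
        using t by (intro eventually_at_in_open') auto
      then have "\<forall>\<^sub>F s in at t. dist (un n s) (un n t) / \<bar>t - s\<bar> = dist (u s) (u t) / \<bar>t - s\<bar>"
        by eventually_elim (use t in \<open>auto simp: un_def\<close>)
      with lim have lim2: "((\<lambda>s. dist (u s) (u t) / \<bar>t - s\<bar>) \<longlongrightarrow> gn n t) (at t)"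
        by (rule Lim_transform_eventually)
      have "filterlim (\<lambda>k. t + inverse (real (Suc k))) (at t) sequentially"
        using LIMSEQ_inverse_real_of_nat_add[of t] by (intro filterlim_atI) auto
      from filterlim_compose[OF lim2 this] have "(\<lambda>k. Q k t) \<longlonglongrightarrow> gn n t"
        using t by (simp add: Q_def u0_def)
      then have "lim (\<lambda>k. Q k t) = gn n t" by (rule limI)
      then show "((\<lambda>s. dist (u s) (u t) / \<bar>t - s\<bar>) \<longlongrightarrow> gn n t) (at t) \<and> g t = gn n t"
        using lim2 gn(2)[of n t] by (simp add: g_def)
    qed
  qed
  have gAE: "AE t in lborel. t \<in> {0..T} \<longrightarrow> g t = gn n t" if "T < real n" for n T
    using key AE_lborel_singleton[of 0] by eventually_elim (use that in force)
  show thesis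
  proof (rule that, unfold is_speed_def, intro conjI allI impI)
    show "0 \<le> g t" for t by (simp add: g_def)
    show "set_integrable lborel {0..T} (\<lambda>r. (g r)\<^sup>2)" for T
    proof -
      obtain n :: nat where n: "T < real n" using reals_Archimedean2 by blast
      show ?thesis
        unfolding set_integrable_def
      proof (rule Bochner_Integration.integrable_bound[OF m2[of n]])
        show "AE r in lborel. norm (indicator {0..T} r *\<^sub>R (g r)\<^sup>2) \<le> norm ((m n r)\<^sup>2)"
          using gAE[OF n] gn(3)[of n]
        proof eventually_elim
          fix r assume "r \<in> {0..T} \<longrightarrow> g r = gn n r" "gn n r \<le> m n r"
          then show "norm (indicator {0..T} r *\<^sub>R (g r)\<^sup>2) \<le> norm ((m n r)\<^sup>2)"
            using gn(2)[of n r] by (auto simp: indicator_def intro!: power_mono)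
        qed
      qed simp
    qed
    show "dist (u s) (u t) \<le> (LINT r:{s..t}|lborel. g r)" if st: "0 \<le> s" "s \<le> t" for s t
    proof -
      obtain n :: nat where n: "t < real n" using reals_Archimedean2 by blast
      have "dist (u s) (u t) \<le> (LINT r:{s..t}|lborel. gn n r)"
        using gn(4)[OF st(2), of n] n st by (simp add: un_def)
      also have "\<dots> = (LINT r:{s..t}|lborel. g r)"
      proof (rule set_lebesgue_integral_cong_AE)
        show "AE r\<in>{s..t} in lborel. gn n r = g r"
          using gAE[OF n] by eventually_elim (use st in auto)
      qed auto
      finally show ?thesis .
    qed
    show "AE t in lborel. t > 0 \<longrightarrow> ((\<lambda>s. dist (u s) (u t) / \<bar>t - s\<bar>) \<longlongrightarrow> g t) (at t)"
      using key
    proof eventually_elim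
      fix t assume *: "\<forall>n. 0 < t \<and> t < real n \<longrightarrow>
         ((\<lambda>s. dist (u s) (u t) / \<bar>t - s\<bar>) \<longlongrightarrow> gn n t) (at t) \<and> g t = gn n t"
      obtain n :: nat where "t < real n" using reals_Archimedean2 by blast
      with * show "t > 0 \<longrightarrow> ((\<lambda>s. dist (u s) (u t) / \<bar>t - s\<bar>) \<longlongrightarrow> g t) (at t)" by auto
    qed
  qed simp
qed

text \<open>The set of exceptions need not be Borel here; it is enclosed in a Borel null set before the
  substitution.\<close>

lemma AE_lborel_affine:
  fixes c t :: real
  assumes c: "c \<noteq> 0" and P: "AE x in lborel. P x"
  shows "AE x in lborel. P (t + c * x)"
proof -
  obtain N where N: "N \<in> null_sets lborel" "{x \<in> space lborel. \<not> P x} \<subseteq> N"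
    using P unfolding eventually_ae_filter by blast
  have "AE x in lborel. x \<notin> N" by (rule AE_not_in[OF N(1)])
  moreover have "Measurable.pred borel (\<lambda>x. x \<notin> N)" using N(1) by auto
  ultimately have "AE x in lborel. t + c * x \<notin> N" using AE_borel_affine[OF c] by blast
  then show ?thesis by eventually_elim (use N(2) in auto)
qed

lemma set_integrable_affine:
  fixes f :: "real \<Rightarrow> real"
  assumes "set_integrable lborel {s + c * a..s + c * b} f" "c > 0"
  shows "set_integrable lborel {a..b} (\<lambda>x. f (s + c * x))"
proof -
  have "integrable lborel (\<lambda>x. indicator {s + c * a..s + c * b} (s + c * x) *\<^sub>R f (s + c * x))"
    using assms lborel_integrable_real_affine[of "\<lambda>x. indicator {s + c * a..s + c * b} x *\<^sub>R f x" c s]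
    by (simp add: set_integrable_def)
  also have "(\<lambda>x. indicator {s + c * a..s + c * b} (s + c * x) *\<^sub>R f (s + c * x)) = (\<lambda>x. indicator {a..b} x *\<^sub>R f (s + c * x))"
    using assms(2) by (auto simp: indicator_def fun_eq_iff)
  finally show ?thesis by (simp add: set_integrable_def)
qed

lemma set_integral_affine:
  fixes f :: "real \<Rightarrow> real"
  assumes "c > 0"
  shows "(LINT x:{s + c * a..s + c * b}|lborel. f x) = c * (LINT x:{a..b}|lborel. f (s + c * x))"
proof -
  have "(LINT x:{s + c * a..s + c * b}|lborel. f x) =
      c * (LINT x|lborel. indicator {s + c * a..s + c * b} (s + c * x) *\<^sub>R f (s + c * x))"
    using assms lborel_integral_real_affine[of c "\<lambda>x. indicator {s + c * a..s + c * b} x *\<^sub>R f x" s]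
    by (simp add: set_lebesgue_integral_def)
  also have "(\<lambda>x. indicator {s + c * a..s + c * b} (s + c * x) *\<^sub>R f (s + c * x)) = (\<lambda>x. indicator {a..b} x *\<^sub>R f (s + c * x))"
    using assms by (auto simp: indicator_def fun_eq_iff)
  finally show ?thesis by (simp add: set_lebesgue_integral_def)
qed

lemma set_integral_split:
  fixes f :: "real \<Rightarrow> real"
  assumes "set_integrable lborel {a..c} f" "a \<le> b" "b \<le> c"
  shows "(LINT x:{a..c}|lborel. f x) = (LINT x:{a..b}|lborel. f x) + (LINT x:{b..c}|lborel. f x)"
proof -
  have "{a..c} = {a..b} \<union> {b..c}" using assms by auto
  moreover have "(LINT x:{a..b} \<union> {b..c}|lborel. f x) = (LINT x:{a..b}|lborel. f x) + (LINT x:{b..c}|lborel. f x)"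
  proof (rule set_integral_Un_AE)
    show "AE x in lborel. \<not> (x \<in> {a..b} \<and> x \<in> {b..c})"
      using AE_lborel_singleton[of b] by eventually_elim auto
  qed (use assms in \<open>auto intro: set_integrable_subset[OF assms(1)]\<close>)
  ultimately show ?thesis by simp
qed

lemma is_speed_affine:
  assumes g: "is_speed u g" and s: "s \<ge> 0" and c: "c > 0"
  shows "is_speed (\<lambda>h. u (s + c * h)) (\<lambda>h. c * g (s + c * h))"
  unfolding is_speed_def
proof (intro conjI allI impI)
  have [measurable]: "g \<in> borel_measurable borel" using is_speed_measurable[OF g] .
  show "(\<lambda>h. c * g (s + c * h)) \<in> borel_measurable borel" by measurable
  show "0 \<le> c * g (s + c * h)" for h using c is_speed_nonneg[OF g] by simp
  show "set_integrable lborel {0..T} (\<lambda>h. (c * g (s + c * h))\<^sup>2)" for T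
  proof -
    have "set_integrable lborel {0..T} (\<lambda>h. (g (s + c * h))\<^sup>2)"
      by (rule set_integrable_affine[OF set_integrable_subset[OF is_speed_square_integrable[OF g, of "s + c * T"]]])
        (use s c in auto)
    then show ?thesis by (simp add: power_mult_distrib)
  qed
  show "dist (u (s + c * a)) (u (s + c * b)) \<le> (LINT h:{a..b}|lborel. c * g (s + c * h))" if "0 \<le> a" "a \<le> b" for a b
    using is_speed_dist_le[OF g, of "s + c * a" "s + c * b"] that s c
    by (simp add: set_integral_affine)
  have "AE t in lborel. s + c * t > 0 \<longrightarrow> ((\<lambda>r. dist (u r) (u (s + c * t)) / \<bar>s + c * t - r\<bar>) \<longlongrightarrow> g (s + c * t)) (at (s + c * t))"
    using AE_lborel_affine[OF _ is_speed_AE[OF g], of c s] c by simp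
  then show "AE t in lborel. t > 0 \<longrightarrow> ((\<lambda>h. dist (u (s + c * h)) (u (s + c * t)) / \<bar>t - h\<bar>) \<longlongrightarrow> c * g (s + c * t)) (at t)"
  proof (eventually_elim, intro impI)
    fix t :: real
    assume lim: "s + c * t > 0 \<longrightarrow> ((\<lambda>r. dist (u r) (u (s + c * t)) / \<bar>s + c * t - r\<bar>) \<longlongrightarrow> g (s + c * t)) (at (s + c * t))" and t: "t > 0"
    have fl: "filterlim (\<lambda>h. s + c * h) (at (s + c * t)) (at t)"
    proof (rule filterlim_atI)
      show "((\<lambda>h. s + c * h) \<longlongrightarrow> s + c * t) (at t)" by (intro tendsto_intros)
      show "\<forall>\<^sub>F h in at t. s + c * h \<noteq> s + c * t" using c by (auto simp: eventually_at_filter)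
    qed
    have "s + c * t > 0" using t s c by (simp add: add_nonneg_pos)
    from filterlim_compose[OF lim[rule_format, OF this] fl]
    have "((\<lambda>h. dist (u (s + c * h)) (u (s + c * t)) / \<bar>s + c * t - (s + c * h)\<bar>) \<longlongrightarrow> g (s + c * t)) (at t)" .
    from tendsto_mult_left[OF this, of c]
    have "((\<lambda>h. c * (dist (u (s + c * h)) (u (s + c * t)) / \<bar>s + c * t - (s + c * h)\<bar>)) \<longlongrightarrow> c * g (s + c * t)) (at t)" .
    moreover have "c * (dist (u (s + c * h)) (u (s + c * t)) / \<bar>s + c * t - (s + c * h)\<bar>) = dist (u (s + c * h)) (u (s + c * t)) / \<bar>t - h\<bar>" for h
    proof -
      have "\<bar>s + c * t - (s + c * h)\<bar> = c * \<bar>t - h\<bar>"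
        using c by (simp add: right_diff_distrib[symmetric] abs_mult)
      then show ?thesis using c by simp
    qed
    ultimately show "((\<lambda>h. dist (u (s + c * h)) (u (s + c * t)) / \<bar>t - h\<bar>) \<longlongrightarrow> c * g (s + c * t)) (at t)" by simp
  qed
qed

text \<open>Only the junction could violate the properties of a speed: the time \<open>\<delta>\<close> is a null set for the limit, and the triangle
  inequality through the common point handles distances across it.\<close>

lemma is_speed_concat:
  fixes p v :: "real \<Rightarrow> 'a::metric_space"
  assumes gp: "is_speed p gp" and gv: "is_speed v gv" and join: "v 0 = p \<delta>" and \<delta>: "\<delta> \<ge> 0"
  shows "is_speed (\<lambda>h. if h \<le> \<delta> then p h else v (h - \<delta>)) (\<lambda>h. if h \<le> \<delta> then gp h else gv (h - \<delta>))"
    (is "is_speed ?w ?g")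
proof -
  have [measurable]: "gp \<in> borel_measurable borel" "gv \<in> borel_measurable borel"
    using is_speed_measurable gp gv by blast+
  have gm[measurable]: "?g \<in> borel_measurable borel" by measurable
  have g0: "0 \<le> ?g h" for h using is_speed_nonneg gp gv by auto
  have g2: "set_integrable lborel {0..T} (\<lambda>h. (?g h)\<^sup>2)" for T
  proof -
    have "set_integrable lborel {\<delta>..T} (\<lambda>h. (gv (-\<delta> + 1 * h))\<^sup>2)"
      by (rule set_integrable_affine[OF set_integrable_subset[OF is_speed_square_integrable[OF gv, of "T"]]])
        (use \<delta> in auto)
    moreover have "set_integrable lborel {0..T} (\<lambda>h. (gp h)\<^sup>2)" using is_speed_square_integrable[OF gp] .
    ultimately have "integrable lborel (\<lambda>h. indicator {0..T} h *\<^sub>R (gp h)\<^sup>2 + indicator {\<delta>..T} h *\<^sub>R (gv (-\<delta> + 1 * h))\<^sup>2)"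
      unfolding set_integrable_def by (rule Bochner_Integration.integrable_add[rotated])
    then show ?thesis
      unfolding set_integrable_def
      by (rule Bochner_Integration.integrable_bound) (auto simp: indicator_def)
  qed
  have gi: "set_integrable lborel {a..b} ?g" if "0 \<le> a" for a b
  proof -
    have "set_integrable lborel {0..max 0 b} (\<lambda>r. 1 + (?g r)\<^sup>2)"
      by (intro set_integral_add g2) (simp add: set_integrable_def)
    then have "set_integrable lborel {0..max 0 b} ?g"
      by (rule set_integrable_bound)
        (use g0 in \<open>auto simp: set_borel_measurable_def abs_of_nonneg simp del: split_paired_All intro!: AE_I2 le_1_plus_square\<close>)
    then show ?thesis by (rule set_integrable_subset) (use that in auto)
  qed
  have before: "dist (?w s) (?w t) \<le> (LINT h:{s..t}|lborel. ?g h)" if "0 \<le> s" "s \<le> t" "t \<le> \<delta>" for s t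
  proof -
    have "(LINT h:{s..t}|lborel. ?g h) = (LINT h:{s..t}|lborel. gp h)"
      using that by (intro set_lebesgue_integral_cong) auto
    then show ?thesis using is_speed_dist_le[OF gp, of s t] that by simp
  qed
  have after: "dist (v (s - \<delta>)) (v (t - \<delta>)) \<le> (LINT h:{s..t}|lborel. ?g h)" if "\<delta> \<le> s" "s \<le> t" for s t
  proof -
    have "(LINT h:{s..t}|lborel. ?g h) = (LINT h:{s..t}|lborel. gv (-\<delta> + 1 * h))"
    proof (rule set_lebesgue_integral_cong_AE)
      show "AE h\<in>{s..t} in lborel. ?g h = gv (-\<delta> + 1 * h)"
        using AE_lborel_singleton[of \<delta>] by eventually_elim (use that in auto)
    qed auto
    also have "\<dots> = (LINT h:{s - \<delta>..t - \<delta>}|lborel. gv h)"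
      using set_integral_affine[of 1 "-\<delta>" s t gv] by simp
    finally show ?thesis using is_speed_dist_le[OF gv, of "s - \<delta>" "t - \<delta>"] that by simp
  qed
  have d: "dist (?w s) (?w t) \<le> (LINT h:{s..t}|lborel. ?g h)" if st: "0 \<le> s" "s \<le> t" for s t
  proof -
    consider "t \<le> \<delta>" | "\<delta> < s" | "s \<le> \<delta>" "\<delta> < t" by linarith
    then show ?thesis
    proof cases
      case 1 then show ?thesis using before st by auto
    next
      case 2 then show ?thesis using after[of s t] st by auto
    next
      case 3
      have "dist (?w s) (?w t) \<le> dist (?w s) (?w \<delta>) + dist (v (\<delta> - \<delta>)) (v (t - \<delta>))"
        using 3 dist_triangle[of "p s" "v (t - \<delta>)" "p \<delta>"] join by simp
      also have "\<dots> \<le> (LINT h:{s..\<delta>}|lborel. ?g h) + (LINT h:{\<delta>..t}|lborel. ?g h)"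
        using 3 st by (intro add_mono before after) auto
      also have "\<dots> = (LINT h:{s..t}|lborel. ?g h)"
        by (rule set_integral_split[symmetric, OF gi]) (use 3 st in auto)
      finally show ?thesis .
    qed
  qed
  have "AE t in lborel. t > 0 \<longrightarrow> ((\<lambda>s. dist (?w s) (?w t) / \<bar>t - s\<bar>) \<longlongrightarrow> ?g t) (at t)"
    using is_speed_AE[OF gp] AE_lborel_affine[OF _ is_speed_AE[OF gv], of 1 "-\<delta>", simplified] AE_lborel_singleton[of \<delta>]
  proof (eventually_elim, intro impI)
    fix t
    assume p: "0 < t \<longrightarrow> ((\<lambda>s. dist (p s) (p t) / \<bar>t - s\<bar>) \<longlongrightarrow> gp t) (at t)"
      and v: "\<delta> < t \<longrightarrow> ((\<lambda>s. dist (v s) (v (t - \<delta>)) / \<bar>t - \<delta> - s\<bar>) \<longlongrightarrow> gv (t - \<delta>)) (at (t - \<delta>))"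
      and ne: "t \<noteq> \<delta>" and t: "0 < t"
    consider "t < \<delta>" | "\<delta> < t" using ne by linarith
    then show "((\<lambda>s. dist (?w s) (?w t) / \<bar>t - s\<bar>) \<longlongrightarrow> ?g t) (at t)"
    proof cases
      case 1
      have "\<forall>\<^sub>F s in at t. s \<in> {..<\<delta>}" using 1 by (intro eventually_at_in_open') auto
      then have "\<forall>\<^sub>F s in at t. dist (p s) (p t) / \<bar>t - s\<bar> = dist (?w s) (?w t) / \<bar>t - s\<bar>"
        by eventually_elim (use 1 in auto)
      moreover have "((\<lambda>s. dist (p s) (p t) / \<bar>t - s\<bar>) \<longlongrightarrow> ?g t) (at t)" using p t 1 by simp
      ultimately show ?thesis by (rule Lim_transform_eventually[rotated])
    next
      case 2
      have "filterlim (\<lambda>s. s - \<delta>) (at (t - \<delta>)) (at t)"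
      proof (rule filterlim_atI)
        show "((\<lambda>s. s - \<delta>) \<longlongrightarrow> t - \<delta>) (at t)" by (intro tendsto_intros)
        show "\<forall>\<^sub>F s in at t. s - \<delta> \<noteq> t - \<delta>" by (auto simp: eventually_at_filter)
      qed
      from filterlim_compose[OF v[rule_format, OF 2] this]
      have "((\<lambda>s. dist (v (s - \<delta>)) (v (t - \<delta>)) / \<bar>t - s\<bar>) \<longlongrightarrow> ?g t) (at t)" using 2 by simp
      moreover have "\<forall>\<^sub>F s in at t. s \<in> {\<delta><..}" using 2 by (intro eventually_at_in_open') auto
      then have "\<forall>\<^sub>F s in at t. dist (v (s - \<delta>)) (v (t - \<delta>)) / \<bar>t - s\<bar> = dist (?w s) (?w t) / \<bar>t - s\<bar>"
        by eventually_elim (use 2 in auto)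
      ultimately show ?thesis by (rule Lim_transform_eventually)
    qed
  qed
  with gm g0 g2 d show ?thesis unfolding is_speed_def by blast
qed

lemma is_speed_continuous:
  fixes u :: "real \<Rightarrow> 'a::metric_space"
  assumes g: "is_speed u g"
  shows "continuous_on UNIV (\<lambda>t. u (max 0 t))"
proof (rule continuous_if_clamps_continuous)
  fix n :: nat
  have m: "integrable lborel (\<lambda>r. indicator {0..real n} r * \<bar>g r\<bar>)"
    using set_integrable_abs[OF is_speed_integrable[OF g order_refl, of "real n"]] by (simp add: set_integrable_def)
  show "continuous_on UNIV (\<lambda>t. u (max 0 (min (real n) t)))"
    by (rule curve_continuous[OF m clamped_curve_dist_le[OF m is_speed_dist_le[OF g]]]) auto
qed

section \<open>Lower semicontinuity along curves\<close>

text \<open>This is what the second compatibility axiom is for: points metrically close to \<open>l\<close> are close to the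
  neighbourhood \<open>V\<close> of \<open>l\<close>, hence lie in \<open>U\<close>.\<close>

lemma compatible_limitin:
  fixes \<sigma> :: "'a::metric_space topology"
  assumes \<sigma>: "compatible \<sigma>" and x: "x \<longlonglongrightarrow> l"
  shows "limitin \<sigma> x l sequentially"
  unfolding limitin_def
proof (intro conjI allI impI)
  show "l \<in> topspace \<sigma>" using \<sigma> by (simp add: compatible_def)
  fix U assume "openin \<sigma> U \<and> l \<in> U"
  then obtain V \<delta> where V: "l \<in> V" "\<delta> > 0" "\<And>y. infdist y V < \<delta> \<Longrightarrow> y \<in> U"
    using \<sigma> unfolding compatible_def by meson
  have "\<forall>\<^sub>F n in sequentially. dist (x n) l < \<delta>" using x V(2) by (rule tendstoD)
  then show "\<forall>\<^sub>F n in sequentially. x n \<in> U"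
  proof eventually_elim
    fix n assume "dist (x n) l < \<delta>"
    moreover have "infdist (x n) V \<le> dist (x n) l" using V(1) by (rule infdist_le)
    ultimately show "x n \<in> U" using V(3) by simp
  qed
qed

lemma lsc_along_metric_limits:
  fixes \<sigma> :: "'a::metric_space topology"
  assumes \<sigma>: "compatible \<sigma>" and \<phi>: "seq_lsc \<sigma> \<phi>" and x: "x \<longlonglongrightarrow> l"
  shows "\<phi> l \<le> liminf (\<lambda>n. \<phi> (x n))"
proof -
  have "dist_bounded x"
  proof -
    have "bounded (range x)" using x convergent_imp_bounded by blast
    then obtain e where e: "\<And>a b. a \<in> range x \<Longrightarrow> b \<in> range x \<Longrightarrow> dist a b \<le> e"
      unfolding bounded_two_points by blast
    show ?thesis unfolding dist_bounded_def by (rule bdd_aboveI[of _ e]) (auto intro: e)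
  qed
  then show ?thesis using \<phi> compatible_limitin[OF \<sigma> x] by (auto simp: seq_lsc_def)
qed

text \<open>The sublevel sets of \<open>\<phi>\<close> along a continuous curve are sequentially closed.\<close>

lemma lsc_curve_measurable:
  fixes \<phi> :: "'a::metric_space \<Rightarrow> ereal"
  assumes lsc: "\<And>x l. x \<longlonglongrightarrow> l \<Longrightarrow> \<phi> l \<le> liminf (\<lambda>n. \<phi> (x n))"
    and c: "continuous_on UNIV (c :: real \<Rightarrow> 'a)"
  shows "(\<lambda>t. \<phi> (c t)) \<in> borel_measurable borel"
proof (rule borel_measurableI_le)
  fix y
  have "closed {t. \<phi> (c t) \<le> y}"
    unfolding closed_sequential_limits
  proof (intro allI impI)
    fix x l assume x: "(\<forall>n. x n \<in> {t. \<phi> (c t) \<le> y}) \<and> x \<longlonglongrightarrow> l"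
    then have "(\<lambda>n. c (x n)) \<longlonglongrightarrow> c l"
      using c by (auto simp: continuous_on_eq_continuous_at continuous_at_sequentially comp_def)
    from lsc[OF this] have "\<phi> (c l) \<le> liminf (\<lambda>n. \<phi> (c (x n)))" .
    also have "\<dots> \<le> liminf (\<lambda>n. y)" using x by (intro Liminf_mono always_eventually) auto
    finally show "l \<in> {t. \<phi> (c t) \<le> y}" by (simp add: Liminf_const)
  qed
  then show "{t \<in> space borel. \<phi> (c t) \<le> y} \<in> sets borel" by simp
qed

section \<open>The exponential weight\<close>

definition wed_weight :: "real \<Rightarrow> real \<Rightarrow> real" where
  "wed_weight \<epsilon> t = exp (- t / \<epsilon>) / \<epsilon>"

lemma wed_weight_pos: "\<epsilon> > 0 \<Longrightarrow> wed_weight \<epsilon> t > 0"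
  by (simp add: wed_weight_def)

lemma wed_weight_measurable[measurable]: "wed_weight \<epsilon> \<in> borel_measurable borel"
  unfolding wed_weight_def[abs_def] by measurable

lemma wed_weight_add: "wed_weight \<epsilon> (s + t) = exp (- s / \<epsilon>) * wed_weight \<epsilon> t"
proof -
  have "- (s + t) / \<epsilon> = - s / \<epsilon> + - t / \<epsilon>" unfolding add_divide_distrib[symmetric] by simp
  then show ?thesis by (simp only: wed_weight_def exp_add times_divide_eq_right)
qed

lemma mu_eq: "mu \<epsilon> = density lborel (\<lambda>t. ennreal (indicator {0<..} t * wed_weight \<epsilon> t))"
  by (simp add: mu_def wed_weight_def)

lemma sets_mu[simp, measurable_cong]: "sets (mu \<epsilon>) = sets borel"
  by (simp add: mu_def)

lemma AE_mu:
  assumes "\<epsilon> > 0"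
  shows "(AE t in mu \<epsilon>. P t) \<longleftrightarrow> (AE t in lborel. t > 0 \<longrightarrow> P t)"
  unfolding mu_eq using wed_weight_pos[OF assms]
  by (subst AE_density) (auto simp: indicator_def zero_less_mult_iff)

lemma integrable_mu_iff:
  fixes F :: "real \<Rightarrow> real"
  assumes \<epsilon>: "\<epsilon> > 0" and F[measurable]: "F \<in> borel_measurable borel"
  shows "integrable (mu \<epsilon>) F \<longleftrightarrow> set_integrable lborel {0..} (\<lambda>t. F t * wed_weight \<epsilon> t)"
    and "integral\<^sup>L (mu \<epsilon>) F = (LINT t:{0..}|lborel. F t * wed_weight \<epsilon> t)"
proof -
  have w: "AE t in lborel. 0 \<le> indicator {0<..} t * wed_weight \<epsilon> t"
    using wed_weight_pos[OF \<epsilon>] by (intro AE_I2) (simp add: less_imp_le)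
  have eq: "AE t in lborel. (indicator {0<..} t * wed_weight \<epsilon> t) *\<^sub>R F t = indicator {0..} t *\<^sub>R (F t * wed_weight \<epsilon> t)"
    using AE_lborel_singleton[of 0] by eventually_elim (auto simp: indicator_def)
  have m: "(\<lambda>t. (indicator {0<..} t * wed_weight \<epsilon> t) *\<^sub>R F t) \<in> borel_measurable lborel"
    "(\<lambda>t. indicator {0..} t *\<^sub>R (F t * wed_weight \<epsilon> t)) \<in> borel_measurable lborel"
    "(\<lambda>t. indicator {0<..} t * wed_weight \<epsilon> t) \<in> borel_measurable lborel"
    "F \<in> borel_measurable lborel" by measurable
  show "integrable (mu \<epsilon>) F \<longleftrightarrow> set_integrable lborel {0..} (\<lambda>t. F t * wed_weight \<epsilon> t)"
    unfolding mu_eq set_integrable_def integrable_density[OF m(4,3) w]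
    by (rule integrable_cong_AE[OF m(1,2) eq])
  show "integral\<^sup>L (mu \<epsilon>) F = (LINT t:{0..}|lborel. F t * wed_weight \<epsilon> t)"
    unfolding mu_eq set_lebesgue_integral_def integral_density[OF m(4,3) w]
    by (rule integral_cong_AE[OF m(1,2) eq])
qed

lemma nn_integral_mu:
  assumes [measurable]: "F \<in> borel_measurable borel"
  shows "(\<integral>\<^sup>+t. F t \<partial>mu \<epsilon>) = (\<integral>\<^sup>+t. ennreal (indicator {0<..} t * wed_weight \<epsilon> t) * F t \<partial>lborel)"
  unfolding mu_eq by (subst nn_integral_density) auto

lemma set_integrable_weight_iff:
  fixes f :: "real \<Rightarrow> real"
  assumes \<epsilon>: "\<epsilon> > 0" and f[measurable]: "f \<in> borel_measurable borel"
  shows "set_integrable lborel {0..T} (\<lambda>t. f t * wed_weight \<epsilon> t) \<longleftrightarrow> set_integrable lborel {0..T} f"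
proof
  assume "set_integrable lborel {0..T} f"
  then have "set_integrable lborel {0..T} (\<lambda>t. f t * (1 / \<epsilon>))" by auto
  then show "set_integrable lborel {0..T} (\<lambda>t. f t * wed_weight \<epsilon> t)"
  proof (rule set_integrable_bound)
    have "\<bar>f t * wed_weight \<epsilon> t\<bar> \<le> \<bar>f t * (1 / \<epsilon>)\<bar>" if "t \<in> {0..T}" for t
    proof -
      have "\<bar>wed_weight \<epsilon> t\<bar> \<le> \<bar>1 / \<epsilon>\<bar>"
        using \<epsilon> that by (simp add: wed_weight_def divide_right_mono)
      then show ?thesis unfolding abs_mult by (rule mult_left_mono) simp
    qed
    then show "AE t in lborel. t \<in> {0..T} \<longrightarrow> norm (f t * wed_weight \<epsilon> t) \<le> norm (f t * (1 / \<epsilon>))"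
      by auto
  qed (simp add: set_borel_measurable_def)
next
  assume "set_integrable lborel {0..T} (\<lambda>t. f t * wed_weight \<epsilon> t)"
  then have "set_integrable lborel {0..T} (\<lambda>t. f t * wed_weight \<epsilon> t * (\<epsilon> * exp (T / \<epsilon>)))"
    by (rule set_integrable_mult_left[rotated]) 
  then show "set_integrable lborel {0..T} f"
  proof (rule set_integrable_bound)
    have "\<bar>f t\<bar> \<le> \<bar>f t * wed_weight \<epsilon> t * (\<epsilon> * exp (T / \<epsilon>))\<bar>" if "t \<in> {0..T}" for t
    proof -
      have "1 \<le> wed_weight \<epsilon> t * (\<epsilon> * exp (T / \<epsilon>))"
        using \<epsilon> that by (simp add: wed_weight_def exp_minus exp_diff[symmetric] field_simps divide_right_mono)
      then have "\<bar>f t\<bar> * 1 \<le> \<bar>f t\<bar> * (wed_weight \<epsilon> t * (\<epsilon> * exp (T / \<epsilon>)))"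
        by (intro mult_left_mono) auto
      then show ?thesis using wed_weight_pos[OF \<epsilon>, of t] \<epsilon> by (simp add: abs_mult mult.assoc)
    qed
    then show "AE t in lborel. t \<in> {0..T} \<longrightarrow> norm (f t) \<le> norm (f t * wed_weight \<epsilon> t * (\<epsilon> * exp (T / \<epsilon>)))"
      by auto
  qed (auto simp: set_borel_measurable_def)
qed

text \<open>The weight is memoryless: by \<open>wed_weight_add\<close> the part of the integral after time \<open>\<delta>\<close> is the integral of the
  continuation, discounted by the factor \<open>exp (- \<delta> / \<epsilon>)\<close>. This is the source of dynamic programming.\<close>

lemma mu_concat:
  fixes F1 F2 :: "real \<Rightarrow> real"
  assumes \<epsilon>: "\<epsilon> > 0" and \<delta>: "\<delta> \<ge> 0"
    and [measurable]: "F1 \<in> borel_measurable borel" "F2 \<in> borel_measurable borel"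
    and F1: "set_integrable lborel {0..\<delta>} F1" and F2: "integrable (mu \<epsilon>) F2"
  shows "integrable (mu \<epsilon>) (\<lambda>t. if t \<le> \<delta> then F1 t else F2 (t - \<delta>))"
    and "(LINT t|mu \<epsilon>. (if t \<le> \<delta> then F1 t else F2 (t - \<delta>))) =
      (LINT t:{0..\<delta>}|lborel. F1 t * wed_weight \<epsilon> t) + exp (- \<delta> / \<epsilon>) * integral\<^sup>L (mu \<epsilon>) F2"
proof -
  let ?W = "\<lambda>t. indicator {0..} t *\<^sub>R ((if t \<le> \<delta> then F1 t else F2 (t - \<delta>)) * wed_weight \<epsilon> t)"
  let ?A = "\<lambda>t. indicator {0..\<delta>} t *\<^sub>R (F1 t * wed_weight \<epsilon> t)"
  let ?B = "\<lambda>t. indicator {0..} t *\<^sub>R (F2 t * wed_weight \<epsilon> t)"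
  have A: "integrable lborel ?A"
    using F1 set_integrable_weight_iff[OF \<epsilon>, of F1 \<delta>] by (simp add: set_integrable_def)
  have B: "integrable lborel ?B"
    using F2 integrable_mu_iff(1)[OF \<epsilon>, of F2] by (simp add: set_integrable_def)
  have B': "integrable lborel (\<lambda>t. exp (- \<delta> / \<epsilon>) * ?B (-\<delta> + 1 * t))"
    using lborel_integrable_real_affine[OF B, of 1 "-\<delta>"] by (intro integrable_mult_right) auto
  have eq: "AE t in lborel. ?A t + exp (- \<delta> / \<epsilon>) * ?B (-\<delta> + 1 * t) = ?W t"
    using AE_lborel_singleton[of \<delta>]
  proof eventually_elim
    fix t assume "t \<noteq> \<delta>"
    then show "?A t + exp (- \<delta> / \<epsilon>) * ?B (-\<delta> + 1 * t) = ?W t"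
      using \<delta> wed_weight_add[of \<epsilon> \<delta> "t - \<delta>"] by (auto simp: indicator_def)
  qed
  have W: "integrable lborel ?W"
    using Bochner_Integration.integrable_add[OF A B'] by (rule integrable_cong_AE_imp) (use eq in auto)
  then show "integrable (mu \<epsilon>) (\<lambda>t. if t \<le> \<delta> then F1 t else F2 (t - \<delta>))"
    by (subst integrable_mu_iff(1)[OF \<epsilon>]) (auto simp: set_integrable_def)
  have "(LINT t|mu \<epsilon>. (if t \<le> \<delta> then F1 t else F2 (t - \<delta>))) = (LINT t|lborel. ?W t)"
    by (subst integrable_mu_iff(2)[OF \<epsilon>]) (auto simp: set_lebesgue_integral_def)
  also have "\<dots> = (LINT t|lborel. ?A t + exp (- \<delta> / \<epsilon>) * ?B (-\<delta> + 1 * t))"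
    using eq by (intro integral_cong_AE) auto
  also have "\<dots> = (LINT t|lborel. ?A t) + exp (- \<delta> / \<epsilon>) * (LINT t|lborel. ?B (-\<delta> + 1 * t))"
    using A B' by (subst Bochner_Integration.integral_add) auto
  also have "(LINT t|lborel. ?B (-\<delta> + 1 * t)) = (LINT t|lborel. ?B t)"
    using lborel_integral_real_affine[of 1 ?B "-\<delta>"] by simp
  also have "\<dots> = integral\<^sup>L (mu \<epsilon>) F2"
    by (subst integrable_mu_iff(2)[OF \<epsilon>]) (auto simp: set_lebesgue_integral_def)
  finally show "(LINT t|mu \<epsilon>. (if t \<le> \<delta> then F1 t else F2 (t - \<delta>))) =
      (LINT t:{0..\<delta>}|lborel. F1 t * wed_weight \<epsilon> t) + exp (- \<delta> / \<epsilon>) * integral\<^sup>L (mu \<epsilon>) F2"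
    by (simp add: set_lebesgue_integral_def)
qed

text \<open>Bound \<open>dist (u t) (u 0)\<close> by the integral of \<open>g\<close> over \<open>{0..t}\<close>, apply the Cauchy-Schwarz inequality to the product of
  \<open>g r * exp (- r / (4 * \<epsilon>))\<close> and \<open>exp (r / (4 * \<epsilon>))\<close>, and exchange the integrals. Splitting the
  exponential evenly leaves a kernel that decays in \<open>t\<close> and reproduces the weight when
  integrated over \<open>t \<ge> r\<close>.\<close>

lemma weighted_poincare:
  fixes u :: "real \<Rightarrow> 'a::metric_space"
  assumes g: "is_speed u g" and \<epsilon>: "\<epsilon> > 0"
  shows "(\<integral>\<^sup>+t. ennreal ((dist (u (max 0 t)) (u 0))\<^sup>2) \<partial>mu \<epsilon>) \<le> ennreal (4 * \<epsilon>\<^sup>2) * (\<integral>\<^sup>+t. ennreal ((g t)\<^sup>2) \<partial>mu \<epsilon>)"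
proof -
  define \<kappa> where "\<kappa> = 1 / (2 * \<epsilon>)"
  have \<kappa>: "\<kappa> > 0" "1 / \<epsilon> = 2 * \<kappa>" using \<epsilon> by (auto simp: \<kappa>_def)
  have w: "wed_weight \<epsilon> t = 2 * \<kappa> * exp (- 2 * \<kappa> * t)" for t
    using \<epsilon> by (simp add: wed_weight_def \<kappa>_def)
  have [measurable]: "g \<in> borel_measurable borel" using is_speed_measurable[OF g] .
  have g0: "0 \<le> g t" for t using is_speed_nonneg[OF g] .
  have uc: "continuous_on UNIV (\<lambda>t. u (max 0 t))" using is_speed_continuous[OF g] .
  have [measurable]: "(\<lambda>t. (dist (u (max 0 t)) (u 0))\<^sup>2) \<in> borel_measurable borel"
    by (intro borel_measurable_continuous_onI continuous_intros uc)
  define H where "H = (\<lambda>r t. ennreal (indicator {0..} r * (if r \<le> t then 1 else 0) * ((g r)\<^sup>2 * exp (- \<kappa> * r)) * (2 * exp (- \<kappa> * t))))"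
  have Hm: "case_prod H \<in> borel_measurable (lborel \<Otimes>\<^sub>M lborel)"
  proof -
    have "case_prod H = (\<lambda>p. ennreal (indicator {0..} (fst p) * (if fst p \<le> snd p then 1 else 0) *
        ((g (fst p))\<^sup>2 * exp (- \<kappa> * fst p)) * (2 * exp (- \<kappa> * snd p))))"
      by (simp add: H_def fun_eq_iff)
    then show ?thesis by (simp only:) measurable
  qed
  have pt: "ennreal ((dist (u (max 0 t)) (u 0))\<^sup>2) * ennreal (wed_weight \<epsilon> t) \<le> (\<integral>\<^sup>+r. H r t \<partial>lborel)" if t: "t > 0" for t
  proof -
    \<comment> \<open>the two factors for the Cauchy-Schwarz inequality, their squares having exponents \<open>- \<kappa> * r\<close> and \<open>\<kappa> * r\<close>\<close>
    let ?a = "\<lambda>r. indicator {0..t} r * g r * exp (- \<kappa> / 2 * r)"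
    let ?b = "\<lambda>r. indicator {0..t} r * exp (\<kappa> / 2 * r)"
    have "ennreal (dist (u t) (u 0)) \<le> ennreal (LINT r:{0..t}|lborel. g r)"
      using is_speed_dist_le[OF g, of 0 t] t by (intro ennreal_leI) (simp add: dist_commute)
    also have "\<dots> = (\<integral>\<^sup>+r. ennreal (indicator {0..t} r * g r) \<partial>lborel)"
      unfolding set_lebesgue_integral_def using is_speed_integrable[OF g, of 0 t] g0
      by (subst nn_integral_eq_integral) (auto simp: set_integrable_def)
    also have "\<dots> = (\<integral>\<^sup>+r. ennreal (?a r) * ennreal (?b r) \<partial>lborel)"
      using g0 by (intro nn_integral_cong) (auto simp: indicator_def ennreal_mult[symmetric] exp_add[symmetric] mult.assoc)
    finally have "(ennreal (dist (u t) (u 0)))\<^sup>2 \<le> (\<integral>\<^sup>+r. ennreal (?a r) * ennreal (?b r) \<partial>lborel)\<^sup>2"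
      by (rule power_mono) simp
    also have "\<dots> \<le> (\<integral>\<^sup>+r. (ennreal (?a r))\<^sup>2 \<partial>lborel) * (\<integral>\<^sup>+r. (ennreal (?b r))\<^sup>2 \<partial>lborel)"
      by (rule Cauchy_Schwarz_nn_integral) auto
    also have "(\<integral>\<^sup>+r. (ennreal (?b r))\<^sup>2 \<partial>lborel) = (\<integral>\<^sup>+r. ennreal (exp (\<kappa> * r)) * indicator {0..t} r \<partial>lborel)"
      by (intro nn_integral_cong) (auto simp: indicator_def ennreal_power exp_double[symmetric])
    also have "\<dots> = ennreal (exp (\<kappa> * t) / \<kappa> - exp (\<kappa> * 0) / \<kappa>)"
      using \<kappa> t by (intro nn_integral_FTC_Icc) (auto intro!: derivative_eq_intros)
    also have "\<dots> \<le> ennreal (exp (\<kappa> * t) / \<kappa>)" using \<kappa> by (intro ennreal_leI) auto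
    also have "(\<integral>\<^sup>+r. (ennreal (?a r))\<^sup>2 \<partial>lborel) = (\<integral>\<^sup>+r. ennreal (indicator {0..t} r * ((g r)\<^sup>2 * exp (- \<kappa> * r))) \<partial>lborel)"
      using g0 by (intro nn_integral_cong) (auto simp: indicator_def ennreal_power power_mult_distrib exp_double[symmetric])
    finally have 1: "ennreal ((dist (u t) (u 0))\<^sup>2) \<le> (\<integral>\<^sup>+r. ennreal (indicator {0..t} r * ((g r)\<^sup>2 * exp (- \<kappa> * r))) \<partial>lborel) * ennreal (exp (\<kappa> * t) / \<kappa>)"
      by (simp add: ennreal_power mult_left_mono)
    have "ennreal ((dist (u (max 0 t)) (u 0))\<^sup>2) * ennreal (wed_weight \<epsilon> t) \<le>
       (\<integral>\<^sup>+r. ennreal (indicator {0..t} r * ((g r)\<^sup>2 * exp (- \<kappa> * r))) \<partial>lborel) * (ennreal (exp (\<kappa> * t) / \<kappa>) * ennreal (wed_weight \<epsilon> t))"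
      using mult_right_mono[OF 1, of "ennreal (wed_weight \<epsilon> t)"] t by (simp add: mult.assoc)
    also have "ennreal (exp (\<kappa> * t) / \<kappa>) * ennreal (wed_weight \<epsilon> t) = ennreal (2 * exp (- \<kappa> * t))"
      using \<kappa> by (simp add: w ennreal_mult[symmetric] exp_add[symmetric])
    also have "(\<integral>\<^sup>+r. ennreal (indicator {0..t} r * ((g r)\<^sup>2 * exp (- \<kappa> * r))) \<partial>lborel) * ennreal (2 * exp (- \<kappa> * t)) =
       (\<integral>\<^sup>+r. H r t \<partial>lborel)"
      by (subst nn_integral_multc[symmetric]) (auto simp: H_def indicator_def ennreal_mult[symmetric] intro!: nn_integral_cong)
    finally show ?thesis .
  qed
  have "(\<integral>\<^sup>+t. ennreal ((dist (u (max 0 t)) (u 0))\<^sup>2) \<partial>mu \<epsilon>) =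
      (\<integral>\<^sup>+t. ennreal (indicator {0<..} t * wed_weight \<epsilon> t) * ennreal ((dist (u (max 0 t)) (u 0))\<^sup>2) \<partial>lborel)"
    by (rule nn_integral_mu) measurable
  also have "\<dots> \<le> (\<integral>\<^sup>+t. (\<integral>\<^sup>+r. H r t \<partial>lborel) \<partial>lborel)"
  proof (rule nn_integral_mono)
    fix t
    show "ennreal (indicator {0<..} t * wed_weight \<epsilon> t) * ennreal ((dist (u (max 0 t)) (u 0))\<^sup>2) \<le> (\<integral>\<^sup>+r. H r t \<partial>lborel)"
      using pt[of t] by (cases "t > 0") (auto simp: mult.commute)
  qed
  also have "\<dots> = (\<integral>\<^sup>+r. (\<integral>\<^sup>+t. H r t \<partial>lborel) \<partial>lborel)"
    by (rule lborel_pair.Fubini'[OF Hm])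
  also have "\<dots> = (\<integral>\<^sup>+r. ennreal (indicator {0..} r * (g r)\<^sup>2 * exp (- 2 * \<kappa> * r) * (2 / \<kappa>)) \<partial>lborel)"
  proof (rule nn_integral_cong)
    fix r
    have "(\<integral>\<^sup>+t. ennreal (2 * exp (- \<kappa> * t)) * indicator {r..} t \<partial>lborel) = ennreal (0 - (- 2 * exp (- \<kappa> * r) / \<kappa>))"
    proof (rule nn_integral_FTC_atLeast)
      show "((\<lambda>t. - 2 * exp (- \<kappa> * t) / \<kappa>) \<longlongrightarrow> 0) at_top"
      proof -
        have "filterlim (\<lambda>t. \<kappa> * t) at_top at_top"
          using \<kappa> by (intro filterlim_tendsto_pos_mult_at_top[OF tendsto_const]) (auto intro: filterlim_ident)
        then have "((\<lambda>t. exp (- (\<kappa> * t))) \<longlongrightarrow> 0) at_top"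
          by (intro filterlim_compose[OF exp_at_bot] filterlim_compose[OF filterlim_uminus_at_bot_at_top])
        from tendsto_mult_left[OF this, of "- 2 / \<kappa>"] show ?thesis by simp
      qed
    qed (use \<kappa> in \<open>auto intro!: derivative_eq_intros\<close>)
    then have I: "(\<integral>\<^sup>+t. ennreal (2 * exp (- \<kappa> * t)) * indicator {r..} t \<partial>lborel) = ennreal (2 * exp (- \<kappa> * r) / \<kappa>)" by simp
    have "(\<integral>\<^sup>+t. H r t \<partial>lborel) = (\<integral>\<^sup>+t. ennreal (indicator {0..} r * ((g r)\<^sup>2 * exp (- \<kappa> * r))) * (ennreal (2 * exp (- \<kappa> * t)) * indicator {r..} t) \<partial>lborel)"
      by (intro nn_integral_cong) (auto simp: H_def indicator_def ennreal_mult[symmetric])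
    also have "\<dots> = ennreal (indicator {0..} r * ((g r)\<^sup>2 * exp (- \<kappa> * r))) * ennreal (2 * exp (- \<kappa> * r) / \<kappa>)"
      by (subst nn_integral_cmult) (auto simp: I[simplified])
    also have "\<dots> = ennreal (indicator {0..} r * (g r)\<^sup>2 * exp (- 2 * \<kappa> * r) * (2 / \<kappa>))"
    proof -
      have "exp (- 2 * \<kappa> * r) = exp (- \<kappa> * r) * exp (- \<kappa> * r)" by (simp add: exp_add[symmetric])
      then show ?thesis using \<kappa> by (simp add: ennreal_mult[symmetric] indicator_def mult_ac)
    qed
    finally show "(\<integral>\<^sup>+t. H r t \<partial>lborel) = ennreal (indicator {0..} r * (g r)\<^sup>2 * exp (- 2 * \<kappa> * r) * (2 / \<kappa>))" .
  qed
  also have "\<dots> = (\<integral>\<^sup>+r. ennreal (4 * \<epsilon>\<^sup>2) * (ennreal (indicator {0<..} r * wed_weight \<epsilon> r) * ennreal ((g r)\<^sup>2)) \<partial>lborel)"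
  proof (rule nn_integral_cong_AE)
    show "AE r in lborel. ennreal (indicator {0..} r * (g r)\<^sup>2 * exp (- 2 * \<kappa> * r) * (2 / \<kappa>)) =
        ennreal (4 * \<epsilon>\<^sup>2) * (ennreal (indicator {0<..} r * wed_weight \<epsilon> r) * ennreal ((g r)\<^sup>2))"
      using AE_lborel_singleton[of 0]
    proof eventually_elim
      fix r :: real assume "r \<noteq> 0"
      moreover have "2 / \<kappa> = 4 * \<epsilon>\<^sup>2 * (2 * \<kappa>)" using \<epsilon> by (simp add: \<kappa>_def power2_eq_square)
      ultimately show "ennreal (indicator {0..} r * (g r)\<^sup>2 * exp (- 2 * \<kappa> * r) * (2 / \<kappa>)) =
        ennreal (4 * \<epsilon>\<^sup>2) * (ennreal (indicator {0<..} r * wed_weight \<epsilon> r) * ennreal ((g r)\<^sup>2))"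
        using \<kappa> by (auto simp: w ennreal_mult[symmetric] indicator_def mult_ac)
    qed
  qed
  also have "\<dots> = ennreal (4 * \<epsilon>\<^sup>2) * (\<integral>\<^sup>+t. ennreal ((g t)\<^sup>2) \<partial>mu \<epsilon>)"
    by (subst nn_integral_mu) (auto simp: nn_integral_cmult)
  finally show ?thesis .
qed

section \<open>Curves of finite cost\<close>

text \<open>Real-valued data from which the functional can be computed with Lebesgue integrals. For a
  lower semicontinuous coercive \<open>\<phi>\<close>, existence of such data means that \<open>u\<close> is admissible with cost below \<open>\<infinity>\<close>; see \<open>finite_cost_admissible\<close>,
  \<open>finite_cost_WED\<close> and \<open>finite_cost_exists\<close>.\<close>

definition finite_cost ::
  "real \<Rightarrow> ('a::metric_space \<Rightarrow> ereal) \<Rightarrow> (real \<Rightarrow> 'a) \<Rightarrow> (real \<Rightarrow> real) \<Rightarrow> (real \<Rightarrow> real) \<Rightarrow> bool" where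
  "finite_cost \<epsilon> \<phi> u g f \<longleftrightarrow> is_speed u g \<and> f \<in> borel_measurable borel \<and>
     (AE t in lborel. t > 0 \<longrightarrow> \<phi> (u t) = ereal (f t)) \<and>
     integrable (mu \<epsilon>) (\<lambda>t. (g t)\<^sup>2) \<and> integrable (mu \<epsilon>) f"

definition wed_cost :: "real \<Rightarrow> (real \<Rightarrow> real) \<Rightarrow> (real \<Rightarrow> real) \<Rightarrow> real" where
  "wed_cost \<epsilon> g f = (LINT t|mu \<epsilon>. \<epsilon> / 2 * (g t)\<^sup>2 + f t)"

lemma
  assumes "finite_cost \<epsilon> \<phi> u g f"
  shows finite_cost_speed: "is_speed u g"
    and finite_cost_measurable: "f \<in> borel_measurable borel" "g \<in> borel_measurable borel"
    and finite_cost_AE: "AE t in lborel. t > 0 \<longrightarrow> \<phi> (u t) = ereal (f t)"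
    and finite_cost_integrable: "integrable (mu \<epsilon>) (\<lambda>t. (g t)\<^sup>2)" "integrable (mu \<epsilon>) f"
  using assms is_speed_measurable by (auto simp: finite_cost_def)

lemma ereal_integral_eq_lebesgue_integral:
  assumes "integrable M l" "AE t in M. L t = ereal (l t)"
  shows "ereal_integral M L = ereal (integral\<^sup>L M l)"
proof -
  have 1: "(\<integral>\<^sup>+ t. e2ennreal (L t) \<partial>M) = (\<integral>\<^sup>+ t. ennreal (l t) \<partial>M)"
    by (rule nn_integral_cong_AE) (use assms(2) in \<open>auto simp: e2ennreal_ereal\<close>)
  have 2: "(\<integral>\<^sup>+ t. e2ennreal (- L t) \<partial>M) = (\<integral>\<^sup>+ t. ennreal (- l t) \<partial>M)"
    by (rule nn_integral_cong_AE) (use assms(2) in \<open>auto simp: e2ennreal_ereal\<close>)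
  have fin: "(\<integral>\<^sup>+ t. ennreal (l t) \<partial>M) \<noteq> \<infinity>" "(\<integral>\<^sup>+ t. ennreal (- l t) \<partial>M) \<noteq> \<infinity>"
    using assms(1) by (auto simp: real_integrable_def)
  have e: "enn2ereal a = ereal (enn2real a)" if "a \<noteq> \<infinity>" for a
    using that by (cases a) (auto simp: enn2ereal_ennreal)
  show ?thesis
    unfolding ereal_integral_def 1 2 real_lebesgue_integral_def[OF assms(1)]
    using e[OF fin(1)] e[OF fin(2)] by simp
qed

lemma finite_cost_admissible:
  assumes fc: "finite_cost \<epsilon> \<phi> u g f" and \<epsilon>: "\<epsilon> > 0"
  shows "u \<in> admissible_curves \<epsilon> (u 0)"
proof -
  have "AE t in mu \<epsilon>. metric_deriv u t = g t"
    unfolding AE_mu[OF \<epsilon>] using metric_deriv_eq_speed[OF finite_cost_speed[OF fc]] .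
  then have "(\<integral>\<^sup>+ t. ennreal ((metric_deriv u t)\<^sup>2) \<partial>mu \<epsilon>) = (\<integral>\<^sup>+ t. ennreal ((g t)\<^sup>2) \<partial>mu \<epsilon>)"
    by (intro nn_integral_cong_AE) auto
  also have "\<dots> < \<infinity>"
    using finite_cost_integrable(1)[OF fc] by (simp add: nn_integral_eq_integral)
  finally show ?thesis
    using is_speed_imp_AC_loc[OF finite_cost_speed[OF fc]] by (simp add: admissible_curves_def)
qed

lemma finite_cost_WED:
  assumes fc: "finite_cost \<epsilon> \<phi> u g f" and \<epsilon>: "\<epsilon> > 0"
  shows "WED \<phi> \<epsilon> u = ereal (wed_cost \<epsilon> g f)"
  unfolding WED_def wed_cost_def
proof (rule ereal_integral_eq_lebesgue_integral)
  show "integrable (mu \<epsilon>) (\<lambda>t. \<epsilon> / 2 * (g t)\<^sup>2 + f t)"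
    by (intro Bochner_Integration.integrable_add integrable_mult_right finite_cost_integrable[OF fc])
  show "AE t in mu \<epsilon>. ereal (\<epsilon> / 2 * (metric_deriv u t)\<^sup>2) + \<phi> (u t) = ereal (\<epsilon> / 2 * (g t)\<^sup>2 + f t)"
    unfolding AE_mu[OF \<epsilon>]
    using metric_deriv_eq_speed[OF finite_cost_speed[OF fc]] finite_cost_AE[OF fc]
    by eventually_elim auto
qed

lemma emeasure_mu_UNIV:
  assumes \<epsilon>: "\<epsilon> > 0"
  shows "emeasure (mu \<epsilon>) UNIV < \<infinity>"
proof -
  have "emeasure (mu \<epsilon>) UNIV = (\<integral>\<^sup>+t. ennreal (indicator {0<..} t * wed_weight \<epsilon> t) \<partial>lborel)"
    unfolding mu_eq by (subst emeasure_density) auto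
  also have "\<dots> \<le> (\<integral>\<^sup>+t. ennreal (wed_weight \<epsilon> t) * indicator {0..} t \<partial>lborel)"
    by (intro nn_integral_mono) (auto simp: indicator_def)
  also have "\<dots> = ennreal (0 - (- exp (- 0 / \<epsilon>)))"
  proof (rule nn_integral_FTC_atLeast)
    show "((\<lambda>t. - exp (- t / \<epsilon>)) \<longlongrightarrow> 0) at_top"
    proof -
      have "filterlim (\<lambda>t. 1 / \<epsilon> * t) at_top at_top"
        using \<epsilon> by (intro filterlim_tendsto_pos_mult_at_top[OF tendsto_const]) (auto intro: filterlim_ident)
      then have "((\<lambda>t. exp (- (1 / \<epsilon> * t))) \<longlongrightarrow> 0) at_top"
        by (intro filterlim_compose[OF exp_at_bot] filterlim_compose[OF filterlim_uminus_at_bot_at_top])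
      from tendsto_minus[OF this] show ?thesis by simp
    qed
  qed (use \<epsilon> in \<open>auto simp: wed_weight_def intro!: derivative_eq_intros\<close>)
  finally show ?thesis by (simp add: le_less_trans)
qed

text \<open>Coercivity with \<open>v = x\<close> bounds the negative part of the running cost by \<open>B\<close> times the squared distance from the
  starting point, up to a constant, and \<open>weighted_poincare\<close> makes this integrable. The difference
  of positive and negative part then shows that the positive part is integrable, too.\<close>

lemma finite_cost_exists:
  fixes \<phi> :: "'a::metric_space \<Rightarrow> ereal"
  assumes \<epsilon>: "\<epsilon> > 0"
    and lsc: "\<And>x l. x \<longlonglongrightarrow> l \<Longrightarrow> \<phi> l \<le> liminf (\<lambda>n. \<phi> (x n))"
    and coer: "coercive \<phi> A B ustar"
    and adm: "u \<in> admissible_curves \<epsilon> x" and fin: "WED \<phi> \<epsilon> u < \<infinity>"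
  obtains g f where "finite_cost \<epsilon> \<phi> u g f"
proof -
  from adm have u: "u \<in> AC_loc 2 {0..}" "u 0 = x" "(\<integral>\<^sup>+ t. ennreal ((metric_deriv u t)\<^sup>2) \<partial>mu \<epsilon>) < \<infinity>"
    by (auto simp: admissible_curves_def)
  obtain g where g: "is_speed u g" using AC_loc_imp_is_speed[OF u(1)] .
  have [measurable]: "g \<in> borel_measurable borel" using is_speed_measurable[OF g] .
  have md: "AE t in mu \<epsilon>. metric_deriv u t = g t"
    unfolding AE_mu[OF \<epsilon>] using metric_deriv_eq_speed[OF g] .
  have g2: "(\<integral>\<^sup>+ t. ennreal ((g t)\<^sup>2) \<partial>mu \<epsilon>) < \<infinity>"
  proof -
    have "(\<integral>\<^sup>+ t. ennreal ((g t)\<^sup>2) \<partial>mu \<epsilon>) = (\<integral>\<^sup>+ t. ennreal ((metric_deriv u t)\<^sup>2) \<partial>mu \<epsilon>)"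
      using md by (intro nn_integral_cong_AE) auto
    with u(3) show ?thesis by simp
  qed
  have g2i: "integrable (mu \<epsilon>) (\<lambda>t. (g t)\<^sup>2)"
    by (rule integrableI_nonneg) (use g2 in auto)
  have uc: "continuous_on UNIV (\<lambda>t. u (max 0 t))" using is_speed_continuous[OF g] .
  define h where "h = (\<lambda>t. \<phi> (u (max 0 t)))"
  have [measurable]: "h \<in> borel_measurable borel"
    unfolding h_def by (rule lsc_curve_measurable[OF lsc uc])
  define L where "L = (\<lambda>t. ereal (\<epsilon> / 2 * (g t)\<^sup>2) + h t)"
  have [measurable]: "L \<in> borel_measurable borel" unfolding L_def by measurable
  have hL: "AE t in mu \<epsilon>. ereal (\<epsilon> / 2 * (metric_deriv u t)\<^sup>2) + \<phi> (u t) = L t"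
    using md unfolding AE_mu[OF \<epsilon>] by eventually_elim (auto simp: L_def h_def)
  have W: "WED \<phi> \<epsilon> u = ereal_integral (mu \<epsilon>) L"
  proof -
    have "(\<integral>\<^sup>+ t. e2ennreal (ereal (\<epsilon> / 2 * (metric_deriv u t)\<^sup>2) + \<phi> (u t)) \<partial>mu \<epsilon>) = (\<integral>\<^sup>+ t. e2ennreal (L t) \<partial>mu \<epsilon>)"
      "(\<integral>\<^sup>+ t. e2ennreal (- (ereal (\<epsilon> / 2 * (metric_deriv u t)\<^sup>2) + \<phi> (u t))) \<partial>mu \<epsilon>) = (\<integral>\<^sup>+ t. e2ennreal (- L t) \<partial>mu \<epsilon>)"
      using hL by (auto intro!: nn_integral_cong_AE)
    then show ?thesis by (simp add: WED_def ereal_integral_def)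
  qed
  define Q where "Q = B * (dist x ustar)\<^sup>2 + A"
  have AB: "A \<ge> 0" "B \<ge> 0" using coer by (auto simp: coercive_def)
  have lower: "ereal (- (B * (dist (u (max 0 t)) (u 0))\<^sup>2 + Q)) \<le> h t" for t
  proof -
    have "ereal (- B * (dist (u (max 0 t)) x)\<^sup>2 - (B * (dist x ustar)\<^sup>2 + A)) \<le> \<phi> (u (max 0 t))"
      using coer by (simp add: coercive_def)
    moreover have "- (B * (dist (u (max 0 t)) (u 0))\<^sup>2 + Q) = - B * (dist (u (max 0 t)) x)\<^sup>2 - (B * (dist x ustar)\<^sup>2 + A)"
      by (simp add: Q_def u(2))
    ultimately show ?thesis unfolding h_def by (simp only:)
  qed
  have negfin: "(\<integral>\<^sup>+ t. e2ennreal (- L t) \<partial>mu \<epsilon>) < \<infinity>"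
  proof -
    have meas[measurable]: "(\<lambda>t. (dist (u (max 0 t)) (u 0))\<^sup>2) \<in> borel_measurable borel"
      by (intro borel_measurable_continuous_onI continuous_intros uc)
    have "(\<integral>\<^sup>+ t. e2ennreal (- L t) \<partial>mu \<epsilon>) \<le>
        (\<integral>\<^sup>+ t. ennreal B * ennreal ((dist (u (max 0 t)) (u 0))\<^sup>2) + ennreal Q \<partial>mu \<epsilon>)"
    proof (rule nn_integral_mono)
      fix t
      have "h t \<le> L t" using \<epsilon> by (cases "h t") (auto simp: L_def)
      then have "- L t \<le> ereal (B * (dist (u (max 0 t)) (u 0))\<^sup>2 + Q)"
        using lower[of t] by (metis ereal_minus_le_minus ereal_uminus_uminus order_trans uminus_ereal.simps(1))
      then have "e2ennreal (- L t) \<le> ennreal (B * (dist (u (max 0 t)) (u 0))\<^sup>2 + Q)"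
        by (metis e2ennreal_ereal e2ennreal_mono)
      also have "\<dots> = ennreal B * ennreal ((dist (u (max 0 t)) (u 0))\<^sup>2) + ennreal Q"
        using AB by (simp add: Q_def ennreal_mult[symmetric] ennreal_plus[symmetric] del: ennreal_plus)
      finally show "e2ennreal (- L t) \<le> ennreal B * ennreal ((dist (u (max 0 t)) (u 0))\<^sup>2) + ennreal Q" .
    qed
    also have "\<dots> = ennreal B * (\<integral>\<^sup>+ t. ennreal ((dist (u (max 0 t)) (u 0))\<^sup>2) \<partial>mu \<epsilon>) + ennreal Q * emeasure (mu \<epsilon>) UNIV"
      by (subst nn_integral_add) (auto simp: nn_integral_cmult mu_eq)
    also have "\<dots> < \<infinity>"
    proof -
      have "(\<integral>\<^sup>+ t. ennreal ((dist (u (max 0 t)) (u 0))\<^sup>2) \<partial>mu \<epsilon>) < \<infinity>"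
        by (rule le_less_trans[OF weighted_poincare[OF g \<epsilon>]]) (use g2 in \<open>simp add: ennreal_mult_less_top\<close>)
      then show ?thesis using emeasure_mu_UNIV[OF \<epsilon>] by (simp add: ennreal_mult_less_top)
    qed
    finally show ?thesis .
  qed
  have posfin: "(\<integral>\<^sup>+ t. e2ennreal (L t) \<partial>mu \<epsilon>) \<noteq> \<infinity>"
  proof
    assume "(\<integral>\<^sup>+ t. e2ennreal (L t) \<partial>mu \<epsilon>) = \<infinity>"
    then have "WED \<phi> \<epsilon> u = \<infinity>" using negfin
      by (cases "\<integral>\<^sup>+ t. e2ennreal (- L t) \<partial>mu \<epsilon>") (auto simp: W ereal_integral_def)
    with fin show False by simp
  qed
  have L_fin: "AE t in mu \<epsilon>. L t \<noteq> \<infinity>"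
  proof -
    have "AE t in mu \<epsilon>. e2ennreal (L t) \<noteq> \<infinity>"
      by (rule nn_integral_PInf_AE) (use posfin in auto)
    then show ?thesis by eventually_elim auto
  qed
  define f where "f = (\<lambda>t. real_of_ereal (h t))"
  have [measurable]: "f \<in> borel_measurable borel" unfolding f_def by measurable
  have hf: "AE t in mu \<epsilon>. h t = ereal (f t)"
    using L_fin
  proof eventually_elim
    fix t assume "L t \<noteq> \<infinity>"
    then show "h t = ereal (f t)" using lower[of t] by (cases "h t") (auto simp: L_def f_def)
  qed
  define l where "l = (\<lambda>t. \<epsilon> / 2 * (g t)\<^sup>2 + f t)"
  have Ll: "AE t in mu \<epsilon>. L t = ereal (l t)" using hf by eventually_elim (simp add: L_def l_def)
  have li: "integrable (mu \<epsilon>) l"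
    unfolding real_integrable_def
  proof (intro conjI)
    show "l \<in> borel_measurable (mu \<epsilon>)" unfolding l_def by measurable
    have "(\<integral>\<^sup>+ t. ennreal (l t) \<partial>mu \<epsilon>) = (\<integral>\<^sup>+ t. e2ennreal (L t) \<partial>mu \<epsilon>)"
      by (rule nn_integral_cong_AE) (use Ll in \<open>auto simp: e2ennreal_ereal\<close>)
    then show "(\<integral>\<^sup>+ t. ennreal (l t) \<partial>mu \<epsilon>) \<noteq> \<infinity>" using posfin by simp
    have "(\<integral>\<^sup>+ t. ennreal (- l t) \<partial>mu \<epsilon>) = (\<integral>\<^sup>+ t. e2ennreal (- L t) \<partial>mu \<epsilon>)"
      by (rule nn_integral_cong_AE) (use Ll in \<open>auto simp: e2ennreal_ereal\<close>)
    then show "(\<integral>\<^sup>+ t. ennreal (- l t) \<partial>mu \<epsilon>) \<noteq> \<infinity>" using negfin by simp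
  qed
  have "integrable (mu \<epsilon>) (\<lambda>t. l t - \<epsilon> / 2 * (g t)\<^sup>2)"
    by (intro Bochner_Integration.integrable_diff li integrable_mult_right g2i)
  then have "integrable (mu \<epsilon>) f" by (simp add: l_def)
  moreover have "AE t in lborel. t > 0 \<longrightarrow> \<phi> (u t) = ereal (f t)"
    using hf unfolding AE_mu[OF \<epsilon>] by eventually_elim (auto simp: h_def)
  ultimately show thesis using that[of g f] g g2i by (simp add: finite_cost_def)
qed

lemma integrable_mu_shift:
  fixes F :: "real \<Rightarrow> real"
  assumes \<epsilon>: "\<epsilon> > 0" and t: "t \<ge> 0" and [measurable]: "F \<in> borel_measurable borel"
    and F: "integrable (mu \<epsilon>) F"
  shows "integrable (mu \<epsilon>) (\<lambda>h. F (t + h))"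
proof -
  let ?W = "\<lambda>r. indicator {0..} r *\<^sub>R (F r * wed_weight \<epsilon> r)"
  have "integrable lborel ?W" using F by (subst (asm) integrable_mu_iff(1)[OF \<epsilon>]) (auto simp: set_integrable_def)
  then have "integrable lborel (\<lambda>h. exp (t / \<epsilon>) * ?W (t + 1 * h))"
    by (intro integrable_mult_right lborel_integrable_real_affine) auto
  then have "integrable lborel (\<lambda>h. indicator {0..} h *\<^sub>R (F (t + h) * wed_weight \<epsilon> h))"
  proof (rule Bochner_Integration.integrable_bound)
    have "exp (t / \<epsilon>) * wed_weight \<epsilon> (t + h) = wed_weight \<epsilon> h" for h
      unfolding wed_weight_add by (simp add: mult.assoc[symmetric] exp_add[symmetric])
    then have E: "exp (t / \<epsilon>) * (F (t + h) * wed_weight \<epsilon> (t + h)) = F (t + h) * wed_weight \<epsilon> h" for h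
      by (simp add: mult.left_commute)
    show "AE h in lborel. norm (indicator {0..} h *\<^sub>R (F (t + h) * wed_weight \<epsilon> h)) \<le> norm (exp (t / \<epsilon>) * ?W (t + 1 * h))"
    proof (rule AE_I2)
      fix h
      show "norm (indicator {0..} h *\<^sub>R (F (t + h) * wed_weight \<epsilon> h)) \<le> norm (exp (t / \<epsilon>) * ?W (t + 1 * h))"
      proof (cases "0 \<le> h")
        case True
        have "?W (t + 1 * h) = F (t + h) * wed_weight \<epsilon> (t + h)" using t True by simp
        moreover have "indicator {0..} h *\<^sub>R (F (t + h) * wed_weight \<epsilon> h) = F (t + h) * wed_weight \<epsilon> h"
          using True by simp
        ultimately show ?thesis by (simp only: E order_refl)
      qed simp
    qed
  qed measurable
  then show ?thesis by (subst integrable_mu_iff(1)[OF \<epsilon>]) (auto simp: set_integrable_def)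
qed

lemma finite_cost_shift:
  assumes \<epsilon>: "\<epsilon> > 0" and fc: "finite_cost \<epsilon> \<phi> u g f" and t: "t \<ge> 0"
  shows "finite_cost \<epsilon> \<phi> (\<lambda>h. u (t + h)) (\<lambda>h. g (t + h)) (\<lambda>h. f (t + h))"
  unfolding finite_cost_def
proof (intro conjI)
  note [measurable] = finite_cost_measurable[OF fc]
  show "is_speed (\<lambda>h. u (t + h)) (\<lambda>h. g (t + h))"
    using is_speed_affine[OF finite_cost_speed[OF fc] t, of 1] by simp
  show "(\<lambda>h. f (t + h)) \<in> borel_measurable borel" by measurable
  show "AE h in lborel. h > 0 \<longrightarrow> \<phi> (u (t + h)) = ereal (f (t + h))"
  proof -
    have "AE h in lborel. t + 1 * h > 0 \<longrightarrow> \<phi> (u (t + 1 * h)) = ereal (f (t + 1 * h))"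
      by (rule AE_lborel_affine[OF _ finite_cost_AE[OF fc]]) simp
    then show ?thesis by eventually_elim (use t in auto)
  qed
  show "integrable (mu \<epsilon>) (\<lambda>h. (g (t + h))\<^sup>2)"
    using integrable_mu_shift[OF \<epsilon> t _ finite_cost_integrable(1)[OF fc]] by simp
  show "integrable (mu \<epsilon>) (\<lambda>h. f (t + h))"
    using integrable_mu_shift[OF \<epsilon> t _ finite_cost_integrable(2)[OF fc]] by simp
qed

lemma finite_cost_concat:
  fixes \<phi> :: "'a::metric_space \<Rightarrow> ereal"
  assumes \<epsilon>: "\<epsilon> > 0" and \<delta>: "\<delta> \<ge> 0"
    and p: "is_speed p gp" and fp[measurable]: "fp \<in> borel_measurable borel"
    and pf: "AE t in lborel. t > 0 \<longrightarrow> \<phi> (p t) = ereal (fp t)"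
    and fpi: "set_integrable lborel {0..\<delta>} fp"
    and v: "finite_cost \<epsilon> \<phi> v gv fv" and join: "v 0 = p \<delta>"
  shows "finite_cost \<epsilon> \<phi> (\<lambda>h. if h \<le> \<delta> then p h else v (h - \<delta>))
      (\<lambda>h. if h \<le> \<delta> then gp h else gv (h - \<delta>)) (\<lambda>h. if h \<le> \<delta> then fp h else fv (h - \<delta>))" (is "finite_cost \<epsilon> \<phi> ?w ?g ?f")
    and "wed_cost \<epsilon> (\<lambda>h. if h \<le> \<delta> then gp h else gv (h - \<delta>)) (\<lambda>h. if h \<le> \<delta> then fp h else fv (h - \<delta>)) =
      (LINT h:{0..\<delta>}|lborel. (\<epsilon> / 2 * (gp h)\<^sup>2 + fp h) * wed_weight \<epsilon> h) + exp (- \<delta> / \<epsilon>) * wed_cost \<epsilon> gv fv"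
proof -
  have [measurable]: "gp \<in> borel_measurable borel" using is_speed_measurable[OF p] .
  note [measurable] = finite_cost_measurable[OF v]
  have sq: "(?g h)\<^sup>2 = (if h \<le> \<delta> then (gp h)\<^sup>2 else (gv (h - \<delta>))\<^sup>2)" for h by simp
  show "finite_cost \<epsilon> \<phi> ?w ?g ?f"
    unfolding finite_cost_def
  proof (intro conjI)
    show "is_speed ?w ?g" by (rule is_speed_concat[OF p finite_cost_speed[OF v] join \<delta>])
    show "?f \<in> borel_measurable borel" by measurable
    show "AE h in lborel. h > 0 \<longrightarrow> \<phi> (?w h) = ereal (?f h)"
      using pf AE_lborel_affine[OF _ finite_cost_AE[OF v], of 1 "-\<delta>", simplified]
      by eventually_elim auto
    show "integrable (mu \<epsilon>) (\<lambda>h. (?g h)\<^sup>2)"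
      unfolding sq using is_speed_square_integrable[OF p] finite_cost_integrable[OF v]
      by (intro mu_concat(1)[OF \<epsilon> \<delta>]) auto
    show "integrable (mu \<epsilon>) ?f"
      using fpi finite_cost_integrable[OF v] by (intro mu_concat(1)[OF \<epsilon> \<delta>]) auto
  qed
  have "\<epsilon> / 2 * (?g h)\<^sup>2 + ?f h =
      (if h \<le> \<delta> then \<epsilon> / 2 * (gp h)\<^sup>2 + fp h else \<epsilon> / 2 * (gv (h - \<delta>))\<^sup>2 + fv (h - \<delta>))" for h by simp
  then have "wed_cost \<epsilon> ?g ?f =
      (LINT h|mu \<epsilon>. (if h \<le> \<delta> then \<epsilon> / 2 * (gp h)\<^sup>2 + fp h else \<epsilon> / 2 * (gv (h - \<delta>))\<^sup>2 + fv (h - \<delta>)))"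
    unfolding wed_cost_def by presburger
  also have "\<dots> = (LINT h:{0..\<delta>}|lborel. (\<epsilon> / 2 * (gp h)\<^sup>2 + fp h) * wed_weight \<epsilon> h) +
      exp (- \<delta> / \<epsilon>) * (LINT h|mu \<epsilon>. \<epsilon> / 2 * (gv h)\<^sup>2 + fv h)"
  proof (rule mu_concat(2)[OF \<epsilon> \<delta>])
    show "set_integrable lborel {0..\<delta>} (\<lambda>h. \<epsilon> / 2 * (gp h)\<^sup>2 + fp h)"
      using is_speed_square_integrable[OF p] by (intro set_integral_add fpi set_integrable_mult_right) auto
    show "integrable (mu \<epsilon>) (\<lambda>h. \<epsilon> / 2 * (gv h)\<^sup>2 + fv h)"
      by (intro Bochner_Integration.integrable_add integrable_mult_right finite_cost_integrable[OF v])
  qed auto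
  finally show "wed_cost \<epsilon> ?g ?f = (LINT h:{0..\<delta>}|lborel. (\<epsilon> / 2 * (gp h)\<^sup>2 + fp h) * wed_weight \<epsilon> h) +
      exp (- \<delta> / \<epsilon>) * wed_cost \<epsilon> gv fv" unfolding wed_cost_def .
qed

lemma finite_cost_locally_integrable:
  assumes \<epsilon>: "\<epsilon> > 0" and fc: "finite_cost \<epsilon> \<phi> u g f"
  shows "set_integrable lborel {0..T} f"
proof -
  note [measurable] = finite_cost_measurable[OF fc]
  have "set_integrable lborel {0..} (\<lambda>t. f t * wed_weight \<epsilon> t)"
    using finite_cost_integrable(2)[OF fc] by (simp add: integrable_mu_iff(1)[OF \<epsilon>])
  then have "set_integrable lborel {0..T} (\<lambda>t. f t * wed_weight \<epsilon> t)"
    by (rule set_integrable_subset) auto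
  then show ?thesis by (simp add: set_integrable_weight_iff[OF \<epsilon>])
qed

text \<open>The competitor from which all inequalities are derived: follow \<open>u\<close> from \<open>u s\<close> with speed factor \<open>c\<close> until time \<open>\<delta>\<close>, then
  continue with any curve of finite cost. The proof that tails are optimal uses it with \<open>s = 0\<close>, \<open>c = 1\<close>, and the
  first variation with the tail of \<open>u\<close> as continuation.\<close>

lemma value_fun_le_reparametrized:
  assumes \<epsilon>: "\<epsilon> > 0" and fc: "finite_cost \<epsilon> \<phi> u g f"
    and s: "s \<ge> 0" and c: "c > 0" and \<delta>: "\<delta> \<ge> 0"
    and v: "finite_cost \<epsilon> \<phi> v gv fv" and join: "v 0 = u (s + c * \<delta>)"
  shows "value_fun \<phi> \<epsilon> (u s) \<le> ereal
     ((LINT h:{0..\<delta>}|lborel. (\<epsilon> / 2 * (c * g (s + c * h))\<^sup>2 + f (s + c * h)) * wed_weight \<epsilon> h)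
       + exp (- \<delta> / \<epsilon>) * wed_cost \<epsilon> gv fv)"
proof -
  note [measurable] = finite_cost_measurable[OF fc]
  have sp: "is_speed (\<lambda>h. u (s + c * h)) (\<lambda>h. c * g (s + c * h))"
    by (rule is_speed_affine[OF finite_cost_speed[OF fc] s c])
  have 1: "AE h in lborel. h > 0 \<longrightarrow> \<phi> (u (s + c * h)) = ereal (f (s + c * h))"
  proof -
    have "AE h in lborel. s + c * h > 0 \<longrightarrow> \<phi> (u (s + c * h)) = ereal (f (s + c * h))"
      using c by (intro AE_lborel_affine[OF _ finite_cost_AE[OF fc]]) auto
    then show ?thesis by eventually_elim (use s c in \<open>auto simp: add_nonneg_pos\<close>)
  qed
  have 2: "set_integrable lborel {0..\<delta>} (\<lambda>h. f (s + c * h))"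
    by (rule set_integrable_affine[OF set_integrable_subset[OF finite_cost_locally_integrable[OF \<epsilon> fc, of "s + c * \<delta>"]] c])
      (use s c in auto)
  note cc = finite_cost_concat[OF \<epsilon> \<delta> sp _ 1 2 v join]
  let ?w = "\<lambda>h. if h \<le> \<delta> then u (s + c * h) else v (h - \<delta>)"
  have m: "(\<lambda>h. f (s + c * h)) \<in> borel_measurable borel" by measurable
  have "?w \<in> admissible_curves \<epsilon> (u s)"
    using finite_cost_admissible[OF cc(1)[OF m] \<epsilon>] \<delta> by simp
  then have "value_fun \<phi> \<epsilon> (u s) \<le> WED \<phi> \<epsilon> ?w"
    unfolding value_fun_def by (rule INF_lower)
  then show ?thesis
    by (simp add: finite_cost_WED[OF cc(1)[OF m] \<epsilon>] cc(2)[OF m])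
qed

lemma wed_cost_split:
  assumes \<epsilon>: "\<epsilon> > 0" and fc: "finite_cost \<epsilon> \<phi> u g f" and t: "t \<ge> 0"
  shows "wed_cost \<epsilon> g f = (LINT h:{0..t}|lborel. (\<epsilon> / 2 * (g h)\<^sup>2 + f h) * wed_weight \<epsilon> h)
       + exp (- t / \<epsilon>) * wed_cost \<epsilon> (\<lambda>h. g (t + h)) (\<lambda>h. f (t + h))"
proof -
  have "(\<lambda>h. if h \<le> t then g h else g (t + (h - t))) = g" "(\<lambda>h. if h \<le> t then f h else f (t + (h - t))) = f"
    by auto
  then show ?thesis
    using finite_cost_concat(2)[OF \<epsilon> t finite_cost_speed[OF fc] finite_cost_measurable(1)[OF fc] finite_cost_AE[OF fc]
      finite_cost_locally_integrable[OF \<epsilon> fc] finite_cost_shift[OF \<epsilon> fc t]] by simp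
qed

section \<open>The value function along a minimizer\<close>

text \<open>Suppose \<open>v\<close> starts at \<open>u t\<close>. Gluing \<open>v\<close> to \<open>u\<close> restricted to \<open>{0..t}\<close> gives a competitor of \<open>u\<close>. Both have the same cost up to
  time \<open>t\<close>, so the remaining cost of \<open>u\<close> is at most that of \<open>v\<close>.\<close>

lemma value_along_minimizer:
  fixes \<phi> :: "'a::metric_space \<Rightarrow> ereal"
  assumes \<epsilon>: "\<epsilon> > 0"
    and lsc: "\<And>x l. x \<longlonglongrightarrow> l \<Longrightarrow> \<phi> l \<le> liminf (\<lambda>n. \<phi> (x n))"
    and coer: "coercive \<phi> A B ustar"
    and min: "u \<in> WED_minimizers \<phi> \<epsilon> x" and fc: "finite_cost \<epsilon> \<phi> u g f" and t: "t \<ge> 0"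
  shows "value_fun \<phi> \<epsilon> (u t) = ereal (wed_cost \<epsilon> (\<lambda>h. g (t + h)) (\<lambda>h. f (t + h)))"
proof (rule antisym)
  note sh = finite_cost_shift[OF \<epsilon> fc t]
  have "(\<lambda>h. u (t + h)) \<in> admissible_curves \<epsilon> (u t)" using finite_cost_admissible[OF sh \<epsilon>] by simp
  then show "value_fun \<phi> \<epsilon> (u t) \<le> ereal (wed_cost \<epsilon> (\<lambda>h. g (t + h)) (\<lambda>h. f (t + h)))"
    unfolding value_fun_def finite_cost_WED[OF sh \<epsilon>, symmetric] by (rule INF_lower)
  show "ereal (wed_cost \<epsilon> (\<lambda>h. g (t + h)) (\<lambda>h. f (t + h))) \<le> value_fun \<phi> \<epsilon> (u t)"
    unfolding value_fun_def
  proof (rule INF_greatest)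
    fix v assume v: "v \<in> admissible_curves \<epsilon> (u t)"
    show "ereal (wed_cost \<epsilon> (\<lambda>h. g (t + h)) (\<lambda>h. f (t + h))) \<le> WED \<phi> \<epsilon> v"
    proof (cases "WED \<phi> \<epsilon> v < \<infinity>")
      case True
      obtain gv fv where vc: "finite_cost \<epsilon> \<phi> v gv fv"
        using finite_cost_exists[OF \<epsilon> lsc coer v True] by blast
      have v0: "v 0 = u (0 + 1 * t)" using v by (simp add: admissible_curves_def)
      have "ereal (wed_cost \<epsilon> g f) = value_fun \<phi> \<epsilon> (u 0)"
      proof -
        have "u 0 = x" using min by (simp add: WED_minimizers_def admissible_curves_def)
        then show ?thesis
          using min unfolding finite_cost_WED[OF fc \<epsilon>, symmetric] value_fun_def WED_minimizers_def
          by (intro antisym INF_greatest INF_lower) auto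
      qed
      also have "\<dots> \<le> ereal ((LINT h:{0..t}|lborel. (\<epsilon> / 2 * (g h)\<^sup>2 + f h) * wed_weight \<epsilon> h)
         + exp (- t / \<epsilon>) * wed_cost \<epsilon> gv fv)"
        using value_fun_le_reparametrized[OF \<epsilon> fc order_refl zero_less_one t vc v0] by simp
      finally have "exp (- t / \<epsilon>) * wed_cost \<epsilon> (\<lambda>h. g (t + h)) (\<lambda>h. f (t + h)) \<le> exp (- t / \<epsilon>) * wed_cost \<epsilon> gv fv"
        using wed_cost_split[OF \<epsilon> fc t] by simp
      then show ?thesis by (simp add: finite_cost_WED[OF vc \<epsilon>])
    qed auto
  qed
qed

section \<open>Regularity of the accumulated cost\<close>

lemma local_lebesgue_differentiation:
  fixes b :: "real \<Rightarrow> real"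
  assumes b: "\<And>T. set_integrable lborel {0..T} b"
  shows "AE t in lborel. t > 0 \<longrightarrow> ((\<lambda>s. LINT r:{0..s}|lborel. b r) has_real_derivative b t) (at t)"
proof -
  have "AE t in lborel. \<forall>n::nat. ((\<lambda>s. LINT r:{..s}|lborel. indicator {0..real n} r *\<^sub>R b r) has_real_derivative indicator {0..real n} t *\<^sub>R b t) (at t)"
    unfolding AE_all_countable using b by (intro allI lebesgue_differentiation) (simp add: set_integrable_def)
  then show ?thesis
  proof (eventually_elim, intro impI)
    fix t :: real
    assume *: "\<forall>n::nat. ((\<lambda>s. LINT r:{..s}|lborel. indicator {0..real n} r *\<^sub>R b r) has_real_derivative indicator {0..real n} t *\<^sub>R b t) (at t)"
      and t: "t > 0"
    obtain n :: nat where n: "t < real n" using reals_Archimedean2 by blast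
    have eq: "(LINT r:{..s}|lborel. indicator {0..real n} r *\<^sub>R b r) = (LINT r:{0..s}|lborel. b r)" if "s \<in> {0<..<real n}" for s
      unfolding set_lebesgue_integral_def using that by (intro Bochner_Integration.integral_cong) (auto simp: indicator_def)
    have "((\<lambda>s. LINT r:{..s}|lborel. indicator {0..real n} r *\<^sub>R b r) has_real_derivative b t) (at t)"
      using *[rule_format, of n] t n by simp
    then show "((\<lambda>s. LINT r:{0..s}|lborel. b r) has_real_derivative b t) (at t)"
      by (rule has_field_derivative_transform_within_open[of _ _ _ "{0<..<real n}"]) (use t n eq in auto)
  qed
qed

lemma right_minimum_derivative_nonneg:
  fixes f :: "real \<Rightarrow> real"
  assumes "(f has_real_derivative D) (at x)" "\<And>y. x \<le> y \<Longrightarrow> f x \<le> f y"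
  shows "0 \<le> D"
proof (rule ccontr)
  assume "\<not> 0 \<le> D"
  then obtain d where d: "d > 0" "\<And>h. 0 < h \<Longrightarrow> h < d \<Longrightarrow> f (x + h) < f x"
    using DERIV_neg_dec_right[OF assms(1)] by auto
  from d(2)[of "d/2"] assms(2)[of "x + d/2"] d(1) show False by auto
qed

text \<open>The argument \<open>r / c\<close> appears when the substitution \<open>r = s + c * h\<close> turns the cost of the reparametrized curve into
  an integral along \<open>u\<close>. Up to the factor \<open>c\<close> it amounts to replacing \<open>\<epsilon>\<close> by \<open>c * \<epsilon>\<close> in the weight.\<close>

lemma reparametrized_cost_integrable:
  assumes \<epsilon>: "\<epsilon> > 0" and fc: "finite_cost \<epsilon> \<phi> u g f" and c: "c > 0"
  shows "set_integrable lborel {0..T} (\<lambda>r. (\<epsilon> / 2 * (c * g r)\<^sup>2 + f r) * wed_weight \<epsilon> (r / c))"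
proof -
  note [measurable] = finite_cost_measurable[OF fc]
  have "set_integrable lborel {0..T} (\<lambda>r. \<epsilon> / 2 * c\<^sup>2 * (g r)\<^sup>2 + f r)"
    by (intro set_integral_add set_integrable_mult_right finite_cost_locally_integrable[OF \<epsilon> fc]
        is_speed_square_integrable[OF finite_cost_speed[OF fc]])
  then have "set_integrable lborel {0..T} (\<lambda>r. (\<epsilon> / 2 * c\<^sup>2 * (g r)\<^sup>2 + f r) * wed_weight (c * \<epsilon>) r)"
    using \<epsilon> c by (subst set_integrable_weight_iff) auto
  then have "set_integrable lborel {0..T} (\<lambda>r. c * ((\<epsilon> / 2 * c\<^sup>2 * (g r)\<^sup>2 + f r) * wed_weight (c * \<epsilon>) r))"
    by (rule set_integrable_mult_right[rotated])
  moreover have "wed_weight \<epsilon> (r / c) = c * wed_weight (c * \<epsilon>) r" for r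
    using c by (simp add: wed_weight_def)
  ultimately show ?thesis by (simp add: power_mult_distrib mult_ac)
qed

text \<open>The product rule for increments: the increment of the integral is bounded by the integral of \<open>\<bar>l\<bar>\<close>, the exponential is
  Lipschitz on compact intervals, and the constant \<open>C\<close> of the proof bounds the second factor on \<open>{0..b}\<close>.\<close>

lemma exp_times_indefinite_integral_AC_loc:
  fixes l :: "real \<Rightarrow> real" and I \<epsilon> :: real
  assumes \<epsilon>: "\<epsilon> > 0" and [measurable]: "l \<in> borel_measurable borel"
    and l: "\<And>T. set_integrable lborel {0..T} l"
  shows "(\<lambda>t. exp (t / \<epsilon>) * (I - (LINT r:{0..t}|lborel. l r))) \<in> AC_loc 1 {0..}"
  unfolding AC_loc_def AC_def
proof (intro CollectI allI impI exI conjI ballI)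
  fix a b :: real assume ab: "{a..b} \<subseteq> {0..}"
  define P where "P = (\<lambda>t. LINT r:{0..t}|lborel. l r)"
  define C where "C = \<bar>I\<bar> + (LINT r:{0..b}|lborel. \<bar>l r\<bar>)"
  define m where "m = (\<lambda>r. exp (b / \<epsilon>) * \<bar>l r\<bar> + exp (b / \<epsilon>) / \<epsilon> * C)"
  have la: "set_integrable lborel {0..T} (\<lambda>r. \<bar>l r\<bar>)" for T by (rule set_integrable_abs[OF l])
  have int0: "0 \<le> (LINT r:S|lborel. \<bar>l r\<bar>)" for S :: "real set"
    unfolding set_lebesgue_integral_def by (intro integral_nonneg_AE) auto
  have C0: "0 \<le> C" using int0 by (simp add: C_def)
  have lab: "set_integrable lborel {s..t} (\<lambda>r. \<bar>l r\<bar>)" "set_integrable lborel {s..t} l" if "0 \<le> s" for s t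
    using that by (auto intro!: set_integrable_subset[OF la[of t]] set_integrable_subset[OF l[of t]])
  have const: "set_integrable lborel {s..t} (\<lambda>r. k)" for s t k :: real
    by (cases "s \<le> t") (auto simp: set_integrable_def intro!: integrable_mult_left integrable_real_indicator)
  have mi: "set_integrable lborel {s..t} m" if "0 \<le> s" for s t
    unfolding m_def using lab(1)[OF that] by (intro set_integral_add set_integrable_mult_right const) auto
  have [measurable]: "m \<in> borel_measurable borel" unfolding m_def by measurable
  have m0: "0 \<le> m r" for r unfolding m_def using C0 \<epsilon> by simp
  show "in_Lp 1 {a..b} m"
  proof (cases "a \<le> b")
    case True
    then show ?thesis using mi[of a b] m0 ab by (simp add: in_Lp_def set_borel_measurable_def)
  qed (simp add: in_Lp_def set_borel_measurable_def)
  fix s t assume st: "s \<in> {a..b}" "t \<in> {a..b}" "s \<le> t"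
  have s0: "0 \<le> s" "0 \<le> t" "t \<le> b" using st ab by auto
  have nt: "\<bar>LINT r:S|lborel. l r\<bar> \<le> (LINT r:S|lborel. \<bar>l r\<bar>)" for S :: "real set"
    unfolding set_lebesgue_integral_def
    by (rule order_trans[OF integral_abs_bound]) (simp add: abs_mult)
  have diff: "P t - P s = (LINT r:{s..t}|lborel. l r)"
    using set_integral_split[OF l, of s t] s0 st by (simp add: P_def)
  have 1: "\<bar>I - P s\<bar> \<le> C"
  proof -
    have "\<bar>P s\<bar> \<le> (LINT r:{0..s}|lborel. \<bar>l r\<bar>)" unfolding P_def by (rule nt)
    also have "\<dots> \<le> (LINT r:{0..b}|lborel. \<bar>l r\<bar>)"
      using set_integral_split[OF la, of s b] s0 st int0[of "{s..b}"] by simp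
    finally show ?thesis unfolding C_def by linarith
  qed
  have 2: "0 \<le> exp (t / \<epsilon>) - exp (s / \<epsilon>)" "exp (t / \<epsilon>) - exp (s / \<epsilon>) \<le> exp (b / \<epsilon>) / \<epsilon> * (t - s)"
  proof -
    show "0 \<le> exp (t / \<epsilon>) - exp (s / \<epsilon>)" using st \<epsilon> by (simp add: divide_right_mono)
    have "exp (s / \<epsilon>) = exp (t / \<epsilon>) * exp ((s - t) / \<epsilon>)"
      by (simp add: exp_add[symmetric] diff_divide_distrib)
    moreover have "exp (t / \<epsilon>) * (1 + (s - t) / \<epsilon>) \<le> exp (t / \<epsilon>) * exp ((s - t) / \<epsilon>)"
      by (intro mult_left_mono exp_ge_add_one_self) auto
    ultimately have "exp (t / \<epsilon>) - exp (s / \<epsilon>) \<le> exp (t / \<epsilon>) * ((t - s) / \<epsilon>)"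
      by (simp add: algebra_simps diff_divide_distrib)
    also have "\<dots> \<le> exp (b / \<epsilon>) * ((t - s) / \<epsilon>)"
      using st \<epsilon> s0 by (intro mult_right_mono) (auto simp: divide_right_mono)
    finally show "exp (t / \<epsilon>) - exp (s / \<epsilon>) \<le> exp (b / \<epsilon>) / \<epsilon> * (t - s)" by simp
  qed
  have "exp (s / \<epsilon>) * (I - P s) - exp (t / \<epsilon>) * (I - P t) =
      exp (t / \<epsilon>) * (P t - P s) - (exp (t / \<epsilon>) - exp (s / \<epsilon>)) * (I - P s)"
    by (simp add: algebra_simps)
  then have "dist (exp (s / \<epsilon>) * (I - P s)) (exp (t / \<epsilon>) * (I - P t)) \<le>
      exp (t / \<epsilon>) * \<bar>P t - P s\<bar> + (exp (t / \<epsilon>) - exp (s / \<epsilon>)) * \<bar>I - P s\<bar>"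
    unfolding dist_real_def using abs_triangle_ineq4[of "exp (t / \<epsilon>) * (P t - P s)" "(exp (t / \<epsilon>) - exp (s / \<epsilon>)) * (I - P s)"] 2(1)
    by (simp add: abs_mult)
  also have "\<dots> \<le> exp (b / \<epsilon>) * (LINT r:{s..t}|lborel. \<bar>l r\<bar>) + exp (b / \<epsilon>) / \<epsilon> * (t - s) * C"
  proof (rule add_mono)
    show "exp (t / \<epsilon>) * \<bar>P t - P s\<bar> \<le> exp (b / \<epsilon>) * (LINT r:{s..t}|lborel. \<bar>l r\<bar>)"
      unfolding diff using s0 \<epsilon> nt[of "{s..t}"] by (intro mult_mono) (auto simp: divide_right_mono)
    show "(exp (t / \<epsilon>) - exp (s / \<epsilon>)) * \<bar>I - P s\<bar> \<le> exp (b / \<epsilon>) / \<epsilon> * (t - s) * C"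
      using 1 2 st \<epsilon> by (intro mult_mono) auto
  qed
  also have "\<dots> = (LINT r:{s..t}|lborel. m r)"
  proof -
    have "(LINT r:{s..t}|lborel. m r) = (LINT r:{s..t}|lborel. exp (b / \<epsilon>) * \<bar>l r\<bar>) + (LINT r:{s..t}|lborel. exp (b / \<epsilon>) / \<epsilon> * C)"
      unfolding m_def using lab(1)[OF s0(1)] by (intro set_integral_add set_integrable_mult_right const) auto
    also have "(LINT r:{s..t}|lborel. exp (b / \<epsilon>) / \<epsilon> * C) = (t - s) * (exp (b / \<epsilon>) / \<epsilon> * C)"
      using st by (simp add: set_lebesgue_integral_def)
    finally show ?thesis by simp
  qed
  finally show "dist (exp (s / \<epsilon>) * (I - (LINT r:{0..s}|lborel. l r))) (exp (t / \<epsilon>) * (I - (LINT r:{0..t}|lborel. l r)))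
      \<le> (LINT r:{s..t}|lborel. m r)" by (simp add: P_def)
qed

section \<open>First variation under changes of speed\<close>

text \<open>After the substitution \<open>r = s + c * h\<close> the integrand is a function of \<open>r\<close> alone, except for the factor
  \<open>exp (s / (c * \<epsilon>))\<close>. Hence the right side can be differentiated in \<open>\<delta>\<close> for almost every \<open>s\<close>, with one exceptional null
  set for each \<open>c\<close>.\<close>

lemma reparametrization_inequality:
  fixes \<phi> :: "'a::metric_space \<Rightarrow> ereal"
  assumes \<epsilon>: "\<epsilon> > 0" and fc: "finite_cost \<epsilon> \<phi> u g f" and s: "s \<ge> 0" and c: "c > 0" and \<delta>: "\<delta> \<ge> 0"
    and val: "\<And>t. t \<ge> 0 \<Longrightarrow> value_fun \<phi> \<epsilon> (u t) = ereal (F t)"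
    and F: "\<And>t. t \<ge> 0 \<Longrightarrow> F t = wed_cost \<epsilon> (\<lambda>h. g (t + h)) (\<lambda>h. f (t + h))"
  defines "b \<equiv> (\<lambda>r. (\<epsilon> / 2 * (c * g r)\<^sup>2 + f r) * wed_weight \<epsilon> (r / c))"
  shows "F s \<le> exp (s / (c * \<epsilon>)) / c * ((LINT r:{0..s + c * \<delta>}|lborel. b r) - (LINT r:{0..s}|lborel. b r))
    + exp (- \<delta> / \<epsilon>) * F (s + c * \<delta>)"
proof -
  let ?b' = "\<lambda>r. (\<epsilon> / 2 * (c * g r)\<^sup>2 + f r) * wed_weight \<epsilon> ((r - s) / c)"
  have sd: "0 \<le> s + c * \<delta>" using s c \<delta> by simp
  have "ereal (F s) \<le> ereal ((LINT h:{0..\<delta>}|lborel. (\<epsilon> / 2 * (c * g (s + c * h))\<^sup>2 + f (s + c * h)) * wed_weight \<epsilon> h)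
       + exp (- \<delta> / \<epsilon>) * F (s + c * \<delta>))"
    unfolding F[OF sd] val[OF s, symmetric]
    by (rule value_fun_le_reparametrized[OF \<epsilon> fc s c \<delta> finite_cost_shift[OF \<epsilon> fc sd]]) simp
  then have le: "F s \<le> (LINT h:{0..\<delta>}|lborel. (\<epsilon> / 2 * (c * g (s + c * h))\<^sup>2 + f (s + c * h)) * wed_weight \<epsilon> h)
       + exp (- \<delta> / \<epsilon>) * F (s + c * \<delta>)" by simp
  have "c * (LINT h:{0..\<delta>}|lborel. (\<epsilon> / 2 * (c * g (s + c * h))\<^sup>2 + f (s + c * h)) * wed_weight \<epsilon> h) =
      (LINT r:{s + c * 0..s + c * \<delta>}|lborel. ?b' r)"
    using c by (subst set_integral_affine[OF c]) simp
  also have "\<dots> = (LINT r:{s..s + c * \<delta>}|lborel. exp (s / (c * \<epsilon>)) * b r)"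
  proof -
    have "wed_weight \<epsilon> ((r - s) / c) = exp (s / (c * \<epsilon>)) * wed_weight \<epsilon> (r / c)" for r
      using wed_weight_add[of \<epsilon> "- s / c" "r / c"] by (simp add: diff_divide_distrib mult.commute)
    then show ?thesis by (simp add: b_def mult.left_commute)
  qed
  also have "\<dots> = exp (s / (c * \<epsilon>)) * (LINT r:{s..s + c * \<delta>}|lborel. b r)" by simp
  also have "(LINT r:{s..s + c * \<delta>}|lborel. b r) = (LINT r:{0..s + c * \<delta>}|lborel. b r) - (LINT r:{0..s}|lborel. b r)"
  proof -
    have "set_integrable lborel {0..s + c * \<delta>} b"
      unfolding b_def by (rule reparametrized_cost_integrable[OF \<epsilon> fc c])
    from set_integral_split[OF this, of s] show ?thesis using s c \<delta> by simp
  qed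
  finally have "(LINT h:{0..\<delta>}|lborel. (\<epsilon> / 2 * (c * g (s + c * h))\<^sup>2 + f (s + c * h)) * wed_weight \<epsilon> h) =
      exp (s / (c * \<epsilon>)) / c * ((LINT r:{0..s + c * \<delta>}|lborel. b r) - (LINT r:{0..s}|lborel. b r))"
    using c by (simp add: field_simps)
  with le show ?thesis by simp
qed

text \<open>The two sides of the inequality assumed for \<open>\<delta> \<ge> 0\<close> agree at \<open>\<delta> = 0\<close>, so the right derivative in \<open>\<delta>\<close> of the right
  side is nonnegative there. The conclusion is this derivative.\<close>

lemma first_variation_inequality:
  fixes F B :: "real \<Rightarrow> real"
  assumes \<epsilon>: "\<epsilon> > 0" and c: "c > 0"
    and dF: "(F has_real_derivative F') (at s)"
    and dB: "(B has_real_derivative (\<epsilon> / 2 * (c * a)\<^sup>2 + b) * wed_weight \<epsilon> (s / c)) (at s)"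
    and le: "\<And>\<delta>. \<delta> \<ge> 0 \<Longrightarrow> F s \<le> exp (s / (c * \<epsilon>)) / c * (B (s + c * \<delta>) - B s) + exp (- \<delta> / \<epsilon>) * F (s + c * \<delta>)"
  shows "0 \<le> c\<^sup>2 / 2 * a\<^sup>2 + b / \<epsilon> - F s / \<epsilon> + c * F'"
proof -
  define \<Psi> where "\<Psi> = (\<lambda>\<delta>. exp (s / (c * \<epsilon>)) / c * (B (s + c * \<delta>) - B s) + exp (- \<delta> / \<epsilon>) * F (s + c * \<delta>))"
  have aff: "((\<lambda>\<delta>. s + c * \<delta>) has_real_derivative c) (at 0)"
    by (auto intro!: derivative_eq_intros)
  have B0: "((\<lambda>\<delta>. B (s + c * \<delta>)) has_real_derivative ((\<epsilon> / 2 * (c * a)\<^sup>2 + b) * wed_weight \<epsilon> (s / c)) * c) (at 0)"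
    using DERIV_chain2[of B _ "\<lambda>\<delta>. s + c * \<delta>" 0 c UNIV] dB aff by simp
  have F0: "((\<lambda>\<delta>. F (s + c * \<delta>)) has_real_derivative F' * c) (at 0)"
    using DERIV_chain2[of F _ "\<lambda>\<delta>. s + c * \<delta>" 0 c UNIV] dF aff by simp
  have "(\<Psi> has_real_derivative exp (s / (c * \<epsilon>)) / c * (((\<epsilon> / 2 * (c * a)\<^sup>2 + b) * wed_weight \<epsilon> (s / c)) * c)
      + (- 1 / \<epsilon> * F s + F' * c)) (at 0)"
  proof -
    have "((\<lambda>\<delta>. exp (- \<delta> / \<epsilon>)) has_real_derivative - 1 / \<epsilon>) (at 0)"
      using \<epsilon> by (auto intro!: derivative_eq_intros simp: field_simps)
    from DERIV_add[OF DERIV_cmult[OF DERIV_diff[OF B0 DERIV_const]] DERIV_mult[OF this F0]]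
    show ?thesis unfolding \<Psi>_def by (rule DERIV_cong) simp
  qed
  moreover have "\<Psi> 0 \<le> \<Psi> y" if "0 \<le> y" for y using le[OF that] by (simp add: \<Psi>_def)
  ultimately have "0 \<le> exp (s / (c * \<epsilon>)) / c * (((\<epsilon> / 2 * (c * a)\<^sup>2 + b) * wed_weight \<epsilon> (s / c)) * c)
      + (- 1 / \<epsilon> * F s + F' * c)"
    by (rule right_minimum_derivative_nonneg)
  also have "exp (s / (c * \<epsilon>)) / c * (((\<epsilon> / 2 * (c * a)\<^sup>2 + b) * wed_weight \<epsilon> (s / c)) * c) =
      (\<epsilon> / 2 * (c * a)\<^sup>2 + b) * (exp (s / (c * \<epsilon>)) * wed_weight \<epsilon> (s / c))" using c by simp
  also have "exp (s / (c * \<epsilon>)) * wed_weight \<epsilon> (s / c) = 1 / \<epsilon>"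
    by (simp add: wed_weight_def exp_add[symmetric])
  finally show ?thesis using \<epsilon> by (simp add: field_simps power2_eq_square)
qed

text \<open>The function \<open>c \<mapsto> c\<^sup>2 / 2 * a\<^sup>2 + K + c * F'\<close> vanishes at \<open>c = 1\<close> and is nonnegative at points approaching 1 from both
  sides, so its derivative \<open>a\<^sup>2 + F'\<close> at 1 is zero. A sequence of values of \<open>c\<close> suffices, which keeps the
  exceptional sets countably many.\<close>

lemma stationary_speed:
  fixes a F' K :: real
  assumes eq: "0 = a\<^sup>2 / 2 + K + F'"
    and le: "\<And>n::nat. 0 \<le> (1 + 1 / (real n + 2))\<^sup>2 / 2 * a\<^sup>2 + K + (1 + 1 / (real n + 2)) * F'"
      "\<And>n::nat. 0 \<le> (1 - 1 / (real n + 2))\<^sup>2 / 2 * a\<^sup>2 + K + (1 - 1 / (real n + 2)) * F'"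
  shows "F' = - a\<^sup>2"
proof -
  have lim: "(\<lambda>n. 1 / (real n + 2)) \<longlonglongrightarrow> 0"
    using LIMSEQ_ignore_initial_segment[OF lim_1_over_n[where ?'a = real], of 2] by (simp add: add.commute)
  have K: "K = - a\<^sup>2 / 2 - F'" using eq by simp
  have "0 \<le> a\<^sup>2 + F' + 1 / (real n + 2) * (a\<^sup>2 / 2)" for n
  proof -
    define e where "e = 1 / (real n + 2)"
    have e: "e > 0" by (simp add: e_def)
    have "0 \<le> e * (a\<^sup>2 + F' + e * (a\<^sup>2 / 2))"
      using le(1)[of n] unfolding e_def[symmetric] K by (simp add: power2_eq_square algebra_simps add_divide_distrib)
    then show ?thesis using e unfolding e_def[symmetric] by (simp add: zero_le_mult_iff)
  qed
  then have "0 \<le> a\<^sup>2 + F' + 0 * (a\<^sup>2 / 2)"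
    by (intro LIMSEQ_le_const[OF tendsto_add[OF tendsto_const tendsto_mult[OF lim tendsto_const]]]) auto
  moreover have "0 \<le> - (a\<^sup>2 + F') + 1 / (real n + 2) * (a\<^sup>2 / 2)" for n
  proof -
    define e where "e = 1 / (real n + 2)"
    have e: "e > 0" by (simp add: e_def)
    have "0 \<le> e * (- (a\<^sup>2 + F') + e * (a\<^sup>2 / 2))"
      using le(2)[of n] unfolding e_def[symmetric] K by (simp add: power2_eq_square algebra_simps add_divide_distrib)
    then show ?thesis using e unfolding e_def[symmetric] by (simp add: zero_le_mult_iff)
  qed
  then have "0 \<le> - (a\<^sup>2 + F') + 0 * (a\<^sup>2 / 2)"
    by (intro LIMSEQ_le_const[OF tendsto_add[OF tendsto_const tendsto_mult[OF lim tendsto_const]]]) auto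
  ultimately show ?thesis by simp
qed

theorem proposition4p3:
  fixes \<sigma> :: "'a::complete_space topology"
    and \<phi> :: "'a \<Rightarrow> ereal"
    and A B \<epsilon> :: real
    and ustar x :: 'a
    and u :: "real \<Rightarrow> 'a"
  assumes "compatible \<sigma>"
    and "proper_fun \<phi>"
    and "LSCC \<sigma> \<phi> A B ustar"
    and "\<epsilon> > 0"
    and "1 / (16 * \<epsilon>) \<ge> B"
    and "x \<in> value_dom \<phi> \<epsilon>"
    and "u \<in> WED_minimizers \<phi> \<epsilon> x"
  shows "(\<forall>t\<ge>0. \<bar>value_fun \<phi> \<epsilon> (u t)\<bar> \<noteq> \<infinity>) \<and>
    (\<lambda>t. real_of_ereal (value_fun \<phi> \<epsilon> (u t))) \<in> AC_loc 1 {0..} \<and>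
    (AE t in lborel. t > 0 \<longrightarrow>
      (\<exists>D. ((\<lambda>s. real_of_ereal (value_fun \<phi> \<epsilon> (u s))) has_real_derivative D) (at t) \<and>
        ereal (- D) = ereal (1 / 2 * (metric_deriv u t)\<^sup>2) + ereal (1 / \<epsilon>) * \<phi> (u t)
                      - ereal (1 / \<epsilon>) * value_fun \<phi> \<epsilon> (u t) \<and>
        ereal (1 / 2 * (metric_deriv u t)\<^sup>2) + ereal (1 / \<epsilon>) * \<phi> (u t)
            - ereal (1 / \<epsilon>) * value_fun \<phi> \<epsilon> (u t)
          = ereal (1 / 2 * (metric_deriv u t)\<^sup>2) + ereal (1 / 2) * (G_fun \<phi> \<epsilon> (u t))\<^sup>2) \<and>
      value_fun \<phi> \<epsilon> (u t) = \<phi> (u t) - ereal (\<epsilon> / 2 * (metric_deriv u t)\<^sup>2))"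
proof -
  note \<epsilon> = assms(4) and min = assms(7)
  have coer: "coercive \<phi> A B ustar" and lsc0: "seq_lsc \<sigma> \<phi>" using assms(3) by (auto simp: LSCC_def)
  have lsc: "\<phi> l \<le> liminf (\<lambda>n. \<phi> (x n))" if "x \<longlonglongrightarrow> l" for x l
    using lsc_along_metric_limits[OF assms(1) lsc0 that] .
  have adm: "u \<in> admissible_curves \<epsilon> x" using min by (simp add: WED_minimizers_def)
  have "WED \<phi> \<epsilon> u \<le> value_fun \<phi> \<epsilon> x"
    unfolding value_fun_def using min by (intro INF_greatest) (auto simp: WED_minimizers_def)
  also have "\<dots> < \<infinity>" using assms(6) by (simp add: value_dom_def)
  finally obtain g f where fc: "finite_cost \<epsilon> \<phi> u g f"
    using finite_cost_exists[OF \<epsilon> lsc coer adm] by blast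
  note [measurable] = finite_cost_measurable[OF fc]
  define F where "F = (\<lambda>t. real_of_ereal (value_fun \<phi> \<epsilon> (u t)))"
  \<comment> \<open>the running cost of \<open>u\<close>, discounted to time 0\<close>
  define l where "l = (\<lambda>r. (\<epsilon> / 2 * (g r)\<^sup>2 + f r) * wed_weight \<epsilon> r)"
  define J where "J = wed_cost \<epsilon> g f"
  have val0: "value_fun \<phi> \<epsilon> (u t) = ereal (wed_cost \<epsilon> (\<lambda>h. g (t + h)) (\<lambda>h. f (t + h)))" if "t \<ge> 0" for t
    by (rule value_along_minimizer[OF \<epsilon> lsc coer min fc that])
  then have val: "value_fun \<phi> \<epsilon> (u t) = ereal (F t)" if "t \<ge> 0" for t using that by (simp add: F_def)
  have Fw: "F t = wed_cost \<epsilon> (\<lambda>h. g (t + h)) (\<lambda>h. f (t + h))" if "t \<ge> 0" for t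
    using val0[OF that] by (simp add: F_def)
  have Fl: "F t = exp (t / \<epsilon>) * (J - (LINT r:{0..t}|lborel. l r))" if "t \<ge> 0" for t
  proof -
    have "J - (LINT r:{0..t}|lborel. l r) = exp (- t / \<epsilon>) * F t"
      using wed_cost_split[OF \<epsilon> fc that] by (simp add: J_def l_def Fw[OF that])
    then show ?thesis by (simp add: exp_minus field_simps)
  qed
  have li: "set_integrable lborel {0..T} l" for T
    using reparametrized_cost_integrable[OF \<epsilon> fc zero_less_one, of T] by (simp add: l_def)
  have [measurable]: "l \<in> borel_measurable borel" unfolding l_def by measurable
  have AC: "F \<in> AC_loc 1 {0..}"
  proof -
    have "(\<lambda>t. exp (t / \<epsilon>) * (J - (LINT r:{0..t}|lborel. l r))) \<in> AC_loc 1 {0..}"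
      by (rule exp_times_indefinite_integral_AC_loc[OF \<epsilon> _ li]) measurable
    then show ?thesis
      unfolding AC_loc_def AC_def by (simp add: Fl[symmetric] subset_iff)
  qed
  define b where "b = (\<lambda>c r. (\<epsilon> / 2 * (c * g r)\<^sup>2 + f r) * wed_weight \<epsilon> (r / c))"
  \<comment> \<open>countably many speed factors on both sides of 1\<close>
  define C where "C = range (\<lambda>n::nat. 1 + 1 / (real n + 2)) \<union> range (\<lambda>n::nat. 1 - 1 / (real n + 2))"
  have Cpos: "c > 0" if "c \<in> C" for c
    using that by (auto simp: C_def field_simps)
  have dC: "AE t in lborel. \<forall>c\<in>C. t > 0 \<longrightarrow> ((\<lambda>s. LINT r:{0..s}|lborel. b c r) has_real_derivative b c t) (at t)"
  proof (subst AE_ball_countable)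
    show "countable C" by (simp add: C_def)
    show "\<forall>c\<in>C. AE t in lborel. t > 0 \<longrightarrow> ((\<lambda>s. LINT r:{0..s}|lborel. b c r) has_real_derivative b c t) (at t)"
      unfolding b_def using reparametrized_cost_integrable[OF \<epsilon> fc Cpos]
      by (intro ballI local_lebesgue_differentiation) auto
  qed
  have main: "AE t in lborel. t > 0 \<longrightarrow> (F has_real_derivative - (g t)\<^sup>2) (at t) \<and> F t = f t - \<epsilon> / 2 * (g t)\<^sup>2"
    using dC local_lebesgue_differentiation[OF li]
  proof (eventually_elim, intro impI)
    fix t :: real
    assume dC: "\<forall>c\<in>C. t > 0 \<longrightarrow> ((\<lambda>s. LINT r:{0..s}|lborel. b c r) has_real_derivative b c t) (at t)"
      and dl: "t > 0 \<longrightarrow> ((\<lambda>s. LINT r:{0..s}|lborel. l r) has_real_derivative l t) (at t)" and t: "t > 0"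
    define F' where "F' = F t / \<epsilon> - ((g t)\<^sup>2 / 2 + f t / \<epsilon>)"
    have dF: "(F has_real_derivative F') (at t)"
    proof (rule has_field_derivative_transform_within_open[of "\<lambda>t. exp (t / \<epsilon>) * (J - (LINT r:{0..t}|lborel. l r))" _ _ "{0<..}"])
      have "exp (t / \<epsilon>) * l t = (\<epsilon> / 2 * (g t)\<^sup>2 + f t) * (exp (t / \<epsilon>) * wed_weight \<epsilon> t)" by (simp add: l_def)
      also have "exp (t / \<epsilon>) * wed_weight \<epsilon> t = 1 / \<epsilon>" by (simp add: wed_weight_def exp_add[symmetric])
      finally have el: "exp (t / \<epsilon>) * l t = (g t)\<^sup>2 / 2 + f t / \<epsilon>" using \<epsilon> by (simp add: field_simps)
      have "((\<lambda>t. exp (t / \<epsilon>)) has_real_derivative exp (t / \<epsilon>) / \<epsilon>) (at t)"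
        using \<epsilon> by (auto intro!: derivative_eq_intros)
      from DERIV_mult[OF this DERIV_diff[OF DERIV_const dl[rule_format, OF t]]]
      show "((\<lambda>t. exp (t / \<epsilon>) * (J - (LINT r:{0..t}|lborel. l r))) has_real_derivative F') (at t)"
      proof (rule DERIV_cong)
        show "exp (t / \<epsilon>) / \<epsilon> * (J - (LINT r:{0..t}|lborel. l r)) + (0 - l t) * exp (t / \<epsilon>) = F'"
          using t Fl[of t] el by (simp add: F'_def mult.commute)
      qed
    qed (use t Fl in auto)
    have K: "0 \<le> c\<^sup>2 / 2 * (g t)\<^sup>2 + (f t / \<epsilon> - F t / \<epsilon>) + c * F'" if "c \<in> C" for c
    proof -
      have "0 \<le> c\<^sup>2 / 2 * (g t)\<^sup>2 + f t / \<epsilon> - F t / \<epsilon> + c * F'"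
      proof (rule first_variation_inequality[OF \<epsilon> Cpos[OF that] dF])
        show "((\<lambda>s. LINT r:{0..s}|lborel. b c r) has_real_derivative (\<epsilon> / 2 * (c * g t)\<^sup>2 + f t) * wed_weight \<epsilon> (t / c)) (at t)"
          using dC that t by (auto simp: b_def)
        show "F t \<le> exp (t / (c * \<epsilon>)) / c * ((LINT r:{0..t + c * \<delta>}|lborel. b c r) - (LINT r:{0..t}|lborel. b c r))
            + exp (- \<delta> / \<epsilon>) * F (t + c * \<delta>)" if "\<delta> \<ge> 0" for \<delta>
          unfolding b_def using t
          by (intro reparametrization_inequality[OF \<epsilon> fc _ Cpos[OF \<open>c \<in> C\<close>] that val Fw]) auto
      qed
      then show ?thesis by simp
    qed
    have "F' = - (g t)\<^sup>2"
    proof (rule stationary_speed)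
      show "0 = (g t)\<^sup>2 / 2 + (f t / \<epsilon> - F t / \<epsilon>) + F'" by (simp add: F'_def)
    qed (rule K; simp add: C_def)+
    moreover from this have "F t = f t - \<epsilon> / 2 * (g t)\<^sup>2" using \<epsilon> by (simp add: F'_def field_simps)
    ultimately show "(F has_real_derivative - (g t)\<^sup>2) (at t) \<and> F t = f t - \<epsilon> / 2 * (g t)\<^sup>2" using dF by simp
  qed
  have "AE t in lborel. t > 0 \<longrightarrow>
      (\<exists>D. (F has_real_derivative D) (at t) \<and>
        ereal (- D) = ereal (1 / 2 * (metric_deriv u t)\<^sup>2) + ereal (1 / \<epsilon>) * \<phi> (u t)
                      - ereal (1 / \<epsilon>) * value_fun \<phi> \<epsilon> (u t) \<and>
        ereal (1 / 2 * (metric_deriv u t)\<^sup>2) + ereal (1 / \<epsilon>) * \<phi> (u t)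
            - ereal (1 / \<epsilon>) * value_fun \<phi> \<epsilon> (u t)
          = ereal (1 / 2 * (metric_deriv u t)\<^sup>2) + ereal (1 / 2) * (G_fun \<phi> \<epsilon> (u t))\<^sup>2) \<and>
      value_fun \<phi> \<epsilon> (u t) = \<phi> (u t) - ereal (\<epsilon> / 2 * (metric_deriv u t)\<^sup>2)"
    using main metric_deriv_eq_speed[OF finite_cost_speed[OF fc]] finite_cost_AE[OF fc]
  proof (eventually_elim, intro impI)
    fix t
    assume "t > 0 \<longrightarrow> (F has_real_derivative - (g t)\<^sup>2) (at t) \<and> F t = f t - \<epsilon> / 2 * (g t)\<^sup>2"
      "t > 0 \<longrightarrow> metric_deriv u t = g t" "t > 0 \<longrightarrow> \<phi> (u t) = ereal (f t)" and t: "t > 0"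
    then have dF: "(F has_real_derivative - (g t)\<^sup>2) (at t)" and Ft: "F t = f t - \<epsilon> / 2 * (g t)\<^sup>2"
      and md: "metric_deriv u t = g t" and ph: "\<phi> (u t) = ereal (f t)" by auto
    have v: "value_fun \<phi> \<epsilon> (u t) = ereal (F t)" using val t by simp
    have "G_fun \<phi> \<epsilon> (u t) = ereal (g t)"
    proof -
      have "2 * (f t - F t) / \<epsilon> = (g t)\<^sup>2" using \<epsilon> by (simp add: Ft)
      moreover have "2 * (\<phi> (u t) - value_fun \<phi> \<epsilon> (u t)) / ereal \<epsilon> = ereal (2 * (f t - F t) / \<epsilon>)"
      proof -
        have "2 * ereal y = ereal (2 * y)" for y by (metis numeral_eq_ereal times_ereal.simps(1))
        then have "2 * (\<phi> (u t) - value_fun \<phi> \<epsilon> (u t)) = ereal (2 * (f t - F t))" by (simp only: ph v ereal_minus(1))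
        then show ?thesis using \<epsilon> by simp
      qed
      ultimately show ?thesis
        using is_speed_nonneg[OF finite_cost_speed[OF fc], of t]
        by (simp add: G_fun_def value_dom_def v ereal_sqrt_def)
    qed
    then show "(\<exists>D. (F has_real_derivative D) (at t) \<and>
        ereal (- D) = ereal (1 / 2 * (metric_deriv u t)\<^sup>2) + ereal (1 / \<epsilon>) * \<phi> (u t)
                      - ereal (1 / \<epsilon>) * value_fun \<phi> \<epsilon> (u t) \<and>
        ereal (1 / 2 * (metric_deriv u t)\<^sup>2) + ereal (1 / \<epsilon>) * \<phi> (u t)
            - ereal (1 / \<epsilon>) * value_fun \<phi> \<epsilon> (u t)
          = ereal (1 / 2 * (metric_deriv u t)\<^sup>2) + ereal (1 / 2) * (G_fun \<phi> \<epsilon> (u t))\<^sup>2) \<and>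
      value_fun \<phi> \<epsilon> (u t) = \<phi> (u t) - ereal (\<epsilon> / 2 * (metric_deriv u t)\<^sup>2)"
      using dF \<epsilon> by (intro conjI exI[of _ "- (g t)\<^sup>2"]) (auto simp: md ph v Ft field_simps)
  qed
  moreover have "\<forall>t\<ge>0. \<bar>value_fun \<phi> \<epsilon> (u t)\<bar> \<noteq> \<infinity>"
  proof (intro allI impI)
    show "\<bar>value_fun \<phi> \<epsilon> (u t)\<bar> \<noteq> \<infinity>" if "t \<ge> 0" for t unfolding val[OF that] by simp
  qed
  ultimately show ?thesis using AC unfolding F_def by blast
qed

end
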